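(* Let $n\ge 1$ and let $\nu\in\mathcal F$ with $\nu_{\min}\triangleq\min_{ij}\nu_{ij}>0$. Consider a family of $n\times n$ switch systems operating under the MaxWeight scheduling algorithm, parameterized by $0<\epsilon<1$, where system $\epsilon$ has arrival process $\mathbf a^{(\epsilon)}(t)$ with mean arrival rate vector $\lambda^{(\epsilon)}=(1-\epsilon)\nu$ (so the load is $\rho=1-\epsilon$) and variance vector $(\sigma^{(\epsilon)})^2=((\sigma_{ij}^{(\epsilon)})^2)_{ij}$. For each system the queue length process $\mathbf q^{(\epsilon)}(t)$ converges in distribution to a steady state random vector $\overline{\mathbf q}^{(\epsilon)}$. Then, for each system with $0<\epsilon\le \nu_{\min}/(2\|\nu\|)$, and for any $r\in\{2,3,\ldots\}$, $$\left(1-\frac1{2n}\right)\frac{\|\sigma^{(\epsilon)}\|^2}{\epsilon}-B_1(\epsilon,n)\le \mathbb E\Big[\sum_{ij}\overline q_{ij}^{(\epsilon)}\Big]\le \left(1-\frac1{2n}\right)\frac{\|\sigma^{(\epsilon)}\|^2}{\epsilon}+B_2(\epsilon,n),$$ where $$B_1(\epsilon,n)=-\frac{n\epsilon}{2}+n+3n^{2-\frac1r}\epsilon^{-\frac1r}M_r^{(\epsilon)},\qquad B_2(\epsilon,n)=\frac{n(1+\epsilon)}{2}+2n^{2-\frac1r}\epsilon^{-\frac1r}M_r^{(\epsilon)},$$ $$M_r^{(\epsilon)}=2^{1/r}\max\left(\frac{8(\|\lambda^{(\epsilon)}\|^2+\|\sigma^{(\epsilon)}\|^2+n)}{\nu_{\min}},\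 (\sqrt r\,e)^{1/r}\,16\,\frac re\,\frac{n a_{\max}}{\nu_{\min}}\,(n a_{\max}+1)\right).$$ The terms $B_1(\epsilon,n)$ and $B_2(\epsilon,n)$ are both $o(1/\epsilon)$, i.e. $\lim_{\epsilon\downarrow0}\epsilon B_1(\epsilon,n)=0$ and $\lim_{\epsilon\downarrow0}\epsilon B_2(\epsilon,n)=0$. Therefore, in the heavy traffic limit $\epsilon\downarrow0$ (so that $\lambda^{(\epsilon)}\to\nu$), if $(\sigma^{(\epsilon)})^2\to\sigma^2=(\sigma_{ij}^2)_{ij}$, then $$\lim_{\epsilon\downarrow0}\epsilon\,\mathbb E\Big[\sum_{ij}\overline q_{ij}^{(\epsilon)}\Big]=\left(1-\frac1{2n}\right)\|\sigma\|^2 .$$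
   Context: Vectors $x=(x_{ij})_{1\le i,j\le n}$ live in $\mathbb R^{n^2}$ with inner product $\langle x,y\rangle=\sum_{ij}x_{ij}y_{ij}$ and Euclidean norm $\|x\|$; in particular $\|\sigma\|^2=\sum_{ij}\sigma_{ij}^2$. Switch model (discrete time). $q_{ij}(t)\in\mathbb Z_+$ is the queue length for the input-output pair $(i,j)$, $a_{ij}(t)\in\mathbb Z_+$ is the number of arrivals to it in slot $t$. For each $(i,j)$ the $a_{ij}(t)$ are i.i.d. across $t$ with mean $\lambda_{ij}$ and variance $\sigma_{ij}^2$; arrivals are independent across pairs $(i,j)$ and independent of the queue lengths and schedules. Arrivals satisfy $a_{ij}(t)\le a_{\max}$ for a constant $a_{\max}\ge1$ not depending on $\epsilon$, and $P(a_{ij}(t)=0)>\epsilon_a$ for some $\epsilon_a>0$. Feasible schedules: $\mathcal S=\{s\in\{0,1\}^{n^2}:\sum_i s_{ij}\le1\ \forall j,\ \sum_j s_{ij}\le1\ \forall i\}$; maximal schedules: $\mathcal S^*=\{s\in\{0,1\}^{n^2}:\sum_i s_{ij}=1\ \forall j,\ \sum_j s_{ij}=1\ \forall i\}$. Queues evolve as $q_{ij}(t+1)=[q_{ij}(t)+a_{ij}(t)-s_{ij}(t)]^+$, where $\mathbf s(t)$ is chosen from $\mathbf q(t)$ before the arrivals $\mathbf a(t)$ occur. MaxWeight algorithm: $\mathbf s(t)\in\arg\max_{s\in\mathcal S}\langle \mathbf q(t),s\rangle$, ties broken uniformly at random; the chosen schedule is always taken to be a maximal one, $\mathbf s(t)\in\mathcal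 S^*$ (the maximum over $\mathcal S$ is always attained in $\mathcal S^*$). Under it, $\mathbf q(t)$ is an irreducible aperiodic Markov chain (on the appropriate state space), positive recurrent when the load $\max\{\max_j\sum_i\lambda_{ij},\max_i\sum_j\lambda_{ij}\}$ is less than $1$. $\mathcal F=\{\lambda\in\mathbb R_+^{n^2}:\sum_i\lambda_{ij}=1\ \forall j,\ \sum_j\lambda_{ij}=1\ \forall i\}$. *)

theory Defs
  imports "HOL-Probability.Probability"
begin

section \<open>Schedules and MaxWeight\<close>

text \<open>
  An \<open>n \<times> n\<close> array indexed by (input, output) is a \<open>vec\<close> of \<open>vec\<close>s over a finite index
  type \<open>'n\<close>, with \<open>n = CARD('n)\<close>. On \<^typ>\<open>real^'n^'n\<close> the library norm is the Euclidean norm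
  of the \<open>n\<^sup>2\<close> entries. Queue lengths, arrivals and schedules have natural-number entries.
\<close>

definition schedules :: "(nat^'n::finite^'n) set" where
  "schedules = {s. (\<forall>i j. s $ i $ j \<in> {0, 1}) \<and>
                   (\<forall>j. (\<Sum>i\<in>UNIV. s $ i $ j) \<le> 1) \<and>
                   (\<forall>i. (\<Sum>j\<in>UNIV. s $ i $ j) \<le> 1)}"

definition maximal_schedules :: "(nat^'n::finite^'n) set" where
  "maximal_schedules = {s. (\<forall>i j. s $ i $ j \<in> {0, 1}) \<and>
                           (\<forall>j. (\<Sum>i\<in>UNIV. s $ i $ j) = 1) \<and>
                           (\<forall>i. (\<Sum>j\<in>UNIV. s $ i $ j) = 1)}"

definition weight :: "nat^'n::finite^'n \<Rightarrow> nat^'n^'n \<Rightarrow> nat" where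
  "weight q s = (\<Sum>i\<in>UNIV. \<Sum>j\<in>UNIV. q $ i $ j * s $ i $ j)"

text \<open>The maximum is taken over all feasible schedules, but only maximal schedules are used.\<close>

definition maxweight_schedules :: "nat^'n::finite^'n \<Rightarrow> (nat^'n^'n) set" where
  "maxweight_schedules q =
     {s \<in> maximal_schedules. \<forall>s'\<in>schedules. weight q s' \<le> weight q s}"

section \<open>The switch\<close>

text \<open>
  One switch system on the probability space \<open>M\<close>, with arbitrary random initial queue
  lengths. The past before slot \<open>t\<close> consists of queue lengths, schedules and arrivals of all
  earlier slots. Given the past and \<open>q t\<close>, the schedule \<open>s t\<close> is uniform on the MaxWeight
  schedules for \<open>q t\<close>; the arrivals \<open>a t\<close> are independent of the past, \<open>q t\<close> and \<open>s t\<close>.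
  All these variables are discrete, so the conditional law of \<open>s t\<close> is given by elementary
  conditional probabilities, multiplied out.
\<close>

definition past ::
  "(nat \<Rightarrow> 'w \<Rightarrow> 'a) \<Rightarrow> (nat \<Rightarrow> 'w \<Rightarrow> 'b) \<Rightarrow> (nat \<Rightarrow> 'w \<Rightarrow> 'c) \<Rightarrow> nat \<Rightarrow> 'w \<Rightarrow> ('a \<times> 'b \<times> 'c) list"
  where "past q s a t \<omega> = map (\<lambda>\<tau>. (q \<tau> \<omega>, s \<tau> \<omega>, a \<tau> \<omega>)) [0..<t]"

locale maxweight_switch = prob_space M
  for M :: "'w measure" +
  fixes a_max :: real
    and lam sd :: "real^'n::finite^'n"
    and a s q :: "nat \<Rightarrow> 'w \<Rightarrow> nat^'n^'n"
  assumes a_measurable: "\<And>t. random_variable (count_space UNIV) (a t)"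
    and s_measurable: "\<And>t. random_variable (count_space UNIV) (s t)"
    and q_measurable: "\<And>t. random_variable (count_space UNIV) (q t)"
    and arrivals_indep:
      "indep_vars (\<lambda>_. count_space UNIV) (\<lambda>(t, i, j) \<omega>. a t \<omega> $ i $ j) UNIV"
    and arrivals_identical:
      "\<And>t i j. distr M (count_space UNIV) (\<lambda>\<omega>. a t \<omega> $ i $ j)
             = distr M (count_space UNIV) (\<lambda>\<omega>. a 0 \<omega> $ i $ j)"
    and arrivals_mean: "\<And>t i j. expectation (\<lambda>\<omega>. real (a t \<omega> $ i $ j)) = lam $ i $ j"
    and arrivals_variance: "\<And>t i j. variance (\<lambda>\<omega>. real (a t \<omega> $ i $ j)) = (sd $ i $ j)\<^sup>2"
    and arrivals_bounded: "\<And>t i j \<omega>. \<omega> \<in> space M \<Longrightarrow> real (a t \<omega> $ i $ j) \<le> a_max"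
    and arrivals_zero:
      "\<exists>\<epsilon>\<^sub>a>0. \<forall>t i j. \<epsilon>\<^sub>a < prob {\<omega> \<in> space M. a t \<omega> $ i $ j = 0}"
    and arrivals_indep_past:
      "\<And>t. indep_set {a t -` A \<inter> space M | A. A \<in> UNIV}
                     {(\<lambda>\<omega>. (past q s a t \<omega>, q t \<omega>, s t \<omega>)) -` B \<inter> space M | B. B \<in> UNIV}"
    and maxweight:
      "\<And>t h x y. prob {\<omega> \<in> space M. past q s a t \<omega> = h \<and> q t \<omega> = x \<and> s t \<omega> = y}
               = prob {\<omega> \<in> space M. past q s a t \<omega> = h \<and> q t \<omega> = x}
                 * pmf (pmf_of_set (maxweight_schedules x)) y"
    \<comment> \<open>truncated subtraction on \<^typ>\<open>nat\<close> is the positive part\<close>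
    and queue_evolution:
      "\<And>t \<omega> i j. \<omega> \<in> space M \<Longrightarrow>
         q (Suc t) \<omega> $ i $ j = q t \<omega> $ i $ j + a t \<omega> $ i $ j - s t \<omega> $ i $ j"

text \<open>
  The weak convergence of the library covers measures on \<^typ>\<open>real\<close> only; this is the usual
  definition on a topological space. It is used for laws on the discrete space \<^typ>\<open>nat^'n^'n\<close>.
\<close>

definition converges_in_distribution ::
  "(nat \<Rightarrow> 'a::topological_space measure) \<Rightarrow> 'a measure \<Rightarrow> bool" where
  "converges_in_distribution \<mu> \<pi> \<longleftrightarrow>
     (\<forall>f::'a \<Rightarrow> real. continuous_on UNIV f \<longrightarrow> bounded (range f) \<longrightarrow>
        (\<lambda>t. integral\<^sup>L (\<mu> t) f) \<longlonglongrightarrow> integral\<^sup>L \<pi> f)"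

definition total_queue :: "nat^'n::finite^'n \<Rightarrow> real" where
  "total_queue q = (\<Sum>i\<in>UNIV. \<Sum>j\<in>UNIV. real (q $ i $ j))"

section \<open>Rates and error terms\<close>

definition doubly_stochastic :: "(real^'n::finite^'n) set" where
  "doubly_stochastic = {x. (\<forall>i j. 0 \<le> x $ i $ j) \<and>
                           (\<forall>j. (\<Sum>i\<in>UNIV. x $ i $ j) = 1) \<and>
                           (\<forall>i. (\<Sum>j\<in>UNIV. x $ i $ j) = 1)}"

definition min_entry :: "real^'n::finite^'n \<Rightarrow> real" where
  "min_entry x = Min (range (\<lambda>(i, j). x $ i $ j))"

definition M_const ::
  "nat \<Rightarrow> real \<Rightarrow> real^'n::finite^'n \<Rightarrow> real^'n^'n \<Rightarrow> real^'n^'n \<Rightarrow> real" where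
  "M_const r a_max nu lam sd =
     (let n = real CARD('n) in
      2 powr (1 / real r) *
      max (8 * ((norm lam)\<^sup>2 + (norm sd)\<^sup>2 + n) / min_entry nu)
          ((sqrt (real r) * exp 1) powr (1 / real r) * 16 * (real r / exp 1)
             * (n * a_max / min_entry nu) * (n * a_max + 1)))"

definition B1 ::
  "nat \<Rightarrow> real \<Rightarrow> real^'n::finite^'n \<Rightarrow> real^'n^'n \<Rightarrow> real^'n^'n \<Rightarrow> real \<Rightarrow> real" where
  "B1 r a_max nu lam sd \<epsilon> =
     (let n = real CARD('n) in
      - (n * \<epsilon> / 2) + n
      + 3 * n powr (2 - 1 / real r) * \<epsilon> powr (- 1 / real r) * M_const r a_max nu lam sd)"

definition B2 ::
  "nat \<Rightarrow> real \<Rightarrow> real^'n::finite^'n \<Rightarrow> real^'n^'n \<Rightarrow> real^'n^'n \<Rightarrow> real \<Rightarrow> real" where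
  "B2 r a_max nu lam sd \<epsilon> =
     (let n = real CARD('n) in
      n * (1 + \<epsilon>) / 2
      + 2 * n powr (2 - 1 / real r) * \<epsilon> powr (- 1 / real r) * M_const r a_max nu lam sd)"

end

theory Submission
  imports Defs
begin

text \<open>
  Arrivals are bounded and MaxWeight has a negative drift, so \<open>exp (\<theta> \<parallel>q\<parallel>)\<close> is a Lyapunov function.
  Together with the accessible state \<open>0\<close>, which has a self-loop, Harris' argument (contraction of
  a weighted oscillation under an independent coupling) gives a stationary law with all moments
  and convergence to it.

  State space collapse: LP duality for the assignment problem bounds \<open>\<langle>q, x\<rangle>\<close> by the MaxWeight
  value for every doubly substochastic \<open>x\<close>. Taking for \<open>x\<close> a perturbation of \<open>\<nu>\<close> towards \<open>q\<close> minus
  its projection on the cone \<open>\<K>\<close> of matrices \<open>w\<^sub>i + v\<^sub>j\<close> shows that the distance of \<open>q\<close> to \<open>\<K>\<close> has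
  drift at most \<open>-\<nu>\<^sub>m\<^sub>i\<^sub>n / 4\<close> once it is large. With bounded increments this forces geometric tails in
  steady state and the moment bound \<open>M\<^sub>r\<close>, uniformly in \<open>\<epsilon>\<close>.

  Setting to zero the stationary drift of the squared norm of the projection of \<open>q\<close> onto the span
  of \<open>\<K>\<close> yields \<open>2 \<epsilon> E [\<Sum> q] = (2 - 1/n) \<parallel>\<sigma>\<parallel>\<^sup>2 + n \<epsilon>\<^sup>2\<close> plus terms in the unused service \<open>u\<close>.
  Since \<open>u\<close> is orthogonal to the next queue vector, the cross term only sees the distance to \<open>\<K>\<close>,
  and \<open>E [\<Sum> u] = n \<epsilon>\<close>.
\<close>

section \<open>Assignment duality\<close>

text \<open>Every use of stationarity needs the function concerned to be integrable. The exponential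
  Lyapunov function supplies these moments, but its drift is of order \<epsilon> and would spoil the
  error terms, so it is used qualitatively only. The quantitative estimates rest on the distance to
  the cone, whose drift survives \<epsilon> \<rightarrow> 0: passing from \<nu> to \<lambda> costs
  at most \<open>\<epsilon> * norm nu\<close> per unit of distance, and the condition
  \<open>\<epsilon> \<le> min_entry nu / (2 * norm nu)\<close> keeps this below half of
  \<open>min_entry nu\<close>.

  The two entries of the maximum in \<open>M_const\<close> come from the two parts of the moment
  bound, the drift threshold and the geometric excess above it; a Stirling estimate of
  \<open>fact r\<close> produces the factors in r. The factor 1 - 1/(2n) arises because an entry's
  variance is counted once through its row, once through its column and -1/n times through the
  total, and is then halved.\<close>

text \<open>Rado's argument: if Hall's condition survived neither the removal of \<open>x\<close> nor that of \<open>y\<close>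
  from \<open>A i\<close>, the two violating families would contradict the submodularity of the cardinality
  of the union.\<close>

lemma hall:
  fixes A :: "'a \<Rightarrow> 'b set"
  assumes "finite I" "\<And>i. i \<in> I \<Longrightarrow> finite (A i)"
    and "\<And>J. J \<subseteq> I \<Longrightarrow> card J \<le> card (\<Union>(A ` J))"
  shows "\<exists>f. inj_on f I \<and> (\<forall>i\<in>I. f i \<in> A i)"
  using assms(2,3)
proof (induction "\<Sum>i\<in>I. card (A i)" arbitrary: A rule: less_induct)
  case less
  show ?case
  proof (cases "\<forall>i\<in>I. card (A i) \<le> 1")
    case True
    have "card (A i) = 1" if "i \<in> I" for i
      using less.prems(2)[of "{i}"] that True by force
    then have "\<forall>i\<in>I. \<exists>z. A i = {z}"
      by (auto simp: card_1_singleton_iff)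
    then obtain f where f: "\<And>i. i \<in> I \<Longrightarrow> A i = {f i}"
      by (auto dest: bchoice)
    have "inj_on f I"
    proof (rule inj_onI)
      fix i j assume ij: "i \<in> I" "j \<in> I" "f i = f j"
      have "card {i, j} \<le> card (\<Union>(A ` {i, j}))"
        using ij by (intro less.prems) auto
      also have "\<Union>(A ` {i, j}) = {f i}"
        using f ij by auto
      finally show "i = j"
        by (cases "i = j") auto
    qed
    then show ?thesis
      using f by blast
  next
    case False
    then obtain i where i: "i \<in> I" "2 \<le> card (A i)"
      by force
    then obtain x y where xy: "x \<in> A i" "y \<in> A i" "x \<noteq> y"
      by (metis card_2_iff' obtain_subset_with_card_n subsetD)
    have drop_violates: "\<exists>J\<subseteq>I - {i}. card (\<Union>(A ` J) \<union> (A i - {z})) \<le> card J"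
      if no: "\<nexists>f. inj_on f I \<and> (\<forall>k\<in>I. f k \<in> A k)" and z: "z \<in> A i" for z
    proof -
      let ?A = "A(i := A i - {z})"
      have "(\<Sum>k\<in>I. card (?A k)) < (\<Sum>k\<in>I. card (A k))"
        using i z less.prems(1) assms(1)
        by (intro sum_strict_mono_ex1) (auto intro!: card_Diff1_less card_Diff1_le bexI[of _ i])
      moreover have "\<not> (\<exists>f. inj_on f I \<and> (\<forall>k\<in>I. f k \<in> ?A k))"
      proof
        assume "\<exists>f. inj_on f I \<and> (\<forall>k\<in>I. f k \<in> ?A k)"
        then obtain f where f: "inj_on f I" "\<And>k. k \<in> I \<Longrightarrow> f k \<in> ?A k" by blast
        have "f k \<in> A k" if "k \<in> I" for k
          using f(2)[OF that] by (cases "k = i") auto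
        then show False using no f(1) by blast
      qed
      moreover have "finite (?A k)" if "k \<in> I" for k
        using less.prems(1) that by auto
      ultimately obtain J where J: "J \<subseteq> I" "card (\<Union>(?A ` J)) < card J"
        using less.hyps[of ?A] by (meson not_le)
      have "i \<in> J"
      proof (rule ccontr)
        assume "i \<notin> J"
        then have "?A ` J = A ` J" by auto
        then show False using J less.prems(2)[of J] by simp
      qed
      have "\<Union>(?A ` J) = \<Union>(?A ` (J - {i})) \<union> ?A i"
        using \<open>i \<in> J\<close> by blast
      also have "?A ` (J - {i}) = A ` (J - {i})"
        by (intro image_cong) auto
      finally have "\<Union>(?A ` J) = \<Union>(A ` (J - {i})) \<union> (A i - {z})"
        by simp
      moreover have "card J = Suc (card (J - {i}))"
        using \<open>i \<in> J\<close> J assms(1) by (metis card.remove finite_subset)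
      ultimately have "card (\<Union>(A ` (J - {i})) \<union> (A i - {z})) \<le> card (J - {i})"
        using J by simp
      then show ?thesis
        using J by (intro exI[of _ "J - {i}"]) auto
    qed
    show ?thesis
    proof (rule ccontr)
      assume no: "\<nexists>f. inj_on f I \<and> (\<forall>k\<in>I. f k \<in> A k)"
      obtain J1 where J1: "J1 \<subseteq> I - {i}" "card (\<Union>(A ` J1) \<union> (A i - {x})) \<le> card J1"
        using drop_violates[OF no xy(1)] by auto
      obtain J2 where J2: "J2 \<subseteq> I - {i}" "card (\<Union>(A ` J2) \<union> (A i - {y})) \<le> card J2"
        using drop_violates[OF no xy(2)] by auto
      let ?U1 = "\<Union>(A ` J1) \<union> (A i - {x})" and ?U2 = "\<Union>(A ` J2) \<union> (A i - {y})"
      have fin: "finite J1" "finite J2"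
        using J1 J2 assms(1) by (auto intro: finite_subset)
      have finU: "finite ?U1" "finite ?U2"
        using J1 J2 i less.prems(1) fin by auto
      have "card J1 + card J2 + 1 = card (insert i (J1 \<union> J2)) + card (J1 \<inter> J2)"
        using J1 J2 fin card_Un_Int[of J1 J2] by (subst card_insert_disjoint) auto
      also have "\<dots> \<le> card (\<Union>(A ` insert i (J1 \<union> J2))) + card (\<Union>(A ` (J1 \<inter> J2)))"
        using J1 J2 i by (intro add_mono less.prems(2)) auto
      \<comment> \<open>As \<open>x \<noteq> y\<close>, the sets \<open>A i - {x}\<close> and
        \<open>A i - {y}\<close> together cover \<open>A i\<close>, so the first union lies in
        \<open>?U1 \<union> ?U2\<close>.\<close>
      also have "\<dots> \<le> card (?U1 \<union> ?U2) + card (?U1 \<inter> ?U2)"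
        using finU xy by (intro add_mono card_mono) auto
      also have "\<dots> = card ?U1 + card ?U2"
        using card_Un_Int[OF finU] by simp
      finally show False
        using J1 J2 by simp
    qed
  qed
qed

text \<open>The dual is minimised over integers; if the tight pairs admitted no perfect matching,
  a Hall violator would allow the dual value to be decreased.\<close>

lemma integer_assignment_duality:
  fixes c :: "'n::finite \<Rightarrow> 'n \<Rightarrow> int"
  shows "\<exists>w v f. (\<forall>i j. c i j \<le> w i + v j) \<and> bij f \<and> (\<forall>i. c i (f i) = w i + v (f i))"
proof -
  define feasible where "feasible = (\<lambda>(w, v). \<forall>i j. c i j \<le> w i + v j)"
  \<comment> \<open>Subtracting the primal value of the identity permutation makes the dual value
    nonnegative on feasible pairs, so \<open>nat\<close> loses nothing there and a least value
    exists.\<close>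
  define val :: "('n \<Rightarrow> int) \<times> ('n \<Rightarrow> int) \<Rightarrow> nat" where
    "val = (\<lambda>(w, v). nat ((\<Sum>i\<in>UNIV. w i) + (\<Sum>j\<in>UNIV. v j) - (\<Sum>i\<in>UNIV. c i i)))"
  have dual_ge: "(\<Sum>i\<in>UNIV. c i i) \<le> (\<Sum>i\<in>UNIV. w i) + (\<Sum>j\<in>UNIV. v j)" if "feasible (w, v)" for w v
    using that by (auto simp: feasible_def sum.distrib[symmetric] intro!: sum_mono)
  have "feasible (\<lambda>i. Max (range (\<lambda>(i, j). c i j)), \<lambda>_. 0)"
    unfolding feasible_def by (auto intro!: Max_ge)
  then obtain wv where wv: "feasible wv" and min: "\<And>wv'. feasible wv' \<Longrightarrow> val wv \<le> val wv'"
    using ex_has_least_nat[of feasible _ val] by blast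
  obtain w v where eq: "wv = (w, v)" by force
  define A where "A i = {j. c i j = w i + v j}" for i
  have hall_cond: "card J \<le> card (\<Union>(A ` J))" for J
  proof (rule ccontr)
    assume less: "\<not> ?thesis"
    define N where "N = \<Union>(A ` J)"
    \<comment> \<open>Over the integers a pair that is not tight has slack at least 1, so lowering
      \<open>w\<close> by 1 on \<open>J\<close> is harmless except at tight pairs, which raising
      \<open>v\<close> on \<open>N\<close> repairs. The dual value changes by
      \<open>card N - card J\<close>, which is negative.\<close>
    define w' where "w' i = w i - (if i \<in> J then 1 else 0)" for i
    define v' where "v' j = v j + (if j \<in> N then 1 else 0)" for j
    have tight: "c i j < w i + v j" if "j \<notin> A i" for i j
      using wv that unfolding feasible_def eq A_def by (simp add: less_le)
    have w_v_feasible: "c i j \<le> w i + v j" for i j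
      using wv unfolding feasible_def eq by simp
    have "feasible (w', v')"
      unfolding feasible_def w'_def v'_def
    proof (simp only: prod.case, intro allI)
      fix i j
      show "c i j \<le> w i - (if i \<in> J then 1 else 0) + (v j + (if j \<in> N then 1 else 0))"
        using tight[of j i] w_v_feasible[of i j] by (cases "i \<in> J"; cases "j \<in> A i") (auto simp: N_def)
    qed
    moreover have "(\<Sum>i\<in>UNIV. w' i) = (\<Sum>i\<in>UNIV. w i) - int (card J)"
      "(\<Sum>j\<in>UNIV. v' j) = (\<Sum>j\<in>UNIV. v j) + int (card N)"
      by (simp_all add: w'_def v'_def sum_subtractf sum.distrib sum.If_cases)
    ultimately show False
      using less min[of "(w', v')"] dual_ge[of w' v'] by (simp add: eq val_def N_def[symmetric])
  qed
  obtain f where f: "inj f" "\<forall>i. f i \<in> A i"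
    using hall[of UNIV A] hall_cond by auto
  then have "bij f"
    by (simp add: bij_def finite_UNIV_inj_surj)
  then show ?thesis
    using f wv unfolding eq feasible_def A_def by auto
qed


section \<open>MaxWeight schedules\<close>

definition real_mat :: "nat^'n::finite^'n \<Rightarrow> real^'n^'n" where
  "real_mat q = (\<chi> i j. real (q $ i $ j))"

lemma real_mat_nth [simp]: "real_mat q $ i $ j = real (q $ i $ j)"
  by (simp add: real_mat_def)

lemma inner_matrix: "x \<bullet> y = (\<Sum>i\<in>UNIV. \<Sum>j\<in>UNIV. x $ i $ j * y $ i $ j)" for x y :: "real^'n::finite^'m::finite"
  by (simp add: inner_vec_def)

lemma norm_matrix_sq: "(norm x)\<^sup>2 = (\<Sum>i\<in>UNIV. \<Sum>j\<in>UNIV. (x $ i $ j)\<^sup>2)" for x :: "real^'n::finite^'m::finite"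
  unfolding power2_norm_eq_inner inner_matrix by (simp add: power2_eq_square)

lemma real_weight: "real (weight q s) = real_mat q \<bullet> real_mat s"
  by (simp add: weight_def inner_matrix)

definition row_sum :: "'a::comm_monoid_add^'n::finite^'n \<Rightarrow> 'n \<Rightarrow> 'a" where
  "row_sum x i = (\<Sum>j\<in>UNIV. x $ i $ j)"

definition col_sum :: "'a::comm_monoid_add^'n::finite^'n \<Rightarrow> 'n \<Rightarrow> 'a" where
  "col_sum x j = (\<Sum>i\<in>UNIV. x $ i $ j)"

definition substochastic :: "real^'n::finite^'n \<Rightarrow> bool" where
  "substochastic x \<longleftrightarrow>
     (\<forall>i j. 0 \<le> x $ i $ j) \<and> (\<forall>i. row_sum x i \<le> 1) \<and> (\<forall>j. col_sum x j \<le> 1)"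

lemma sum_row_sum_eq_sum_col_sum: "(\<Sum>i\<in>UNIV. row_sum x i) = (\<Sum>j\<in>UNIV. col_sum x j)"
  unfolding row_sum_def col_sum_def by (rule sum.swap)

text \<open>Row deficits and column deficits have the same sum \<open>d\<close>, so the rank-one
  matrix of deficit products over \<open>d\<close> fills every row and column exactly.\<close>

lemma substochastic_extend:
  fixes x :: "real^'n::finite^'n"
  assumes "substochastic x"
  obtains y where "\<And>i j. x $ i $ j \<le> y $ i $ j" "\<And>i. row_sum y i = 1" "\<And>j. col_sum y j = 1"
proof -
  define d where "d = (\<Sum>i\<in>UNIV. 1 - row_sum x i)"
  have d': "d = (\<Sum>j\<in>UNIV. 1 - col_sum x j)"
    by (simp add: d_def sum_subtractf sum_row_sum_eq_sum_col_sum)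
  have le: "row_sum x i \<le> 1" "col_sum x i \<le> 1" for i
    using assms by (auto simp: substochastic_def)
  have zero: "row_sum x i = 1" "col_sum x i = 1" if "d = 0" for i
    using that le sum_nonneg_eq_0_iff[of UNIV "\<lambda>i. 1 - row_sum x i"]
      sum_nonneg_eq_0_iff[of UNIV "\<lambda>i. 1 - col_sum x i"]
    by (simp_all add: d_def d'[unfolded d_def])
  \<comment> \<open>If \<open>d = 0\<close>, division by zero gives 0 and \<open>y = x\<close>; all
    deficits vanish then, so the sums are already 1.\<close>
  define y where "y = (\<chi> i j. x $ i $ j + (1 - row_sum x i) * (1 - col_sum x j) / d)"
  have "d \<ge> 0"
    unfolding d_def using le by (intro sum_nonneg) simp
  then have "x $ i $ j \<le> y $ i $ j" for i j
    using le by (simp add: y_def)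
  moreover have "row_sum y i = row_sum x i + (1 - row_sum x i) * d / d" for i
    unfolding y_def row_sum_def by (simp add: sum.distrib d' row_sum_def sum_divide_distrib sum_distrib_left)
  moreover have "col_sum y j = col_sum x j + (1 - col_sum x j) * d / d" for j
  proof -
    have "col_sum y j = col_sum x j + (\<Sum>i\<in>UNIV. (1 - row_sum x i) * ((1 - col_sum x j) / d))"
      unfolding y_def col_sum_def by (simp add: sum.distrib)
    also have "\<dots> = col_sum x j + d * ((1 - col_sum x j) / d)"
      unfolding d_def sum_distrib_right ..
    finally show ?thesis by (simp add: mult.commute)
  qed
  ultimately show ?thesis
    using that[of y] zero by (cases "d = 0") auto
qed

lemma finite_maximal_schedules: "finite (maximal_schedules :: (nat^'n::finite^'n) set)"
proof -
  have "maximal_schedules \<subseteq> (\<lambda>f :: 'n \<Rightarrow> 'n \<Rightarrow> nat. \<chi> i j. f i j) ` (UNIV \<rightarrow>\<^sub>E (UNIV \<rightarrow>\<^sub>E {0, 1 :: nat}))"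
  proof
    fix s :: "nat^'n^'n" assume "s \<in> maximal_schedules"
    then show "s \<in> (\<lambda>f :: 'n \<Rightarrow> 'n \<Rightarrow> nat. \<chi> i j. f i j) ` (UNIV \<rightarrow>\<^sub>E (UNIV \<rightarrow>\<^sub>E {0, 1 :: nat}))"
      by (intro image_eqI[of _ _ "\<lambda>i j. s $ i $ j"]) (force simp: maximal_schedules_def)+
  qed
  then show ?thesis
    by (rule finite_subset) (intro finite_imageI finite_PiE; simp)
qed

text \<open>The permutation given by duality attains the dual value, and weak duality bounds all
  competitors. The dual variables may be negative, so inequalities on row and column sums would not
  suffice: \<open>x\<close> is first enlarged to a matrix whose sums are exactly 1, which does not
  lower the inner product because \<open>q\<close> is nonnegative.\<close>

lemma optimal_maximal_schedule:
  fixes q :: "nat^'n::finite^'n"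
  shows "\<exists>s\<in>maximal_schedules. \<forall>x. substochastic x \<longrightarrow> real_mat q \<bullet> x \<le> real (weight q s)"
proof -
  obtain w v :: "'n \<Rightarrow> int" and f where wv: "\<And>i j. int (q $ i $ j) \<le> w i + v j"
    and f: "bij f" "\<And>i. int (q $ i $ f i) = w i + v (f i)"
    using integer_assignment_duality[of "\<lambda>i j. int (q $ i $ j)"] by blast
  define s :: "nat^'n^'n" where "s = (\<chi> i j. if j = f i then 1 else 0)"
  have "(\<Sum>i\<in>UNIV. if j = f i then 1 else 0) = (1::nat)" for j
  proof -
    have "(\<Sum>i\<in>UNIV. if j = f i then 1 else 0) = (\<Sum>k\<in>UNIV. if j = k then 1 else (0::nat))"
      using f(1) by (rule sum.reindex_bij_betw)
    then show ?thesis by simp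
  qed
  then have s: "s \<in> maximal_schedules"
    by (auto simp: s_def maximal_schedules_def)
  have "int (weight q s) = (\<Sum>i\<in>UNIV. int (q $ i $ f i))"
    by (simp add: weight_def s_def if_distrib[of "(*) _"] cong: if_cong)
  also have "\<dots> = (\<Sum>i\<in>UNIV. w i) + (\<Sum>i\<in>UNIV. v (f i))"
    by (simp add: f sum.distrib)
  also have "(\<Sum>i\<in>UNIV. v (f i)) = (\<Sum>j\<in>UNIV. v j)"
    using f(1) by (rule sum.reindex_bij_betw)
  finally have weight_s: "real (weight q s) = (\<Sum>i\<in>UNIV. real_of_int (w i)) + (\<Sum>j\<in>UNIV. real_of_int (v j))"
    by (metis of_int_add of_int_of_nat_eq of_int_sum)
  have "real_mat q \<bullet> x \<le> real (weight q s)" if x: "substochastic x" for x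
  proof -
    obtain y where y: "\<And>i j. x $ i $ j \<le> y $ i $ j" "\<And>i. row_sum y i = 1" "\<And>j. col_sum y j = 1"
      using substochastic_extend[OF x] by blast
    have y_nonneg: "0 \<le> y $ i $ j" for i j
      using y(1)[of i j] x unfolding substochastic_def by (meson order_trans)
    have wv': "real (q $ i $ j) \<le> real_of_int (w i) + real_of_int (v j)" for i j
      using wv[of i j] by linarith
    have "real_mat q \<bullet> x \<le> (\<Sum>i\<in>UNIV. \<Sum>j\<in>UNIV. (real_of_int (w i) + real_of_int (v j)) * y $ i $ j)"
      unfolding inner_matrix real_mat_nth
    proof (intro sum_mono)
      fix i j
      have "real (q $ i $ j) * x $ i $ j \<le> real (q $ i $ j) * y $ i $ j"
        using y(1) by (intro mult_left_mono) auto
      also have "\<dots> \<le> (real_of_int (w i) + real_of_int (v j)) * y $ i $ j"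
        using wv' y_nonneg by (intro mult_right_mono) auto
      finally show "real (q $ i $ j) * x $ i $ j \<le> (real_of_int (w i) + real_of_int (v j)) * y $ i $ j" .
    qed
    also have "\<dots> = (\<Sum>i\<in>UNIV. real_of_int (w i) * row_sum y i) + (\<Sum>j\<in>UNIV. real_of_int (v j) * col_sum y j)"
      unfolding distrib_right sum.distrib row_sum_def col_sum_def sum_distrib_left
      by (intro arg_cong2[where f = "(+)"] refl sum.swap)
    also have "\<dots> = real (weight q s)"
      by (simp add: y weight_s)
    finally show ?thesis .
  qed
  with s show ?thesis by blast
qed

lemma schedules_substochastic: "s \<in> schedules \<Longrightarrow> substochastic (real_mat s)"
  unfolding schedules_def substochastic_def row_sum_def col_sum_def
  by (auto simp flip: of_nat_sum)

lemma maximal_schedules_subset: "maximal_schedules \<subseteq> schedules"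
  by (auto simp: maximal_schedules_def schedules_def)

text \<open>This makes \<open>pmf_of_set\<close> meaningful. It requires a maximal schedule to
  attain the maximum over all of \<open>schedules\<close>.\<close>

lemma maxweight_schedules_nonempty: "maxweight_schedules q \<noteq> {}"
proof -
  obtain s where s: "s \<in> maximal_schedules" "\<And>x. substochastic x \<Longrightarrow> real_mat q \<bullet> x \<le> real (weight q s)"
    using optimal_maximal_schedule by blast
  have "weight q s' \<le> weight q s" if "s' \<in> schedules" for s'
    using s(2)[OF schedules_substochastic[OF that]] by (simp flip: real_weight)
  then show ?thesis
    using s(1) by (auto simp: maxweight_schedules_def)
qed

lemma finite_maxweight_schedules: "finite (maxweight_schedules q)"
  by (rule finite_subset[OF _ finite_maximal_schedules]) (auto simp: maxweight_schedules_def)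

text \<open>The drift arguments compare the chosen schedule with fractional rate matrices; duality
  permits this without decomposing such a matrix into permutations.\<close>

lemma maxweight_ge_substochastic:
  assumes "s \<in> maxweight_schedules q" "substochastic x"
  shows "real_mat q \<bullet> x \<le> real_mat q \<bullet> real_mat s"
proof -
  obtain s' where s': "s' \<in> maximal_schedules" "real_mat q \<bullet> x \<le> real (weight q s')"
    using optimal_maximal_schedule assms(2) by blast
  moreover have "weight q s' \<le> weight q s"
    using s'(1) assms(1) maximal_schedules_subset by (auto simp: maxweight_schedules_def)
  ultimately show ?thesis
    by (simp flip: real_weight)
qed

section \<open>Expectations over discrete distributions\<close>

text \<open>Tonelli for a two-stage experiment. Integrability is assumed on the composed side
  because stationarity, \<open>bind_pmf p K = p\<close>, supplies it there.\<close>

lemma integrable_bind_pmf_nonneg: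
  fixes f :: "'b \<Rightarrow> real"
  assumes f: "integrable (measure_pmf (bind_pmf p K))  f" and nonneg: "\<And>y. 0 \<le> f y"
  shows "\<And>x. x \<in> set_pmf p \<Longrightarrow> integrable (measure_pmf (K x)) f"
    and "integrable (measure_pmf p) (\<lambda>x. \<integral>y. f y \<partial>measure_pmf (K x))"
    and "(\<integral>y. f y \<partial>measure_pmf (bind_pmf p K)) = (\<integral>x. (\<integral>y. f y \<partial>measure_pmf (K x)) \<partial>measure_pmf p)"
proof -
  have fin: "(\<integral>\<^sup>+x. \<integral>\<^sup>+y. ennreal (f y) \<partial>measure_pmf (K x) \<partial>measure_pmf p) = ennreal (\<integral>y. f y \<partial>measure_pmf (bind_pmf p K))"
    using nn_integral_eq_integral[OF f] nonneg by simp
  then have "AE x in measure_pmf p. (\<integral>\<^sup>+y. ennreal (f y) \<partial>measure_pmf (K x)) \<noteq> \<infinity>"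
    by (intro nn_integral_noteq_infinite) auto
  then show int: "integrable (measure_pmf (K x)) f" if "x \<in> set_pmf p" for x
    using that nonneg by (intro integrableI_nonneg) (auto simp: AE_measure_pmf_iff top.not_eq_extremum)
  have "(\<integral>\<^sup>+x. ennreal (\<integral>y. f y \<partial>measure_pmf (K x)) \<partial>measure_pmf p) =
        (\<integral>\<^sup>+x. \<integral>\<^sup>+y. ennreal (f y) \<partial>measure_pmf (K x) \<partial>measure_pmf p)"
    using int nonneg by (intro nn_integral_cong_AE) (auto simp: AE_measure_pmf_iff nn_integral_eq_integral)
  then have eq: "(\<integral>\<^sup>+x. ennreal (\<integral>y. f y \<partial>measure_pmf (K x)) \<partial>measure_pmf p) = ennreal (\<integral>y. f y \<partial>measure_pmf (bind_pmf p K))"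
    using fin by simp
  then show int': "integrable (measure_pmf p) (\<lambda>x. \<integral>y. f y \<partial>measure_pmf (K x))"
    using nonneg by (intro integrableI_nonneg) (auto intro: Bochner_Integration.integral_nonneg)
  show "(\<integral>y. f y \<partial>measure_pmf (bind_pmf p K)) = (\<integral>x. (\<integral>y. f y \<partial>measure_pmf (K x)) \<partial>measure_pmf p)"
    using nn_integral_eq_integral[OF int'] eq nonneg
    by (simp add: Bochner_Integration.integral_nonneg)
qed

lemma
  fixes f :: "'b \<Rightarrow> real"
  assumes f: "integrable (measure_pmf (bind_pmf p K)) f"
  shows integrable_inner_pmf: "integrable (measure_pmf p) (\<lambda>x. \<integral>y. f y \<partial>measure_pmf (K x))"
    and integral_bind_pmf': "(\<integral>y. f y \<partial>measure_pmf (bind_pmf p K)) = (\<integral>x. (\<integral>y. f y \<partial>measure_pmf (K x)) \<partial>measure_pmf p)"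
proof -
  let ?p = "\<lambda>y. max (f y) 0" and ?n = "\<lambda>y. max (- f y) 0"
  have p: "integrable (measure_pmf (bind_pmf p K)) ?p" and n: "integrable (measure_pmf (bind_pmf p K)) ?n"
    using f by (intro integrable_max; simp)+
  have f_eq: "f y = ?p y - ?n y" for y by simp
  note P = integrable_bind_pmf_nonneg[OF p] and N = integrable_bind_pmf_nonneg[OF n]
  have inner: "(\<integral>y. f y \<partial>measure_pmf (K x)) = (\<integral>y. ?p y \<partial>measure_pmf (K x)) - (\<integral>y. ?n y \<partial>measure_pmf (K x))"
    if "x \<in> set_pmf p" for x
    using P(1) N(1) that by (subst f_eq, subst Bochner_Integration.integral_diff) auto
  have "integrable (measure_pmf p) (\<lambda>x. (\<integral>y. ?p y \<partial>measure_pmf (K x)) - (\<integral>y. ?n y \<partial>measure_pmf (K x)))"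
    using P(2) N(2) by auto
  then show "integrable (measure_pmf p) (\<lambda>x. \<integral>y. f y \<partial>measure_pmf (K x))"
    by (rule integrable_cong_AE_imp) (auto simp: AE_measure_pmf_iff inner)
  have "(\<integral>y. f y \<partial>measure_pmf (bind_pmf p K)) =
      (\<integral>y. ?p y \<partial>measure_pmf (bind_pmf p K)) - (\<integral>y. ?n y \<partial>measure_pmf (bind_pmf p K))"
    using p n by (subst f_eq, subst Bochner_Integration.integral_diff) auto
  also have "\<dots> = (\<integral>x. (\<integral>y. ?p y \<partial>measure_pmf (K x)) - (\<integral>y. ?n y \<partial>measure_pmf (K x)) \<partial>measure_pmf p)"
    using P N by (subst Bochner_Integration.integral_diff) auto
  also have "\<dots> = (\<integral>x. (\<integral>y. f y \<partial>measure_pmf (K x)) \<partial>measure_pmf p)"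
    by (intro integral_cong_AE) (auto simp: AE_measure_pmf_iff inner)
  finally show "(\<integral>y. f y \<partial>measure_pmf (bind_pmf p K)) = (\<integral>x. (\<integral>y. f y \<partial>measure_pmf (K x)) \<partial>measure_pmf p)" .
qed

lemma integrable_pmf_bounded:
  fixes f :: "'a \<Rightarrow> real"
  assumes "\<And>x. \<bar>f x\<bar> \<le> b"
  shows "integrable (measure_pmf p) f"
  using assms by (intro measure_pmf.integrable_const_bound[where B = b]) auto

lemma abs_integral_pmf_le:
  fixes f :: "'a \<Rightarrow> real"
  assumes "\<And>x. \<bar>f x\<bar> \<le> b"
  shows "\<bar>\<integral>x. f x \<partial>measure_pmf p\<bar> \<le> b"
proof -
  have "\<bar>\<integral>x. f x \<partial>measure_pmf p\<bar> \<le> (\<integral>x. \<bar>f x\<bar> \<partial>measure_pmf p)"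
    by (rule integral_abs_bound)
  also have "\<dots> \<le> (\<integral>x. b \<partial>measure_pmf p)"
    using assms by (intro integral_mono integrable_pmf_bounded[where b = b]) (auto intro: order_trans[OF abs_ge_zero])
  finally show ?thesis by simp
qed

text \<open>The mass outside \<open>F\<close> is at most \<open>e\<close>. Finite sums pass to
  pointwise limits of probabilities, so this carries such limits over to integrals.\<close>

lemma integral_truncation:
  fixes f :: "'a \<Rightarrow> real"
  assumes f: "\<And>x. \<bar>f x\<bar> \<le> b" and F: "finite F" "1 - e \<le> measure (measure_pmf p) F"
  shows "\<bar>(\<integral>y. f y \<partial>measure_pmf p) - (\<Sum>y\<in>F. f y * pmf p y)\<bar> \<le> b * e"
proof -
  have b_nonneg: "0 \<le> b" using f[of undefined] by linarith
  have int: "integrable (measure_pmf p) f" "integrable (measure_pmf p) (\<lambda>y. f y * indicator F y)"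
    "integrable (measure_pmf p) (\<lambda>y. b * indicator (- F) y :: real)"
    using f b_nonneg by (intro integrable_pmf_bounded[where b = b]; force simp: indicator_def)+
  have "(\<Sum>y\<in>F. f y * pmf p y) = (\<integral>y. f y * indicator F y \<partial>measure_pmf p)"
    using F by (subst integral_measure_pmf_real[of F]) (auto simp: indicator_def split: if_splits)
  then have "(\<integral>y. f y \<partial>measure_pmf p) - (\<Sum>y\<in>F. f y * pmf p y) =
      (\<integral>y. f y - f y * indicator F y \<partial>measure_pmf p)"
    using int by simp
  also have "\<bar>\<dots>\<bar> \<le> (\<integral>y. \<bar>f y - f y * indicator F y\<bar> \<partial>measure_pmf p)"
    by (rule integral_abs_bound)
  also have "\<dots> \<le> (\<integral>y. b * indicator (- F) y \<partial>measure_pmf p)"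
    using int f b_nonneg by (intro integral_mono) (auto simp: indicator_def)
  also have "\<dots> = b * (1 - measure (measure_pmf p) F)"
    using measure_pmf.prob_compl[of F p] by (simp add: Compl_eq_Diff_UNIV)
  also have "\<dots> \<le> b * e"
    using F b_nonneg by (intro mult_left_mono) auto
  finally show ?thesis .
qed

section \<open>Geometric ergodicity\<close>

primrec kernel_pow :: "('a \<Rightarrow> 'a pmf) \<Rightarrow> nat \<Rightarrow> 'a \<Rightarrow> 'a pmf" where
  "kernel_pow K 0 x = return_pmf x"
| "kernel_pow K (Suc t) x = bind_pmf (kernel_pow K t x) K"

lemma kernel_pow_add: "kernel_pow K (s + t) x = bind_pmf (kernel_pow K s x) (kernel_pow K t)"
proof (induction t)
  case 0
  then show ?case by (simp add: bind_return_pmf')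
next
  case (Suc t)
  then show ?case by (simp add: bind_assoc_pmf)
qed

lemma finite_set_kernel_pow:
  assumes "\<And>x. finite (set_pmf (K x))"
  shows "finite (set_pmf (kernel_pow K t x))"
  by (induction t) (auto simp: assms)

lemma power_div_tendsto_0:
  fixes \<rho> :: real
  assumes "1 \<le> m" "0 \<le> \<rho>" "\<rho> < 1"
  shows "(\<lambda>t. b * \<rho> ^ (t div m) * c) \<longlonglongrightarrow> 0"
proof -
  have "filterlim (\<lambda>t. t div m) sequentially sequentially"
    using assms by (intro filterlim_at_top_div_const_nat) auto
  then have "(\<lambda>t. \<rho> ^ (t div m)) \<longlonglongrightarrow> 0"
    using assms by (intro filterlim_compose[OF LIMSEQ_power_zero]) auto
  then show ?thesis
    by (intro tendsto_mult_left_zero tendsto_mult_right_zero)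
qed

text \<open>Accessibility of the single state \<open>z\<close> takes the place of irreducibility,
  its loop that of aperiodicity. Finite sublevel sets turn accessibility into a minorisation uniform
  over low states.\<close>

locale lyapunov_chain =
  fixes K :: "'a \<Rightarrow> 'a pmf" and W :: "'a \<Rightarrow> real" and \<gamma> C :: real and z :: 'a
  assumes finite_K: "\<And>x. finite (set_pmf (K x))"
    and W_nonneg: "\<And>x. 0 \<le> W x"
    and finite_sublevel: "\<And>R. finite {x. W x \<le> R}"
    and gamma: "0 \<le> \<gamma>" "\<gamma> < 1"
    and C_nonneg: "0 \<le> C"
    and drift: "\<And>x. (\<integral>y. W y \<partial>measure_pmf (K x)) \<le> \<gamma> * W x + C"
    and reach: "\<And>x. \<exists>t. z \<in> set_pmf (kernel_pow K t x)"
    and loop: "z \<in> set_pmf (K z)"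
begin

definition Pw :: "nat \<Rightarrow> ('a \<Rightarrow> real) \<Rightarrow> 'a \<Rightarrow> real" where
  "Pw t f x = (\<integral>y. f y \<partial>measure_pmf (kernel_pow K t x))"

lemma integrable_pow [simp]: "integrable (measure_pmf (kernel_pow K t x)) (f :: 'a \<Rightarrow> real)"
  by (intro integrable_measure_pmf_finite finite_set_kernel_pow finite_K)

lemma Pw_add: "Pw (s + t) f x = Pw s (Pw t f) x"
  unfolding Pw_def kernel_pow_add
  by (rule integral_bind_pmf') (metis kernel_pow_add integrable_pow)

lemma Pw_mono: "(\<And>y. f y \<le> g y) \<Longrightarrow> Pw t f x \<le> Pw t g x"
  unfolding Pw_def by (intro integral_mono) auto

text \<open>The fixed point of \<open>c = \<gamma> * c + C\<close>, which bounds the accumulated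
  drift constants.\<close>

definition C' :: real where "C' = C / (1 - \<gamma>)"

lemma C'_nonneg: "0 \<le> C'"
  using gamma C_nonneg by (simp add: C'_def)

lemma drift_pow: "Pw t W x \<le> \<gamma> ^ t * W x + C'"
proof (induction t)
  case 0
  then show ?case using C'_nonneg by (simp add: Pw_def)
next
  case (Suc t)
  have "Pw (Suc t) W x = Pw t (Pw 1 W) x"
    using Pw_add[of t 1] by simp
  also have "\<dots> \<le> Pw t (\<lambda>y. \<gamma> * W y + C) x"
    using drift by (intro Pw_mono) (simp add: Pw_def bind_return_pmf)
  also have "\<dots> = \<gamma> * Pw t W x + C"
    by (simp add: Pw_def)
  also have "\<dots> \<le> \<gamma> * (\<gamma> ^ t * W x + C') + C"
    using Suc gamma by (intro add_right_mono mult_left_mono) auto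
  also have "\<dots> = \<gamma> ^ Suc t * W x + C'"
    using gamma by (simp add: C'_def field_simps)
  finally show ?case .
qed

lemma drift_pow_le: "Pw t W x \<le> W x + C'"
proof -
  have "\<gamma> ^ t * W x \<le> 1 * W x"
    using gamma W_nonneg by (intro mult_right_mono power_le_one) auto
  then show ?thesis using drift_pow[of t x] by simp
qed

text \<open>A path that reaches \<open>z\<close> early can wait there on the loop, so the sum of the
  individual hitting times serves all of \<open>F\<close>. The extra step ensures
  \<open>m \<ge> 1\<close>, whence \<open>\<gamma> ^ m \<le> \<gamma>\<close> later.\<close>

lemma common_reach:
  assumes "finite F"
  shows "\<exists>m\<ge>1. \<forall>x\<in>F. z \<in> set_pmf (kernel_pow K m x)"
proof -
  have stay: "z \<in> set_pmf (kernel_pow K (t + u) x)" if "z \<in> set_pmf (kernel_pow K t x)" for t u x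
    using that by (induction u) (auto intro: loop)
  obtain T where T: "\<And>x. z \<in> set_pmf (kernel_pow K (T x) x)"
    using reach by metis
  have "z \<in> set_pmf (kernel_pow K (Suc (\<Sum>x\<in>F. T x)) x)" if "x \<in> F" for x
  proof -
    have "T x \<le> Suc (\<Sum>x\<in>F. T x)"
      using that assms by (simp add: le_SucI member_le_sum)
    then show ?thesis
      using stay[OF T] by (metis le_add_diff_inverse)
  qed
  then show ?thesis by (intro exI[of _ "Suc (\<Sum>x\<in>F. T x)"]) auto
qed

text \<open>The independent coupling of \<open>K\<^sup>m x\<close> and \<open>K\<^sup>m y\<close> meets at \<open>z\<close> with probability bounded
  below when both starting points are low, and otherwise the drift of \<open>W\<close> dominates.\<close>

lemma coupling_bound:
  assumes c: "0 \<le> c" and \<beta>: "0 \<le> \<beta>"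
    and f: "\<And>x y. \<bar>f x - f y\<bar> \<le> c * (2 + \<beta> * (W x + W y))"
  shows "\<bar>Pw m f x - Pw m f y\<bar> \<le>
    c * (2 + \<beta> * (Pw m W x + Pw m W y) - 2 * pmf (kernel_pow K m x) z * pmf (kernel_pow K m y) z)"
proof -
  let ?J = "pair_pmf (kernel_pow K m x) (kernel_pow K m y)"
  have fin: "finite (set_pmf ?J)"
    by (simp add: finite_set_kernel_pow finite_K)
  have int: "integrable (measure_pmf ?J) h" for h :: "'a \<times> 'a \<Rightarrow> real"
    using fin by (rule integrable_measure_pmf_finite)
  have fst: "(\<integral>u. g (fst u) \<partial>measure_pmf ?J) = Pw m g x" and snd: "(\<integral>u. g (snd u) \<partial>measure_pmf ?J) = Pw m g y" for g
    unfolding Pw_def by (subst integral_map_pmf[symmetric], simp add: map_fst_pair_pmf map_snd_pair_pmf)+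
  have "Pw m f x - Pw m f y = (\<integral>u. f (fst u) - f (snd u) \<partial>measure_pmf ?J)"
    unfolding fst[symmetric] snd[symmetric] using int by simp
  also have "\<bar>\<dots>\<bar> \<le> (\<integral>u. \<bar>f (fst u) - f (snd u)\<bar> \<partial>measure_pmf ?J)"
    by (rule integral_abs_bound)
  also have "\<dots> \<le> (\<integral>u. c * (2 + \<beta> * (W (fst u) + W (snd u)) - 2 * indicator {(z, z)} u) \<partial>measure_pmf ?J)"
  proof (intro integral_mono int)
    fix u :: "'a \<times> 'a"
    \<comment> \<open>At \<open>(z, z)\<close> the left side is 0, so the constant 2 can be
      cancelled there; elsewhere this is the hypothesis on \<open>f\<close>.\<close>
    show "\<bar>f (fst u) - f (snd u)\<bar> \<le> c * (2 + \<beta> * (W (fst u) + W (snd u)) - 2 * indicator {(z, z)} u)"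
      using f[of "fst u" "snd u"] c \<beta> W_nonneg by (auto simp: indicator_def)
  qed
  also have "\<dots> = c * (2 + \<beta> * ((\<integral>u. W (fst u) \<partial>measure_pmf ?J) + (\<integral>u. W (snd u) \<partial>measure_pmf ?J))
      - 2 * measure (measure_pmf ?J) {(z, z)})"
    using int by simp
  also have "measure (measure_pmf ?J) {(z, z)} = pmf (kernel_pow K m x) z * pmf (kernel_pow K m y) z"
    by (simp add: measure_pmf_single pmf_pair)
  finally show ?thesis
    unfolding fst snd by (simp add: algebra_simps)
qed

text \<open>The seminorm that contracts is the oscillation of \<open>f\<close> relative to
  \<open>2 + \<beta> * (W x + W y)\<close>. The constant 2 exploits the coupling at low states, the
  \<beta>-term the drift at high ones.\<close>

lemma contraction:
  "\<exists>m \<beta> \<rho>. 1 \<le> m \<and> 0 < \<beta> \<and> 0 \<le> \<rho> \<and> \<rho> < 1 \<and>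
    (\<forall>f c. 0 \<le> c \<longrightarrow> (\<forall>x y. \<bar>f x - f y\<bar> \<le> c * (2 + \<beta> * (W x + W y))) \<longrightarrow>
       (\<forall>x y. \<bar>Pw m f x - Pw m f y\<bar> \<le> c * \<rho> * (2 + \<beta> * (W x + W y))))"
proof -
  \<comment> \<open>Above \<open>R\<close> the constant \<open>2 * C'\<close> consumes at most half
    of the decrease \<open>(1 - \<gamma>) * S\<close>, leaving the rate
    \<open>\<gamma>' = (1 + \<gamma>) / 2\<close>. The summand 1 keeps \<open>R\<close> positive
    when \<open>C' = 0\<close>.\<close>
  define R where "R = 4 * C' / (1 - \<gamma>) + 1"
  define F where "F = {x. W x \<le> R}"
  have R: "0 < R" "4 * C' \<le> (1 - \<gamma>) * R"
  proof -
    have "(1 - \<gamma>) * R = 4 * C' + (1 - \<gamma>)"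
      using gamma by (simp add: R_def distrib_left)
    then show "4 * C' \<le> (1 - \<gamma>) * R"
      using gamma by simp
    show "0 < R"
      using C'_nonneg gamma by (simp add: R_def add_nonneg_pos)
  qed
  obtain m where m: "1 \<le> m" "\<And>x. x \<in> F \<Longrightarrow> z \<in> set_pmf (kernel_pow K m x)"
    using common_reach[of F] finite_sublevel by (auto simp: F_def)
  obtain \<alpha> where \<alpha>: "0 < \<alpha>" "\<alpha> \<le> 1" "\<And>x. x \<in> F \<Longrightarrow> \<alpha> \<le> pmf (kernel_pow K m x) z"
  proof
    let ?\<alpha> = "Min (insert 1 ((\<lambda>x. pmf (kernel_pow K m x) z) ` F))"
    have fin: "finite F" by (simp add: F_def finite_sublevel)
    show "0 < ?\<alpha>" using fin m(2) by (auto simp: pmf_positive)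
    show "?\<alpha> \<le> 1" using fin by auto
    show "?\<alpha> \<le> pmf (kernel_pow K m x) z" if "x \<in> F" for x using fin that by auto
  qed
  \<comment> \<open>Small enough that \<open>2 * \<beta> * C'\<close> uses at most half of the
    coupling gain \<open>2 * \<alpha>\<^sup>2\<close>.\<close>
  define \<beta> where "\<beta> = \<alpha>\<^sup>2 / (2 * (C' + 1))"
  define \<gamma>' where "\<gamma>' = (1 + \<gamma>) / 2"
  \<comment> \<open>The ratio of \<open>2 + \<beta> * \<gamma>' * S\<close> to
    \<open>2 + \<beta> * S\<close> decreases in \<open>S\<close>, so its worst value for
    \<open>S \<ge> R\<close> is at \<open>R\<close>; the other two entries treat the low
    states.\<close>
  define \<rho> where "\<rho> = max ((2 + \<beta> * \<gamma>' * R) / (2 + \<beta> * R)) (max \<gamma> (1 - \<alpha>\<^sup>2 / 2))"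
  have \<beta>: "0 < \<beta>" "2 * \<beta> * C' \<le> \<alpha>\<^sup>2"
    using \<alpha> C'_nonneg by (auto simp: \<beta>_def field_simps)
  have \<gamma>': "\<gamma>' < 1" using gamma by (simp add: \<gamma>'_def)
  have "\<beta> * \<gamma>' * R < \<beta> * R"
    using \<beta> \<gamma>' R by simp
  then have \<rho>: "0 \<le> \<rho>" "\<rho> < 1"
    using gamma \<alpha> \<beta> R by (auto simp: \<rho>_def le_max_iff_disj divide_simps add_pos_pos)
  have "\<bar>Pw m f x - Pw m f y\<bar> \<le> c * \<rho> * (2 + \<beta> * (W x + W y))"
    if c: "0 \<le> c" and f: "\<And>x y. \<bar>f x - f y\<bar> \<le> c * (2 + \<beta> * (W x + W y))" for f c x y
  proof -
    define S where "S = W x + W y"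
    let ?p = "pmf (kernel_pow K m x) z * pmf (kernel_pow K m y) z"
    have S: "0 \<le> S" using W_nonneg by (simp add: S_def)
    have Wm: "Pw m W x \<le> \<gamma> * W x + C'" for x
    proof -
      have "\<gamma> ^ m \<le> \<gamma> ^ 1"
        using gamma m(1) by (intro power_decreasing) auto
      then have "\<gamma> ^ m * W x \<le> \<gamma> * W x"
        using W_nonneg by (intro mult_right_mono) auto
      then show ?thesis using drift_pow[of m x] by simp
    qed
    have "\<beta> * (Pw m W x + Pw m W y) \<le> \<beta> * (\<gamma> * S + 2 * C')"
      using \<beta> Wm[of x] Wm[of y] by (intro mult_left_mono) (auto simp: S_def algebra_simps)
    then have "2 + \<beta> * (Pw m W x + Pw m W y) - 2 * ?p \<le> 2 + \<beta> * \<gamma> * S + 2 * \<beta> * C' - 2 * ?p"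
      by (simp add: algebra_simps)
    also have "\<dots> \<le> \<rho> * (2 + \<beta> * S)"
    proof (cases "S \<ge> R")
      case True
      have "4 * C' \<le> (1 - \<gamma>) * S"
        using R(2) True gamma by (meson diff_ge_0_iff_ge less_imp_le mult_left_mono order_trans)
      then have "\<beta> * (4 * C') \<le> \<beta> * ((1 - \<gamma>) * S)"
        using \<beta> by (intro mult_left_mono) auto
      then have "2 + \<beta> * \<gamma> * S + 2 * \<beta> * C' \<le> 2 + \<beta> * \<gamma>' * S"
        by (simp add: \<gamma>'_def field_simps)
      also have "\<dots> \<le> (2 + \<beta> * \<gamma>' * R) / (2 + \<beta> * R) * (2 + \<beta> * S)"
      proof -
        have "0 \<le> 2 * \<beta> * (1 - \<gamma>') * (S - R)"
          using \<beta> \<gamma>' True by simp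
        moreover have "0 < 2 + \<beta> * R" using \<beta> R by (simp add: add_pos_pos)
        ultimately show ?thesis by (simp add: field_simps)
      qed
      also have "\<dots> \<le> \<rho> * (2 + \<beta> * S)"
        using \<beta> S by (intro mult_right_mono) (auto simp: \<rho>_def)
      finally show ?thesis
        using pmf_nonneg[of "kernel_pow K m x" z] pmf_nonneg[of "kernel_pow K m y" z]
          mult_nonneg_nonneg[of "pmf (kernel_pow K m x) z" "pmf (kernel_pow K m y) z"] by linarith
    next
      case False
      then have "x \<in> F" "y \<in> F"
        using W_nonneg[of x] W_nonneg[of y] by (auto simp: F_def S_def)
      then have "\<alpha> * \<alpha> \<le> ?p"
        using \<alpha> by (intro mult_mono) auto
      then have "2 + \<beta> * \<gamma> * S + 2 * \<beta> * C' - 2 * ?p \<le> 2 * (1 - \<alpha>\<^sup>2 / 2) + \<gamma> * (\<beta> * S)"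
        using \<beta> by (simp add: power2_eq_square)
      also have "\<dots> \<le> 2 * \<rho> + \<rho> * (\<beta> * S)"
        using \<beta> S by (intro add_mono mult_left_mono mult_right_mono) (auto simp: \<rho>_def)
      finally show ?thesis by (simp add: algebra_simps)
    qed
    finally have "c * (2 + \<beta> * (Pw m W x + Pw m W y) - 2 * ?p) \<le> c * (\<rho> * (2 + \<beta> * S))"
      using c by (rule mult_left_mono)
    then show ?thesis
      using coupling_bound[OF c less_imp_le[OF \<beta>(1)] f, of m x y] by (simp add: S_def mult.assoc)
  qed
  then show ?thesis using m(1) \<beta>(1) \<rho> by blast
qed


text \<open>A function bounded by \<open>b\<close> has oscillation at most \<open>2 * b\<close>, so
  the contraction can be iterated from seminorm \<open>b\<close>. The constants are chosen before
  \<open>f\<close>.\<close>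

lemma geometric_forgetting:
  "\<exists>m \<beta> \<rho>. 1 \<le> m \<and> 0 < \<beta> \<and> 0 \<le> \<rho> \<and> \<rho> < 1 \<and>
    (\<forall>f b t x y. (\<forall>x. \<bar>f x\<bar> \<le> b) \<longrightarrow>
       \<bar>Pw t f x - Pw t f y\<bar> \<le> b * \<rho> ^ (t div m) * (2 + \<beta> * (W x + W y)))"
proof -
  obtain m \<beta> \<rho> where m: "1 \<le> m" "0 < \<beta>" "0 \<le> \<rho>" "\<rho> < 1" and
    contr: "\<And>f c x y. 0 \<le> c \<Longrightarrow> (\<And>x y. \<bar>f x - f y\<bar> \<le> c * (2 + \<beta> * (W x + W y))) \<Longrightarrow>
       \<bar>Pw m f x - Pw m f y\<bar> \<le> c * \<rho> * (2 + \<beta> * (W x + W y))"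
    using contraction by blast
  have "\<bar>Pw t f x - Pw t f y\<bar> \<le> b * \<rho> ^ (t div m) * (2 + \<beta> * (W x + W y))"
    if b: "\<And>x. \<bar>f x\<bar> \<le> b" for f b t x y
  proof -
    have b_nonneg: "0 \<le> b" using b[of x] by linarith
    \<comment> \<open>The incomplete block is applied to \<open>f\<close> first, where it only has
      to preserve the bound \<open>b\<close>; full blocks of length \<open>m\<close> then
      contract.\<close>
    define g where "g = Pw (t mod m) f"
    have g: "\<bar>g x\<bar> \<le> b" for x
      unfolding g_def Pw_def by (rule abs_integral_pmf_le) (rule b)
    have "\<bar>Pw (m * k) g x - Pw (m * k) g y\<bar> \<le> b * \<rho> ^ k * (2 + \<beta> * (W x + W y))" for k x y
    proof (induction k arbitrary: x y)
      case 0
      have "0 \<le> b * (\<beta> * (W x + W y))"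
        using b_nonneg m(2) W_nonneg by auto
      then show ?case
        using g[of x] g[of y] unfolding Pw_def by (simp add: distrib_left)
    next
      case (Suc k)
      have eq: "Pw (m * Suc k) g x = Pw m (Pw (m * k) g) x" for x
        using Pw_add[of m "m * k"] by simp
      show ?case
        unfolding eq using contr[of "b * \<rho> ^ k" "Pw (m * k) g" x y] Suc b_nonneg m(3)
        by (simp add: mult_ac)
    qed
    then show ?thesis
      using Pw_add[of "m * (t div m)" "t mod m" f] by (simp add: g_def)
  qed
  then show ?thesis using m by blast
qed

section \<open>Construction of the stationary law and convergence to it\<close>

lemma tail_bound:
  assumes "0 < R"
  shows "measure (measure_pmf (kernel_pow K t x)) {y. \<not> W y \<le> R} \<le> (W x + C') / R"
proof -
  have "R * measure (measure_pmf (kernel_pow K t x)) {y. \<not> W y \<le> R}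
      = (\<integral>y. R * indicator {y. \<not> W y \<le> R} y \<partial>measure_pmf (kernel_pow K t x))"
    by simp
  also have "\<dots> \<le> Pw t W x"
    unfolding Pw_def using W_nonneg by (intro integral_mono) (auto simp: indicator_def)
  also have "\<dots> \<le> W x + C'"
    by (rule drift_pow_le)
  finally show ?thesis
    using assms by (simp add: field_simps)
qed

text \<open>Running \<open>u\<close> steps first changes the starting point into a random one whose
  mean of \<open>W\<close> is bounded in \<open>u\<close>, and \<open>t\<close> further steps forget
  it. Hence the sequence is Cauchy.\<close>

lemma convergent_Pw:
  assumes f: "\<And>x. \<bar>f x\<bar> \<le> b"
  shows "convergent (\<lambda>t. Pw t f x)"
proof -
  obtain m \<beta> \<rho> where m: "1 \<le> m" "0 < \<beta>" "0 \<le> \<rho>" "\<rho> < 1" and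
    forget: "\<And>t x y. \<bar>Pw t f x - Pw t f y\<bar> \<le> b * \<rho> ^ (t div m) * (2 + \<beta> * (W x + W y))"
    using geometric_forgetting f by blast
  define B where "B = b * (2 + \<beta> * (2 * W x + C'))"
  have b_nonneg: "0 \<le> b" using f[of x] by linarith
  have shift: "\<bar>Pw (t + u) f x - Pw t f x\<bar> \<le> B * \<rho> ^ (t div m)" for t u
  proof -
    let ?r = "b * \<rho> ^ (t div m)"
    have "Pw (t + u) f x - Pw t f x = (\<integral>y. Pw t f y - Pw t f x \<partial>measure_pmf (kernel_pow K u x))"
      using Pw_add[of u t f x] by (simp add: Pw_def[of u] add.commute)
    also have "\<bar>\<dots>\<bar> \<le> (\<integral>y. \<bar>Pw t f y - Pw t f x\<bar> \<partial>measure_pmf (kernel_pow K u x))"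
      by (rule integral_abs_bound)
    also have "\<dots> \<le> (\<integral>y. ?r * (2 + \<beta> * (W y + W x)) \<partial>measure_pmf (kernel_pow K u x))"
      using forget by (intro integral_mono) auto
    also have "\<dots> = ?r * (2 + \<beta> * (Pw u W x + W x))"
      by (simp add: Pw_def)
    also have "\<dots> \<le> ?r * (2 + \<beta> * (2 * W x + C'))"
      using m b_nonneg drift_pow_le[of u x] by (intro mult_left_mono add_left_mono) auto
    finally show ?thesis by (simp add: B_def mult_ac)
  qed
  have lim0: "(\<lambda>t. B * \<rho> ^ (t div m)) \<longlonglongrightarrow> 0"
    using power_div_tendsto_0[of m \<rho> B 1] m by simp
  show ?thesis
  proof (rule Cauchy_convergent, rule CauchyI')
    fix e :: real assume "0 < e"
    then obtain T where T: "\<And>t. t \<ge> T \<Longrightarrow> \<bar>B * \<rho> ^ (t div m)\<bar> < e"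
      using LIMSEQ_D[OF lim0] by auto
    have "dist (Pw t f x) (Pw u f x) < e" if "t \<ge> T" "u > t" for t u
      using shift[of t "u - t"] T[OF that(1)] that by (simp add: dist_real_def abs_minus_commute)
    then show "\<exists>M. \<forall>t\<ge>M. \<forall>u>t. dist (Pw t f x) (Pw u f x) < e" by blast
  qed
qed

text \<open>By \<open>drift_pow_le\<close>, a bound on the mean of \<open>W\<close> from
  \<open>z\<close> that is uniform in time.\<close>

definition c0 :: real where "c0 = W z + C'"

definition \<pi>f :: "'a \<Rightarrow> real" where
  "\<pi>f y = lim (\<lambda>t. pmf (kernel_pow K t z) y)"

lemma \<pi>f_lim: "(\<lambda>t. pmf (kernel_pow K t z) y) \<longlonglongrightarrow> \<pi>f y"
proof -
  have "Pw t (indicator {y}) z = pmf (kernel_pow K t z) y" for t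
    by (simp add: Pw_def measure_pmf_single)
  then have "convergent (\<lambda>t. pmf (kernel_pow K t z) y)"
    using convergent_Pw[of "indicator {y}" 1 z] by (simp add: indicator_def)
  then show ?thesis
    by (simp add: \<pi>f_def convergent_LIMSEQ_iff)
qed

lemma \<pi>f_nonneg: "0 \<le> \<pi>f y"
  by (rule LIMSEQ_le_const[OF \<pi>f_lim]) auto

lemma sum_\<pi>f_lim:
  "(\<lambda>t. \<Sum>y\<in>F. f y * pmf (kernel_pow K t z) y) \<longlonglongrightarrow> (\<Sum>y\<in>F. f y * \<pi>f y)"
  by (intro tendsto_intros \<pi>f_lim)

lemma sum_\<pi>f_ge:
  assumes "0 < R"
  shows "1 - c0 / R \<le> (\<Sum>y | W y \<le> R. \<pi>f y)"
proof (rule LIMSEQ_le_const)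
  show "(\<lambda>t. \<Sum>y | W y \<le> R. pmf (kernel_pow K t z) y) \<longlonglongrightarrow> (\<Sum>y | W y \<le> R. \<pi>f y)"
    by (intro tendsto_intros \<pi>f_lim)
  have "1 - c0 / R \<le> (\<Sum>y | W y \<le> R. pmf (kernel_pow K t z) y)" for t
  proof -
    have "(\<Sum>y | W y \<le> R. pmf (kernel_pow K t z) y) = measure (measure_pmf (kernel_pow K t z)) {y. W y \<le> R}"
      by (simp add: measure_measure_pmf_finite finite_sublevel)
    also have "\<dots> = 1 - measure (measure_pmf (kernel_pow K t z)) {y. \<not> W y \<le> R}"
      using measure_pmf.prob_compl[of "{y. W y \<le> R}" "kernel_pow K t z"]
      by (simp add: Compl_eq_Diff_UNIV[symmetric] Collect_neg_eq[symmetric])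
    finally show ?thesis
      using tail_bound[OF assms, of t z] by (simp add: c0_def)
  qed
  then show "\<exists>N. \<forall>t\<ge>N. 1 - c0 / R \<le> (\<Sum>y | W y \<le> R. pmf (kernel_pow K t z) y)" by blast
qed

text \<open>Fatou gives at most 1; the tightness in \<open>sum_\<pi>f_ge\<close> excludes escape of
  mass to infinity.\<close>

lemma nn_integral_\<pi>f: "(\<integral>\<^sup>+y. ennreal (\<pi>f y) \<partial>count_space UNIV) = 1"
proof (rule antisym)
  have "(\<integral>\<^sup>+y. ennreal (\<pi>f y) \<partial>count_space UNIV)
      = (\<integral>\<^sup>+y. liminf (\<lambda>t. ennreal (pmf (kernel_pow K t z) y)) \<partial>count_space UNIV)"
    by (intro nn_integral_cong lim_imp_Liminf[symmetric] tendsto_ennrealI \<pi>f_lim) auto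
  also have "\<dots> \<le> liminf (\<lambda>t. \<integral>\<^sup>+y. ennreal (pmf (kernel_pow K t z) y) \<partial>count_space UNIV)"
    by (intro nn_integral_liminf) auto
  also have "\<dots> = 1"
    by (simp add: nn_integral_pmf Liminf_const)
  finally show "(\<integral>\<^sup>+y. ennreal (\<pi>f y) \<partial>count_space UNIV) \<le> 1" .
next
  have "ennreal (1 - c0 / real (Suc k)) \<le> (\<integral>\<^sup>+y. ennreal (\<pi>f y) \<partial>count_space UNIV)" for k
  proof -
    let ?F = "{y. W y \<le> real (Suc k)}"
    have "ennreal (1 - c0 / real (Suc k)) \<le> ennreal (\<Sum>y\<in>?F. \<pi>f y)"
      by (intro ennreal_leI sum_\<pi>f_ge) auto
    also have "\<dots> = (\<integral>\<^sup>+y. ennreal (\<pi>f y) * indicator ?F y \<partial>count_space UNIV)"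
      using finite_sublevel \<pi>f_nonneg
      by (subst nn_integral_indicator_finite) (auto simp: sum_ennreal)
    also have "\<dots> \<le> (\<integral>\<^sup>+y. ennreal (\<pi>f y) \<partial>count_space UNIV)"
      by (intro nn_integral_mono) (auto simp: indicator_def)
    finally show ?thesis .
  qed
  moreover have "(\<lambda>k. ennreal (1 - c0 / real (Suc k))) \<longlonglongrightarrow> ennreal (1 - 0)"
    by (intro tendsto_intros tendsto_ennrealI LIMSEQ_Suc[OF lim_const_over_n])
  ultimately show "1 \<le> (\<integral>\<^sup>+y. ennreal (\<pi>f y) \<partial>count_space UNIV)"
    by (intro LIMSEQ_le_const2) auto
qed

definition \<pi> :: "'a pmf" where "\<pi> = embed_pmf \<pi>f"

lemma pmf_\<pi>: "pmf \<pi> y = \<pi>f y"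
  unfolding \<pi>_def by (rule pmf_embed_pmf[OF \<pi>f_nonneg nn_integral_\<pi>f])

text \<open>The limit exists already and only has to be identified: both integrals differ from
  corresponding finite sums over a sublevel set by at most \<open>b * (c0 / R)\<close>, these sums
  converge, and \<open>R\<close> is arbitrary.\<close>

lemma Pw_tendsto_z:
  assumes f: "\<And>x. \<bar>f x\<bar> \<le> b"
  shows "(\<lambda>t. Pw t f z) \<longlonglongrightarrow> (\<integral>y. f y \<partial>measure_pmf \<pi>)"
proof -
  obtain L where L: "(\<lambda>t. Pw t f z) \<longlonglongrightarrow> L"
    using convergent_Pw[of f, OF f] by (auto simp: convergent_def)
  let ?I = "\<integral>y. f y \<partial>measure_pmf \<pi>"
  have "\<bar>L - ?I\<bar> \<le> 2 * b * c0 / R" if R: "0 < R" for R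
  proof -
    let ?F = "{y. W y \<le> R}"
    let ?S = "\<Sum>y\<in>?F. f y * \<pi>f y"
    have "\<bar>Pw t f z - (\<Sum>y\<in>?F. f y * pmf (kernel_pow K t z) y)\<bar> \<le> b * (c0 / R)" for t
      unfolding Pw_def
    proof (rule integral_truncation[OF f finite_sublevel])
      show "1 - c0 / R \<le> measure (measure_pmf (kernel_pow K t z)) ?F"
        using tail_bound[OF R, of t z] measure_pmf.prob_compl[of "{y. W y \<le> R}" "kernel_pow K t z"]
        by (simp add: Compl_eq_Diff_UNIV[symmetric] Collect_neg_eq[symmetric] c0_def)
    qed
    then have "\<bar>L - ?S\<bar> \<le> b * (c0 / R)"
      by (intro LIMSEQ_le_const2[OF tendsto_rabs[OF tendsto_diff[OF L sum_\<pi>f_lim]]]) auto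
    moreover have "\<bar>?I - (\<Sum>y\<in>?F. f y * pmf \<pi> y)\<bar> \<le> b * (c0 / R)"
    proof (rule integral_truncation[OF f finite_sublevel])
      show "1 - c0 / R \<le> measure (measure_pmf \<pi>) ?F"
        using sum_\<pi>f_ge[OF R] by (simp add: measure_measure_pmf_finite finite_sublevel pmf_\<pi>)
    qed
    ultimately show ?thesis
      by (simp add: pmf_\<pi>)
  qed
  then have "\<bar>L - ?I\<bar> \<le> 2 * b * c0 / real (Suc k)" for k
    by simp
  moreover have "(\<lambda>k. 2 * b * c0 / real (Suc k)) \<longlonglongrightarrow> 0"
    by (intro LIMSEQ_Suc[OF lim_const_over_n])
  ultimately have "\<bar>L - ?I\<bar> \<le> 0"
    by (intro LIMSEQ_le_const) auto
  then show ?thesis using L by simp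
qed

text \<open>The mean of the bounded function \<open>\<lambda>x. pmf (K x) y\<close> at time t is the
  probability of \<open>y\<close> at time t + 1, so the two sides are limits of the same
  sequence.\<close>

theorem stationary: "bind_pmf \<pi> K = \<pi>"
proof (rule pmf_eqI)
  fix y
  have "(\<lambda>t. Pw t (\<lambda>x. pmf (K x) y) z) \<longlonglongrightarrow> (\<integral>x. pmf (K x) y \<partial>measure_pmf \<pi>)"
    by (rule Pw_tendsto_z[where b = 1]) (auto simp: pmf_le_1)
  moreover have "Pw t (\<lambda>x. pmf (K x) y) z = pmf (kernel_pow K (Suc t) z) y" for t
    by (simp add: Pw_def pmf_bind)
  ultimately show "pmf (bind_pmf \<pi> K) y = pmf \<pi> y"
    using LIMSEQ_Suc[OF \<pi>f_lim[of y]] by (simp add: pmf_bind pmf_\<pi> LIMSEQ_unique)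
qed

text \<open>\<open>W\<close> is unbounded, so weak convergence does not reach it; Fatou with the
  uniform bound \<open>c0\<close> does.\<close>

theorem integrable_stationary: "integrable (measure_pmf \<pi>) W"
proof (rule integrableI_nonneg)
  have "(\<integral>\<^sup>+x. ennreal (W x) \<partial>measure_pmf \<pi>) = (\<integral>\<^sup>+y. ennreal (\<pi>f y) * ennreal (W y) \<partial>count_space UNIV)"
    by (simp add: nn_integral_measure_pmf pmf_\<pi>)
  also have "\<dots> = (\<integral>\<^sup>+y. liminf (\<lambda>t. ennreal (pmf (kernel_pow K t z) y) * ennreal (W y)) \<partial>count_space UNIV)"
  proof (intro nn_integral_cong lim_imp_Liminf[symmetric])
    fix y
    have "(\<lambda>t. ennreal (pmf (kernel_pow K t z) y * W y)) \<longlonglongrightarrow> ennreal (\<pi>f y * W y)"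
      by (intro tendsto_ennrealI tendsto_intros \<pi>f_lim)
    then show "(\<lambda>t. ennreal (pmf (kernel_pow K t z) y) * ennreal (W y)) \<longlonglongrightarrow> ennreal (\<pi>f y) * ennreal (W y)"
      by (simp add: ennreal_mult' \<pi>f_nonneg)
  qed auto
  also have "\<dots> \<le> liminf (\<lambda>t. \<integral>\<^sup>+y. ennreal (pmf (kernel_pow K t z) y) * ennreal (W y) \<partial>count_space UNIV)"
    by (intro nn_integral_liminf) auto
  also have "\<dots> = liminf (\<lambda>t. ennreal (Pw t W z))"
    unfolding Pw_def nn_integral_measure_pmf[symmetric]
    using W_nonneg by (simp add: nn_integral_eq_integral)
  also have "\<dots> \<le> liminf (\<lambda>t. ennreal c0)"
    using drift_pow_le by (intro Liminf_mono always_eventually allI ennreal_leI) (auto simp: c0_def)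
  also have "\<dots> = ennreal c0"
    by (simp add: Liminf_const)
  finally show "(\<integral>\<^sup>+x. ennreal (W x) \<partial>measure_pmf \<pi>) < \<infinity>"
    by (rule le_less_trans) simp
qed (use W_nonneg in auto)

text \<open>The initial law may have infinite mean of \<open>W\<close>, so the geometric rate is
  used only from each fixed state; dominated convergence then averages over \<mu>.\<close>

theorem converges_to_stationary:
  fixes f :: "'a \<Rightarrow> real"
  assumes f: "\<And>x. \<bar>f x\<bar> \<le> b"
  shows "(\<lambda>t. \<integral>y. f y \<partial>measure_pmf (bind_pmf \<mu> (kernel_pow K t))) \<longlonglongrightarrow> (\<integral>y. f y \<partial>measure_pmf \<pi>)"
proof -
  obtain m \<beta> \<rho> where m: "1 \<le> m" "0 < \<beta>" "0 \<le> \<rho>" "\<rho> < 1" and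
    forget: "\<And>t x y. \<bar>Pw t f x - Pw t f y\<bar> \<le> b * \<rho> ^ (t div m) * (2 + \<beta> * (W x + W y))"
    using geometric_forgetting f by blast
  have Pw_b: "\<bar>Pw t f x\<bar> \<le> b" for t x
    unfolding Pw_def by (rule abs_integral_pmf_le) (rule f)
  have Pw_x: "(\<lambda>t. Pw t f x) \<longlonglongrightarrow> (\<integral>y. f y \<partial>measure_pmf \<pi>)" for x
  proof -
    have "(\<lambda>t. Pw t f x - Pw t f z) \<longlonglongrightarrow> 0"
      by (rule Lim_null_comparison[OF _ power_div_tendsto_0[OF m(1,3,4)]])
        (auto intro!: always_eventually forget)
    from tendsto_add[OF this Pw_tendsto_z[of f b, OF f]] show ?thesis by simp
  qed
  have "(\<lambda>t. \<integral>x. Pw t f x \<partial>measure_pmf \<mu>) \<longlonglongrightarrow> (\<integral>x. (\<integral>y. f y \<partial>measure_pmf \<pi>) \<partial>measure_pmf \<mu>)"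
    by (rule integral_dominated_convergence[where w = "\<lambda>_. b"]) (auto simp: Pw_x Pw_b)
  moreover have "(\<integral>y. f y \<partial>measure_pmf (bind_pmf \<mu> (kernel_pow K t))) = (\<integral>x. Pw t f x \<partial>measure_pmf \<mu>)" for t
    unfolding Pw_def by (rule integral_bind_pmf') (rule integrable_pmf_bounded, rule f)
  ultimately show ?thesis by simp
qed

end

section \<open>Moments from negative drift\<close>

text \<open>Convexity of the power at the midpoint of \<open>2 * a\<close> and \<open>2 * b\<close>.
  It separates the drift threshold from the geometric excess above it.\<close>

lemma power_add_le_half:
  fixes a b :: real
  assumes "0 \<le> a" "0 \<le> b" "1 \<le> r"
  shows "(a + b) ^ r \<le> ((2 * a) ^ r + (2 * b) ^ r) / 2"
  using assms(3)
proof (induction r rule: nat_induct_at_least)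
  case (Suc r)
  \<comment> \<open>Chebyshev's inequality: \<open>a, b\<close> and \<open>a ^ r, b ^ r\<close> are
    ordered alike.\<close>
  have "0 \<le> (a - b) * (a ^ r - b ^ r)"
    using assms(1,2) by (cases "a \<le> b") (auto simp: mult_nonpos_nonpos power_mono)
  then have *: "(a + b) * (a ^ r + b ^ r) \<le> 2 * (a ^ Suc r + b ^ Suc r)"
    by (simp add: algebra_simps)
  have "(a + b) ^ Suc r \<le> (a + b) * (((2 * a) ^ r + (2 * b) ^ r) / 2)"
    unfolding power_Suc using Suc assms by (intro mult_left_mono) auto
  also have "\<dots> = 2 ^ r / 2 * ((a + b) * (a ^ r + b ^ r))"
    by (simp add: power_mult_distrib algebra_simps)
  also have "\<dots> \<le> 2 ^ r / 2 * (2 * (a ^ Suc r + b ^ Suc r))"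
    using * by (intro mult_left_mono) auto
  finally show ?case
    by (simp add: power_mult_distrib algebra_simps)
qed simp

text \<open>By Pascal's rule, multiplication by \<open>1 - \<rho>\<close> lowers r by one up to a
  nonnegative boundary term.\<close>

lemma negative_binomial_partial_sum:
  fixes \<rho> :: real
  assumes "0 \<le> \<rho>" "\<rho> < 1"
  shows "(\<Sum>k<n. real ((k + r) choose r) * \<rho> ^ k) \<le> 1 / (1 - \<rho>) ^ Suc r"
proof (induction r)
  case 0
  have "(\<Sum>k<n. \<rho> ^ k) = (1 - \<rho> ^ n) / (1 - \<rho>)"
    using assms by (simp add: sum_gp_strict)
  also have "\<dots> \<le> 1 / (1 - \<rho>)"
    using assms by (intro divide_right_mono) auto
  finally show ?case by simp
next
  case (Suc r)
  let ?S = "\<lambda>r n. \<Sum>k<n. real ((k + r) choose r) * \<rho> ^ k"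
  have "(1 - \<rho>) * ?S (Suc r) n + real ((n + r) choose Suc r) * \<rho> ^ n = ?S r n"
  proof (induction n)
    case (Suc n)
    have "?S (Suc r) (Suc n) = ?S (Suc r) n + (real ((n + r) choose r) + real ((n + r) choose Suc r)) * \<rho> ^ n"
      by simp
    moreover have "?S r (Suc n) = ?S r n + real ((n + r) choose r) * \<rho> ^ n"
      "real ((Suc n + r) choose Suc r) * \<rho> ^ Suc n =
        \<rho> * (real ((n + r) choose r) + real ((n + r) choose Suc r)) * \<rho> ^ n"
      by simp_all
    ultimately show ?case
      using Suc.IH[symmetric] by (simp only:) (simp add: algebra_simps)
  qed simp
  moreover have "0 \<le> real ((n + r) choose Suc r) * \<rho> ^ n"
    using assms by simp
  ultimately have "(1 - \<rho>) * ?S (Suc r) n \<le> 1 / (1 - \<rho>) ^ Suc r"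
    using Suc by linarith
  then have "?S (Suc r) n \<le> 1 / (1 - \<rho>) ^ Suc r / (1 - \<rho>)"
    using assms by (subst pos_le_divide_eq) (auto simp only: mult.commute[of _ "1 - \<rho>"] diff_gt_0_iff_gt)
  then show ?case
    by (simp add: mult.commute)
qed

text \<open>The right side is the rising factorial N (N + 1) ... (N + r).\<close>

lemma power_le_fact_binomial: "real N ^ Suc r \<le> fact (Suc r) * real ((N + r) choose Suc r)"
proof (induction r)
  case (Suc r)
  have *: "real (Suc (Suc r)) * real ((N + Suc r) choose Suc (Suc r)) = real ((N + r) choose Suc r) * real (N + Suc r)"
  proof -
    have "Suc (Suc r) * (Suc (N + r) choose Suc (Suc r)) = Suc (N + r) * ((N + r) choose Suc r)"
      by (rule Suc_times_binomial)
    then show ?thesis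
      by (metis add_Suc_right mult.commute of_nat_mult)
  qed
  have "real N ^ Suc (Suc r) \<le> (fact (Suc r) * real ((N + r) choose Suc r)) * real (N + Suc r)"
    using Suc by (subst power_Suc2, intro mult_mono) auto
  also have "\<dots> = fact (Suc (Suc r)) * real ((N + Suc r) choose Suc (Suc r))"
    by (simp only: mult.assoc * [symmetric]) (simp add: mult_ac)
  finally show ?case .
qed simp

text \<open>Since \<open>N\<^sup>r \<le> r! \<cdot> (N + r - 1 choose r)\<close>, summation by parts turns a geometric tail into
  the negative binomial series.\<close>

lemma geometric_tail_moment:
  fixes N :: "'a \<Rightarrow> nat"
  assumes \<rho>: "0 \<le> \<rho>" "\<rho> < 1" and r: "1 \<le> r"
    and tail: "\<And>k. measure (measure_pmf p) {x. k < N x} \<le> \<rho> ^ k"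
  shows "(\<integral>\<^sup>+x. ennreal (real (N x) ^ r) \<partial>measure_pmf p) \<le> ennreal (fact r / (1 - \<rho>) ^ r)"
proof -
  obtain r' where r': "r = Suc r'" using r by (cases r) auto
  \<comment> \<open>The hockey-stick identity: these increments weight the tail probabilities
    below.\<close>
  have binom: "real ((n + r') choose Suc r') = (\<Sum>k<n. real ((k + r') choose r'))" for n
    by (induction n) simp_all
  have step: "ennreal (real ((N x + r') choose Suc r')) =
      (\<Sum>k. ennreal (real ((k + r') choose r')) * indicator {x. k < N x} x)" for x
  proof -
    have "(\<Sum>k. ennreal (real ((k + r') choose r')) * indicator {x. k < N x} x) =
        (\<Sum>k<N x. ennreal (real ((k + r') choose r')) * indicator {x. k < N x} x)"
      by (rule suminf_finite) (auto simp: indicator_def)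
    also have "\<dots> = (\<Sum>k<N x. ennreal (real ((k + r') choose r')))"
      by (intro sum.cong) (auto simp: indicator_def)
    also have "\<dots> = ennreal (real ((N x + r') choose Suc r'))"
      unfolding binom by (simp add: sum_ennreal)
    finally show ?thesis ..
  qed
  have "(\<integral>\<^sup>+x. ennreal (real ((N x + r') choose Suc r')) \<partial>measure_pmf p) =
      (\<Sum>k. ennreal (real ((k + r') choose r')) * emeasure (measure_pmf p) {x. k < N x})"
    unfolding step by (subst nn_integral_suminf) (auto simp: nn_integral_cmult_indicator)
  also have "\<dots> \<le> ennreal (1 / (1 - \<rho>) ^ r)"
  proof (rule suminf_le_const)
    fix n
    have "(\<Sum>k<n. ennreal (real ((k + r') choose r')) * emeasure (measure_pmf p) {x. k < N x})
        = ennreal (\<Sum>k<n. real ((k + r') choose r') * measure (measure_pmf p) {x. k < N x})"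
      by (simp add: measure_pmf.emeasure_eq_measure ennreal_mult'[symmetric] sum_ennreal)
    also have "\<dots> \<le> ennreal (\<Sum>k<n. real ((k + r') choose r') * \<rho> ^ k)"
      by (intro ennreal_leI sum_mono mult_left_mono tail) auto
    also have "\<dots> \<le> ennreal (1 / (1 - \<rho>) ^ r)"
      unfolding r' by (intro ennreal_leI negative_binomial_partial_sum \<rho>)
    finally show "(\<Sum>k<n. ennreal (real ((k + r') choose r')) * emeasure (measure_pmf p) {x. k < N x})
        \<le> ennreal (1 / (1 - \<rho>) ^ r)" .
  qed auto
  finally have B: "(\<integral>\<^sup>+x. ennreal (real ((N x + r') choose Suc r')) \<partial>measure_pmf p) \<le> ennreal (1 / (1 - \<rho>) ^ r)" .
  have "(\<integral>\<^sup>+x. ennreal (real (N x) ^ r) \<partial>measure_pmf p) \<le>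
      (\<integral>\<^sup>+x. ennreal (fact r) * ennreal (real ((N x + r') choose Suc r')) \<partial>measure_pmf p)"
    using power_le_fact_binomial[of _ r'] unfolding r'
    by (intro nn_integral_mono) (simp add: ennreal_mult'[symmetric])
  also have "\<dots> = ennreal (fact r) * (\<integral>\<^sup>+x. ennreal (real ((N x + r') choose Suc r')) \<partial>measure_pmf p)"
    by (rule nn_integral_cmult) auto
  also have "\<dots> \<le> ennreal (fact r) * ennreal (1 / (1 - \<rho>) ^ r)"
    by (rule mult_left_mono[OF B]) auto
  finally show ?thesis
    using \<rho> by (simp add: ennreal_mult'[symmetric])
qed

lemma exp_le_quadratic:
  fixes x :: real
  assumes "\<bar>x\<bar> \<le> 1"
  shows "exp x \<le> 1 + x + x\<^sup>2"
proof (cases "0 \<le> x")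
  case True
  then show ?thesis using assms by (intro exp_bound) auto
next
  case False
  have "1 - x \<le> exp (- x)" using exp_ge_add_one_self[of "- x"] by simp
  then have "(1 - x) * exp x \<le> exp (- x) * exp x" by (rule mult_right_mono) simp
  then have "(1 - x) * exp x \<le> 1" by (simp flip: exp_add)
  \<comment> \<open>The product equals 1 - x^3, and x is negative.\<close>
  also have "1 \<le> (1 - x) * (1 + x + x\<^sup>2)"
    using False by (simp add: algebra_simps power2_eq_square mult_nonpos_nonneg)
  finally show ?thesis using False by simp
qed

section \<open>Tails and moments of a stationary chain with negative drift\<close>

locale stationary_drift =
  fixes K :: "'a \<Rightarrow> 'a pmf" and p :: "'a pmf" and Z :: "'a \<Rightarrow> real" and \<kappa> \<eta> D :: real
  assumes finite_K: "\<And>x. finite (set_pmf (K x))"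
    and stationary: "bind_pmf p K = p"
    and integrable_Z: "integrable (measure_pmf p) Z"
    and Z_nonneg: "\<And>x. 0 \<le> Z x"
    and pos: "0 \<le> \<kappa>" "0 < \<eta>" "0 < D"
    and increment: "\<And>x y. y \<in> set_pmf (K x) \<Longrightarrow> \<bar>Z y - Z x\<bar> \<le> D"
    and drift: "\<And>x. \<kappa> \<le> Z x \<Longrightarrow> (\<integral>y. Z y \<partial>measure_pmf (K x)) \<le> Z x - \<eta>"
begin

text \<open>The drift of \<open>max c Z\<close> vanishes in stationarity, is at most \<open>D\<close> near \<open>c\<close>, at most \<open>-\<eta>\<close>
  above and zero below.\<close>

lemma tail_step:
  assumes c: "\<kappa> \<le> c + D"
  shows "(D + \<eta>) * measure (measure_pmf p) {x. c + D \<le> Z x} \<le> D * measure (measure_pmf p) {x. c - D < Z x}"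
proof -
  let ?Y = "\<lambda>x. max c (Z x)"
  have intY: "integrable (measure_pmf p) ?Y"
    using integrable_Z by (intro integrable_max) auto
  then have intY': "integrable (measure_pmf (bind_pmf p K)) ?Y" by (simp add: stationary)
  have intK: "integrable (measure_pmf (K x)) f" for x and f :: "'a \<Rightarrow> real"
    by (rule integrable_measure_pmf_finite[OF finite_K])
  have pointwise: "(\<integral>y. ?Y y \<partial>measure_pmf (K x)) - ?Y x \<le>
      D * indicator {x. c - D < Z x} x - (D + \<eta>) * indicator {x. c + D \<le> Z x} x" for x
  proof -
    \<comment> \<open>A step moves \<open>Z\<close> by at most \<open>D\<close>: from below
      \<open>c - D\<close> the maximum stays \<open>c\<close>, and from above \<open>c + D\<close>
      it coincides with \<open>Z\<close>.\<close>
    consider "Z x \<le> c - D" | "c - D < Z x" "Z x < c + D" | "c + D \<le> Z x" by linarith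
    then show ?thesis
    proof cases
      case 1
      have "(\<integral>y. ?Y y \<partial>measure_pmf (K x)) = (\<integral>y. c \<partial>measure_pmf (K x))"
        using increment[of _ x] 1 by (intro integral_cong_AE) (force simp: AE_measure_pmf_iff)+
      then show ?thesis using 1 pos by (simp add: indicator_def)
    next
      case 2
      have "(\<integral>y. ?Y y \<partial>measure_pmf (K x)) \<le> (\<integral>y. ?Y x + D \<partial>measure_pmf (K x))"
      proof (intro integral_mono_AE intK, unfold AE_measure_pmf_iff, rule ballI)
        fix y assume "y \<in> set_pmf (K x)"
        then show "?Y y \<le> ?Y x + D" using increment[of y x] pos by linarith
      qed
      then show ?thesis using 2 pos by (simp add: indicator_def)
    next
      case 3
      have "(\<integral>y. ?Y y \<partial>measure_pmf (K x)) = (\<integral>y. Z y \<partial>measure_pmf (K x))"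
        using increment[of _ x] 3 by (intro integral_cong_AE) (force simp: AE_measure_pmf_iff)+
      also have "\<dots> \<le> Z x - \<eta>"
        using 3 c by (intro drift) auto
      finally show ?thesis using 3 pos by (simp add: indicator_def)
    qed
  qed
  have ind: "integrable (measure_pmf p) (indicator A :: 'a \<Rightarrow> real)" for A
    by (rule integrable_pmf_bounded[where b = 1]) (simp add: indicator_def)
  have "0 = (\<integral>x. (\<integral>y. ?Y y \<partial>measure_pmf (K x)) - ?Y x \<partial>measure_pmf p)"
    using integral_bind_pmf'[OF intY'] integrable_inner_pmf[OF intY'] intY by (simp add: stationary)
  also have "\<dots> \<le> (\<integral>x. D * indicator {x. c - D < Z x} x - (D + \<eta>) * indicator {x. c + D \<le> Z x} x \<partial>measure_pmf p)"
    using integrable_inner_pmf[OF intY'] intY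
    by (intro integral_mono pointwise Bochner_Integration.integrable_diff integrable_mult_right ind) auto
  also have "\<dots> = D * measure (measure_pmf p) {x. c - D < Z x} - (D + \<eta>) * measure (measure_pmf p) {x. c + D \<le> Z x}"
    by (subst Bochner_Integration.integral_diff) (auto intro!: integrable_mult_right ind)
  finally show ?thesis by simp
qed

text \<open>\<open>tail_step\<close> compares the levels \<open>c + D\<close> and
  \<open>c - D\<close>, hence the spacing \<open>2 * D\<close>; each spacing gains the factor
  \<open>D / (D + \<eta>)\<close>.\<close>

lemma geometric_tail:
  "measure (measure_pmf p) {x. \<kappa> + 2 * D * real m \<le> Z x} \<le> (D / (D + \<eta>)) ^ m"
proof (induction m)
  case (Suc m)
  let ?P = "\<lambda>A. measure (measure_pmf p) A"
  have "(D + \<eta>) * ?P {x. \<kappa> + 2 * D * real (Suc m) \<le> Z x} \<le> D * ?P {x. \<kappa> + 2 * D * real m < Z x}"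
    using tail_step[of "\<kappa> + 2 * D * real m + D"] pos by (simp add: algebra_simps)
  also have "\<dots> \<le> D * ?P {x. \<kappa> + 2 * D * real m \<le> Z x}"
    using pos by (intro mult_left_mono measure_pmf.finite_measure_mono) auto
  also have "\<dots> \<le> D * (D / (D + \<eta>)) ^ m"
    using pos Suc by (intro mult_left_mono) auto
  finally show ?case
    using pos by (simp add: pos_le_divide_eq mult.commute)
qed simp

theorem moment_bound:
  assumes r: "1 \<le> r"
  shows "integrable (measure_pmf p) (\<lambda>x. Z x ^ r)"
    and "(\<integral>x. Z x ^ r \<partial>measure_pmf p) \<le> ((2 * \<kappa>) ^ r + (4 * D * (D + \<eta>) / \<eta>) ^ r * fact r) / 2"
proof -
  \<comment> \<open>Rounding up serves both directions: \<open>Z\<close> is at most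
    \<open>\<kappa> + 2 * D * N\<close>, while \<open>k < N x\<close> still forces \<open>Z\<close>
    above the k-th level.\<close>
  define N where "N x = nat (\<lceil>(Z x - \<kappa>) / (2 * D)\<rceil>)" for x
  let ?\<rho> = "D / (D + \<eta>)"
  let ?B = "((2 * \<kappa>) ^ r + (4 * D * (D + \<eta>) / \<eta>) ^ r * fact r) / 2"
  have \<rho>: "0 \<le> ?\<rho>" "?\<rho> < 1" using pos by auto
  have Z_le: "Z x \<le> \<kappa> + 2 * D * real (N x)" for x
  proof -
    have "(Z x - \<kappa>) / (2 * D) \<le> real (N x)"
      unfolding N_def by (rule real_nat_ceiling_ge)
    then show ?thesis using pos by (simp add: field_simps)
  qed
  have tail: "measure (measure_pmf p) {x. k < N x} \<le> ?\<rho> ^ k" for k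
  proof -
    have "{x. k < N x} \<subseteq> {x. \<kappa> + 2 * D * real k \<le> Z x}"
    proof clarify
      fix x assume "k < N x"
      then have "real k < (Z x - \<kappa>) / (2 * D)"
        by (metis N_def less_ceiling_iff of_int_of_nat_eq zless_nat_eq_int_zless)
      then show "\<kappa> + 2 * D * real k \<le> Z x" using pos by (simp add: field_simps)
    qed
    then have "measure (measure_pmf p) {x. k < N x} \<le> measure (measure_pmf p) {x. \<kappa> + 2 * D * real k \<le> Z x}"
      by (intro measure_pmf.finite_measure_mono) auto
    also have "\<dots> \<le> ?\<rho> ^ k" by (rule geometric_tail)
    finally show ?thesis .
  qed
  have "(\<integral>\<^sup>+x. ennreal (Z x ^ r) \<partial>measure_pmf p) \<le>
      (\<integral>\<^sup>+x. ennreal ((2 * \<kappa>) ^ r / 2) + ennreal ((4 * D) ^ r / 2) * ennreal (real (N x) ^ r) \<partial>measure_pmf p)"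
  proof (intro nn_integral_mono)
    fix x
    have "Z x ^ r \<le> (\<kappa> + 2 * D * real (N x)) ^ r"
      using Z_le Z_nonneg by (intro power_mono) auto
    also have "\<dots> \<le> ((2 * \<kappa>) ^ r + (2 * (2 * D * real (N x))) ^ r) / 2"
      using pos r by (intro power_add_le_half) auto
    also have "\<dots> = (2 * \<kappa>) ^ r / 2 + (4 * D) ^ r / 2 * real (N x) ^ r"
      by (simp add: power_mult_distrib add_divide_distrib flip: mult.assoc)
    finally show "ennreal (Z x ^ r) \<le> ennreal ((2 * \<kappa>) ^ r / 2) + ennreal ((4 * D) ^ r / 2) * ennreal (real (N x) ^ r)"
      using pos by (simp add: ennreal_mult'[symmetric] ennreal_plus[symmetric] ennreal_leI del: ennreal_plus)
  qed
  also have "\<dots> = ennreal ((2 * \<kappa>) ^ r / 2) + ennreal ((4 * D) ^ r / 2) * (\<integral>\<^sup>+x. ennreal (real (N x) ^ r) \<partial>measure_pmf p)"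
    by (subst nn_integral_add) (auto simp: nn_integral_cmult)
  also have "\<dots> \<le> ennreal ((2 * \<kappa>) ^ r / 2) + ennreal ((4 * D) ^ r / 2) * ennreal (fact r / (1 - ?\<rho>) ^ r)"
    using geometric_tail_moment[OF \<rho> r tail] by (intro add_left_mono mult_left_mono) auto
  also have "\<dots> = ennreal ((2 * \<kappa>) ^ r / 2 + (4 * D) ^ r / 2 * (fact r / (1 - ?\<rho>) ^ r))"
    using pos \<rho> by (simp add: ennreal_mult'[symmetric] ennreal_plus[symmetric] del: ennreal_plus)
  also have "(2 * \<kappa>) ^ r / 2 + (4 * D) ^ r / 2 * (fact r / (1 - ?\<rho>) ^ r) = ?B"
  proof -
    have "1 - ?\<rho> = \<eta> / (D + \<eta>)" using pos by (simp add: field_simps)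
    moreover have "4 * D * (D + \<eta>) / \<eta> = 4 * D / (\<eta> / (D + \<eta>))" by simp
    ultimately show ?thesis by (simp only: power_divide) (simp add: add_divide_distrib, simp only: mult_ac)
  qed
  finally have le: "(\<integral>\<^sup>+x. ennreal (Z x ^ r) \<partial>measure_pmf p) \<le> ennreal ?B" .
  then show "integrable (measure_pmf p) (\<lambda>x. Z x ^ r)"
    by (intro integrableI_nonneg) (auto simp: Z_nonneg intro: le_less_trans)
  have "0 \<le> ?B" using pos by simp
  then show "(\<integral>x. Z x ^ r \<partial>measure_pmf p) \<le> ?B"
    using le by (intro integral_real_bounded) auto
qed

end

lemma exp_drift:
  fixes Z :: "'a \<Rightarrow> real"
  assumes finite_K: "\<And>x. finite (set_pmf (K x))"
    and pos: "0 < \<eta>" "0 < D"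
    and increment: "\<And>x y. y \<in> set_pmf (K x) \<Longrightarrow> \<bar>Z y - Z x\<bar> \<le> D"
    and drift: "\<And>x. \<kappa> \<le> Z x \<Longrightarrow> (\<integral>y. Z y \<partial>measure_pmf (K x)) \<le> Z x - \<eta>"
  shows "\<exists>\<theta> \<gamma> C. 0 < \<theta> \<and> 0 \<le> \<gamma> \<and> \<gamma> < 1 \<and> 0 \<le> C \<and>
    (\<forall>x. (\<integral>y. exp (\<theta> * Z y) \<partial>measure_pmf (K x)) \<le> \<gamma> * exp (\<theta> * Z x) + C)"
proof -
  \<comment> \<open>The first bound puts the exponent in the range of
    \<open>exp_le_quadratic\<close>; the second makes the quadratic term at most half of the linear
    gain \<open>\<theta> * \<eta>\<close>.\<close>
  define \<theta> where "\<theta> = min (1 / D) (\<eta> / (2 * D\<^sup>2))"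
  define \<gamma> where "\<gamma> = max 0 (1 - \<theta> * \<eta> / 2)"
  define C where "C = exp (\<theta> * (\<kappa> + D))"
  have \<theta>: "0 < \<theta>" "\<theta> * D \<le> 1" "2 * (\<theta> * D\<^sup>2) \<le> \<eta>"
    using pos by (auto simp: \<theta>_def min_def field_simps)
  have int: "integrable (measure_pmf (K x)) f" for x and f :: "'a \<Rightarrow> real"
    by (rule integrable_measure_pmf_finite[OF finite_K])
  have "(\<integral>y. exp (\<theta> * Z y) \<partial>measure_pmf (K x)) \<le> \<gamma> * exp (\<theta> * Z x) + C" for x
  proof (cases "\<kappa> \<le> Z x")
    case True
    have "(\<integral>y. exp (\<theta> * Z y) \<partial>measure_pmf (K x)) \<le>
        (\<integral>y. exp (\<theta> * Z x) * (1 + \<theta> * (Z y - Z x) + (\<theta> * D)\<^sup>2) \<partial>measure_pmf (K x))"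
    proof (intro integral_mono_AE int, unfold AE_measure_pmf_iff, rule ballI)
      fix y assume y: "y \<in> set_pmf (K x)"
      have abs: "\<bar>\<theta> * (Z y - Z x)\<bar> \<le> \<theta> * D"
        using \<theta> increment[OF y] by (simp add: abs_mult)
      have "exp (\<theta> * (Z y - Z x)) \<le> 1 + \<theta> * (Z y - Z x) + (\<theta> * (Z y - Z x))\<^sup>2"
        using abs \<theta> by (intro exp_le_quadratic) auto
      also have "(\<theta> * (Z y - Z x))\<^sup>2 \<le> (\<theta> * D)\<^sup>2"
        using abs by (metis abs_ge_zero power2_abs power_mono)
      finally have "exp (\<theta> * Z x) * exp (\<theta> * (Z y - Z x)) \<le> exp (\<theta> * Z x) * (1 + \<theta> * (Z y - Z x) + (\<theta> * D)\<^sup>2)"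
        by (intro mult_left_mono) auto
      then show "exp (\<theta> * Z y) \<le> exp (\<theta> * Z x) * (1 + \<theta> * (Z y - Z x) + (\<theta> * D)\<^sup>2)"
        by (simp add: algebra_simps flip: exp_add)
    qed
    also have "\<dots> = exp (\<theta> * Z x) * (1 + \<theta> * ((\<integral>y. Z y \<partial>measure_pmf (K x)) - Z x) + (\<theta> * D)\<^sup>2)"
      using int by simp
    also have "\<dots> \<le> exp (\<theta> * Z x) * \<gamma>"
    proof (rule mult_left_mono)
      have "\<theta> * ((\<integral>y. Z y \<partial>measure_pmf (K x)) - Z x) \<le> \<theta> * (- \<eta>)"
        using drift[OF True] \<theta> by (intro mult_left_mono) auto
      moreover have "\<theta> * (2 * (\<theta> * D\<^sup>2)) \<le> \<theta> * \<eta>"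
        using \<theta> by (intro mult_left_mono) auto
      ultimately show "1 + \<theta> * ((\<integral>y. Z y \<partial>measure_pmf (K x)) - Z x) + (\<theta> * D)\<^sup>2 \<le> \<gamma>"
        by (simp add: \<gamma>_def power2_eq_square algebra_simps)
    qed simp
    finally show ?thesis
      by (simp add: C_def add_increasing2 mult.commute)
  next
    case False
    have "(\<integral>y. exp (\<theta> * Z y) \<partial>measure_pmf (K x)) \<le> (\<integral>y. C \<partial>measure_pmf (K x))"
      using increment[of _ x] False \<theta>
      by (intro integral_mono_AE int) (force simp: AE_measure_pmf_iff C_def)
    then show ?thesis
      by (simp add: \<gamma>_def add_increasing)
  qed
  moreover have "\<gamma> < 1" "0 \<le> \<gamma>" "0 \<le> C"
    using \<theta> pos by (auto simp: \<gamma>_def C_def)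
  ultimately show ?thesis
    using \<theta>(1) by blast
qed

text \<open>Induction on the logarithmic form, with equality at r = 1. The step is (r + 1/2) ln (1 +
  1/r) \<ge> 1, which follows from the midpoint estimate for the logarithm.\<close>

lemma fact_le_stirling:
  assumes "1 \<le> r"
  shows "fact r \<le> sqrt (real r) * exp 1 * (real r / exp 1) ^ r"
proof -
  have "fact r \<le> exp ((real r + 1 / 2) * ln (real r) - real r + 1)"
    using assms
  proof (induction r rule: nat_induct_at_least)
    case (Suc r)
    have r: "0 < real r" using Suc by simp
    have "2 * (real r + 1 - real r) / (real r + (real r + 1)) \<le> ln (real r + 1) - ln (real r)"
      using r by (intro ln_inverse_approx_ge) auto
    then have "1 \<le> (real r + 1 / 2) * (ln (real r + 1) - ln (real r))"
      using r by (simp add: field_simps)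
    then have *: "ln (real r + 1) + ((real r + 1 / 2) * ln (real r) - real r + 1) \<le>
        (real (Suc r) + 1 / 2) * ln (real (Suc r)) - real (Suc r) + 1"
      by (simp add: algebra_simps)
    have "fact (Suc r) \<le> real (Suc r) * exp ((real r + 1 / 2) * ln (real r) - real r + 1)"
      using Suc by (simp only: fact_Suc) (rule mult_left_mono; simp)
    also have "\<dots> = exp (ln (real r + 1) + ((real r + 1 / 2) * ln (real r) - real r + 1))"
      using r by (subst exp_add) simp
    also have "\<dots> \<le> exp ((real (Suc r) + 1 / 2) * ln (real (Suc r)) - real (Suc r) + 1)"
      using * by simp
    finally show ?case .
  qed simp
  also have "(real r + 1 / 2) * ln (real r) - real r + 1 = ln (real r) / 2 + 1 + real r * (ln (real r) - 1)"
    by (simp add: algebra_simps)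
  also have "exp \<dots> = sqrt (real r) * exp 1 * (real r / exp 1) ^ r"
    using assms by (simp add: exp_add exp_diff exp_of_nat_mult ln_sqrt[symmetric])
  finally show ?thesis .
qed

section \<open>The cone of additive matrices\<close>

definition total :: "real^'n::finite^'n \<Rightarrow> real" where
  "total x = (\<Sum>i\<in>UNIV. row_sum x i)"

lemma row_sum_linear [simp]:
  fixes x y :: "real^'n::finite^'n"
  shows "row_sum (x + y) i = row_sum x i + row_sum y i" "row_sum (x - y) i = row_sum x i - row_sum y i"
    "row_sum (c *\<^sub>R x) i = c * row_sum x i"
  by (simp_all add: row_sum_def sum.distrib sum_subtractf sum_distrib_left)

lemma col_sum_linear [simp]:
  fixes x y :: "real^'n::finite^'n"
  shows "col_sum (x + y) i = col_sum x i + col_sum y i" "col_sum (x - y) i = col_sum x i - col_sum y i"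
    "col_sum (c *\<^sub>R x) i = c * col_sum x i"
  by (simp_all add: col_sum_def sum.distrib sum_subtractf sum_distrib_left)

lemma total_linear [simp]:
  fixes x y :: "real^'n::finite^'n"
  shows "total (x + y) = total x + total y" "total (x - y) = total x - total y" "total (c *\<^sub>R x) = c * total x"
  by (simp_all add: total_def sum.distrib sum_subtractf sum_distrib_left)

lemma total_col: "total x = (\<Sum>j\<in>UNIV. col_sum x j)"
  unfolding total_def by (rule sum_row_sum_eq_sum_col_sum)

lemma total_queue_eq: "total_queue x = total (real_mat x)"
  by (simp add: total_queue_def total_def row_sum_def)

text \<open>The orthogonal projection onto the matrices \<open>w\<^sub>i + v\<^sub>j\<close>.\<close>

definition proj :: "real^'n::finite^'n \<Rightarrow> real^'n^'n" where
  "proj x = (\<chi> i j. (row_sum x i + col_sum x j - total x / real CARD('n)) / real CARD('n))"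

text \<open>This is n times the inner product of the projections. The form makes it computable from
  row and column sums alone, which for a maximal schedule are all 1.\<close>

definition quad :: "real^'n::finite^'n \<Rightarrow> real^'n^'n \<Rightarrow> real" where
  "quad x y = (\<Sum>i\<in>UNIV. row_sum x i * row_sum y i) + (\<Sum>j\<in>UNIV. col_sum x j * col_sum y j)
     - total x * total y / real CARD('n)"

lemma quad_commute: "quad x y = quad y x"
  by (simp add: quad_def mult.commute)

lemma quad_add_left: "quad (x + y) z = quad x z + quad y z"
  by (simp add: quad_def distrib_right sum.distrib add_divide_distrib)

lemma quad_diff_left: "quad (x - y) z = quad x z - quad y z"
  by (simp add: quad_def left_diff_distrib sum_subtractf diff_divide_distrib)

lemma quad_add_right: "quad z (x + y) = quad z x + quad z y"
  by (simp add: quad_commute[of z] quad_add_left)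

lemma quad_diff_right: "quad z (x - y) = quad z x - quad z y"
  by (simp add: quad_commute[of z] quad_diff_left)

lemma quad_eq_inner_proj: "quad x y = real CARD('n) * (proj x \<bullet> y)" for x y :: "real^'n::finite^'n"
proof -
  have "real CARD('n) * (proj x \<bullet> y) =
      (\<Sum>i\<in>UNIV. \<Sum>j\<in>UNIV. (row_sum x i + col_sum x j - total x / real CARD('n)) * y $ i $ j)"
    by (simp add: inner_matrix proj_def sum_distrib_left)
  also have "\<dots> = (\<Sum>i\<in>UNIV. \<Sum>j\<in>UNIV. row_sum x i * y $ i $ j) + (\<Sum>i\<in>UNIV. \<Sum>j\<in>UNIV. col_sum x j * y $ i $ j)
      - (\<Sum>i\<in>UNIV. \<Sum>j\<in>UNIV. total x / real CARD('n) * y $ i $ j)"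
    by (simp only: distrib_right left_diff_distrib sum.distrib sum_subtractf)
  also have "(\<Sum>i\<in>UNIV. \<Sum>j\<in>UNIV. col_sum x j * y $ i $ j) = (\<Sum>j\<in>UNIV. \<Sum>i\<in>UNIV. col_sum x j * y $ i $ j)"
    by (rule sum.swap)
  finally show ?thesis
    by (simp add: quad_def total_def[of y] row_sum_def[of y] col_sum_def[of y] sum_distrib_left[symmetric]
        sum_divide_distrib[symmetric])
qed

lemma row_sum_proj: "row_sum (proj x) i = row_sum x i" for x :: "real^'n::finite^'n"
  by (simp add: row_sum_def proj_def sum.distrib sum_subtractf flip: sum_divide_distrib)
    (simp add: total_col col_sum_def row_sum_def field_simps)

lemma col_sum_proj: "col_sum (proj x) i = col_sum x i" for x :: "real^'n::finite^'n"
  by (simp add: col_sum_def proj_def sum.distrib sum_subtractf flip: sum_divide_distrib)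
    (simp add: total_def col_sum_def row_sum_def field_simps)

lemma quad_proj: "quad (proj x) y = quad x y"
  by (simp add: quad_def row_sum_proj col_sum_proj total_def)

lemma quad_self_eq_norm: "quad x x = real CARD('n) * (norm (proj x))\<^sup>2" for x :: "real^'n::finite^'n"
proof -
  have "quad x x = quad x (proj x)"
    by (simp add: quad_commute[of x "proj x"] quad_proj)
  then show ?thesis
    by (simp add: quad_eq_inner_proj power2_norm_eq_inner)
qed

lemma quad_self_nonneg: "0 \<le> quad x x"
  by (simp add: quad_self_eq_norm)

lemma norm_proj: "(norm (x - proj x))\<^sup>2 = (norm x)\<^sup>2 - (norm (proj x))\<^sup>2" for x :: "real^'n::finite^'n"
proof -
  have "proj x \<bullet> x = (norm (proj x))\<^sup>2"
    using quad_self_eq_norm[of x] by (simp add: quad_eq_inner_proj)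
  then show ?thesis
    by (simp add: power2_norm_eq_inner inner_diff_left inner_diff_right inner_commute)
qed

lemma norm_diff_proj_le: "norm (x - proj x) \<le> norm x"
  by (rule power2_le_imp_le) (auto simp: norm_proj)

lemma norm_proj_le: "norm (proj x) \<le> norm x"
proof (rule power2_le_imp_le)
  show "(norm (proj x))\<^sup>2 \<le> (norm x)\<^sup>2"
    using norm_proj[of x] zero_le_power2[of "norm (x - proj x)"] by linarith
qed simp

text \<open>These are the nonnegative matrices of the form \<open>w\<^sub>i + v\<^sub>j\<close>; shifting a constant between
  \<open>w\<close> and \<open>v\<close> makes both nonnegative, so this is the cone \<open>\<K>\<close> of the state space collapse.\<close>

definition additive_cone :: "(real^'n::finite^'n) set" where
  "additive_cone = {x. (\<forall>i j. 0 \<le> x $ i $ j) \<and> (\<forall>i j k l. x $ i $ j + x $ k $ l = x $ i $ l + x $ k $ j)}"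

lemma additive_cone_nonneg: "x \<in> additive_cone \<Longrightarrow> 0 \<le> x $ i $ j"
  by (simp add: additive_cone_def)

lemma additive_cone_add:
  assumes "x \<in> additive_cone" "y \<in> additive_cone"
  shows "x + y \<in> additive_cone"
proof -
  have "x $ i $ j + y $ i $ j + (x $ k $ l + y $ k $ l) = x $ i $ l + y $ i $ l + (x $ k $ j + y $ k $ j)" for i j k l
  proof -
    have "x $ i $ j + x $ k $ l = x $ i $ l + x $ k $ j" "y $ i $ j + y $ k $ l = y $ i $ l + y $ k $ j"
      using assms by (simp_all add: additive_cone_def)
    then show ?thesis by simp
  qed
  then show ?thesis
    using assms by (simp add: additive_cone_def)
qed

lemma zero_in_additive_cone: "0 \<in> additive_cone"
  by (simp add: additive_cone_def)

lemma convex_additive_cone: "convex (additive_cone :: (real^'n::finite^'n) set)"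
proof (rule convexI)
  fix x y :: "real^'n^'n" and u v :: real
  assume x: "x \<in> additive_cone" and y: "y \<in> additive_cone" and uv: "0 \<le> u" "0 \<le> v"
  have "u * x $ i $ j + v * y $ i $ j + (u * x $ k $ l + v * y $ k $ l) =
      u * x $ i $ l + v * y $ i $ l + (u * x $ k $ j + v * y $ k $ j)" for i j k l
  proof -
    have "u * (x $ i $ j + x $ k $ l) = u * (x $ i $ l + x $ k $ j)"
      "v * (y $ i $ j + y $ k $ l) = v * (y $ i $ l + y $ k $ j)"
      using x y by (simp_all add: additive_cone_def)
    then show ?thesis by (simp add: distrib_left)
  qed
  then show "u *\<^sub>R x + v *\<^sub>R y \<in> additive_cone"
    using x y uv by (simp add: additive_cone_def)
qed

lemma closed_additive_cone: "closed (additive_cone :: (real^'n::finite^'n) set)"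
proof -
  have "additive_cone = (\<Inter>i j. {x :: real^'n^'n. 0 \<le> x $ i $ j}) \<inter>
      (\<Inter>i j k l. {x. x $ i $ j + x $ k $ l = x $ i $ l + x $ k $ j})"
    by (auto simp: additive_cone_def)
  also have "closed \<dots>"
    by (intro closed_Int closed_INT ballI closed_Collect_le closed_Collect_eq continuous_intros)
  finally show ?thesis .
qed

text \<open>Sum the exchange identity of the cone over k and l.\<close>

lemma proj_additive:
  fixes x :: "real^'n::finite^'n"
  assumes "x \<in> additive_cone"
  shows "proj x = x"
proof -
  let ?n = "real CARD('n)"
  have "proj x $ i $ j = x $ i $ j" for i j
  proof -
    have "(\<Sum>k\<in>UNIV. \<Sum>l\<in>UNIV. x $ i $ j + x $ k $ l) = (\<Sum>k\<in>UNIV. \<Sum>l\<in>UNIV. x $ i $ l + x $ k $ j)"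
      using assms by (simp add: additive_cone_def)
    then have "?n * (?n * x $ i $ j) + total x = ?n * row_sum x i + ?n * col_sum x j"
      by (simp add: sum.distrib total_def row_sum_def col_sum_def sum_distrib_left)
    then show ?thesis by (simp add: proj_def field_simps)
  qed
  then show ?thesis by (simp add: vec_eq_iff)
qed

lemma inner_additive_zero:
  fixes x m :: "real^'n::finite^'n"
  assumes "x \<in> additive_cone" "\<And>i. row_sum m i = 0" "\<And>j. col_sum m j = 0"
  shows "x \<bullet> m = 0"
proof -
  have "real CARD('n) * (x \<bullet> m) = quad x m"
    using assms by (simp add: quad_eq_inner_proj proj_additive)
  then show ?thesis using assms by (simp add: quad_def total_def)
qed

text \<open>The projection fixes the nearest cone point \<open>k\<close>, so \<open>proj y\<close>
  and \<open>y\<close> differ by the complementary part of \<open>y - k\<close>, which is no longer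
  than \<open>y - k\<close>. Orthogonality of \<open>y\<close> and \<open>u\<close> removes the
  rest.\<close>

lemma quad_le_infdist:
  fixes y u :: "real^'n::finite^'n"
  assumes "y \<bullet> u = 0"
  shows "\<bar>quad y u\<bar> \<le> real CARD('n) * (infdist y additive_cone * norm u)"
proof -
  define k where "k = closest_point additive_cone y"
  have k: "k \<in> additive_cone" "infdist y additive_cone = norm (y - k)"
    using closest_point_in_set[OF closed_additive_cone, of y] zero_in_additive_cone
      setdist_closest_point[OF closed_additive_cone, of y]
    by (auto simp: k_def infdist_eq_setdist dist_norm)
  have "quad y u = quad (y - k) u + quad k u"
    by (simp flip: quad_add_left)
  also have "\<dots> = real CARD('n) * (proj (y - k) \<bullet> u + k \<bullet> u - y \<bullet> u)"
    using k assms by (simp add: quad_eq_inner_proj proj_additive distrib_left)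
  also have "proj (y - k) \<bullet> u + k \<bullet> u - y \<bullet> u = - (((y - k) - proj (y - k)) \<bullet> u)"
    by (simp add: inner_diff_left)
  finally have "\<bar>quad y u\<bar> = real CARD('n) * \<bar>((y - k) - proj (y - k)) \<bullet> u\<bar>"
    by (simp add: abs_mult)
  also have "\<dots> \<le> real CARD('n) * (norm (y - k) * norm u)"
    by (intro mult_left_mono order_trans[OF Cauchy_Schwarz_ineq2] mult_right_mono norm_diff_proj_le) auto
  finally show ?thesis by (simp add: k)
qed

lemma min_entry_le: "min_entry x \<le> x $ i $ j"
  unfolding min_entry_def by (rule Min_le) (auto intro: range_eqI[of _ _ "(i, j)"])

lemma abs_entry_le_norm: "\<bar>x $ i $ j\<bar> \<le> norm x" for x :: "real^'n::finite^'m::finite"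
  using component_le_norm_cart[of "x $ i" j] Finite_Cartesian_Product.norm_nth_le[of x i] by linarith

text \<open>Perturbing \<open>\<nu>\<close> in the direction of the distance to the cone stays in the capacity region,
  because that direction lies in the polar cone and so has nonpositive row and column sums.\<close>

lemma maxweight_drift:
  fixes nu :: "real^'n::finite^'n"
  assumes nu: "nu \<in> doubly_stochastic" "0 < min_entry nu" and s: "s \<in> maxweight_schedules q"
  defines "p \<equiv> closest_point additive_cone (real_mat q)"
  shows "(real_mat q - p) \<bullet> (nu - real_mat s) \<le> - min_entry nu * norm (real_mat q - p)"
proof -
  define y where "y = real_mat q - p"
  have p: "p \<in> additive_cone"
    using closest_point_in_set[OF closed_additive_cone] zero_in_additive_cone by (auto simp: p_def)
  have dot: "y \<bullet> (k - p) \<le> 0" if "k \<in> additive_cone" for k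
    unfolding y_def p_def by (rule closest_point_dot[OF convex_additive_cone closed_additive_cone that])
  \<comment> \<open>The origin lies in the cone; this gives
    \<open>\<langle>q, y\<rangle> \<ge> \<parallel>y\<parallel>\<^sup>2\<close>.\<close>
  have yp: "0 \<le> y \<bullet> p"
    using dot[OF zero_in_additive_cone] by simp
  have row: "row_sum y i \<le> 0" for i
  proof -
    \<comment> \<open>The indicator of row i is an additive matrix, and testing polarity at
      \<open>p + e\<close> isolates the row sum of \<open>y\<close>.\<close>
    define e :: "real^'n^'n" where "e = (\<chi> k l. if k = i then 1 else 0)"
    have "p + e \<in> additive_cone"
      by (intro additive_cone_add p) (auto simp: additive_cone_def e_def)
    moreover have "y \<bullet> e = row_sum y i"
    proof -
      have "y \<bullet> e = (\<Sum>k\<in>UNIV. if k = i then row_sum y k else 0)"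
        unfolding inner_matrix by (intro sum.cong) (auto simp: e_def row_sum_def)
      then show ?thesis by simp
    qed
    ultimately show ?thesis using dot[of "p + e"] by simp
  qed
  have col: "col_sum y j \<le> 0" for j
  proof -
    define e :: "real^'n^'n" where "e = (\<chi> k l. if l = j then 1 else 0)"
    have "p + e \<in> additive_cone"
      by (intro additive_cone_add p) (auto simp: additive_cone_def e_def)
    moreover have "y \<bullet> e = col_sum y j"
      by (simp add: inner_matrix e_def col_sum_def if_distrib[of "(*) _"] cong: if_cong)
    ultimately show ?thesis using dot[of "p + e"] by simp
  qed
  have nu': "row_sum nu i = 1" "col_sum nu i = 1" "0 \<le> nu $ i $ j" for i j
    using nu by (auto simp: doubly_stochastic_def row_sum_def col_sum_def)
  have s': "row_sum (real_mat s) i = 1" "col_sum (real_mat s) i = 1" for i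
    using s by (auto simp: maxweight_schedules_def maximal_schedules_def row_sum_def col_sum_def simp flip: of_nat_sum)
  \<comment> \<open>For \<open>y \<noteq> 0\<close> the perturbation has norm exactly
    \<open>min_entry nu\<close>, which keeps all entries of \<open>nu + t *\<^sub>R y\<close>
    nonnegative.\<close>
  define t where "t = (if y = 0 then 0 else min_entry nu / norm y)"
  have t: "0 \<le> t" "t * norm y \<le> min_entry nu" "t * (norm y)\<^sup>2 = min_entry nu * norm y"
    using nu(2) by (auto simp: t_def power2_eq_square)
  have "substochastic (nu + t *\<^sub>R y)"
    unfolding substochastic_def
  proof (intro conjI allI)
    fix i j
    have "- (t * norm y) \<le> t * y $ i $ j"
      using t(1) abs_entry_le_norm[of y i j] mult_left_mono[of "- norm y" "y $ i $ j" t] by simp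
    then show "0 \<le> (nu + t *\<^sub>R y) $ i $ j"
      using t(2) min_entry_le[of nu i j] by simp
    show "row_sum (nu + t *\<^sub>R y) i \<le> 1"
      using row[of i] t(1) by (simp add: nu' mult_nonneg_nonpos)
    show "col_sum (nu + t *\<^sub>R y) j \<le> 1"
      using col[of j] t(1) by (simp add: nu' mult_nonneg_nonpos)
  qed
  then have "real_mat q \<bullet> (nu + t *\<^sub>R y) \<le> real_mat q \<bullet> real_mat s"
    by (rule maxweight_ge_substochastic[OF s])
  moreover have "real_mat q \<bullet> y = y \<bullet> p + (norm y)\<^sup>2"
    by (simp add: y_def inner_diff_left inner_diff_right power2_norm_eq_inner inner_commute)
  moreover have "p \<bullet> (nu - real_mat s) = 0"
    by (rule inner_additive_zero[OF p]) (simp_all add: nu' s')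
  moreover have "0 \<le> t * (y \<bullet> p)"
    using t yp by simp
  moreover have "y \<bullet> (nu - real_mat s) = real_mat q \<bullet> nu - real_mat q \<bullet> real_mat s - p \<bullet> (nu - real_mat s)"
    by (simp add: y_def inner_diff_left inner_diff_right)
  ultimately have "y \<bullet> (nu - real_mat s) \<le> - min_entry nu * norm y"
    using t(3) by (simp add: inner_add_right distrib_left)
  then show ?thesis by (simp add: y_def)
qed

lemma maxweight_drift_zero:
  fixes nu :: "real^'n::finite^'n"
  assumes nu: "nu \<in> doubly_stochastic" and s: "s \<in> maxweight_schedules q"
  shows "real_mat q \<bullet> (nu - real_mat s) \<le> 0"
proof -
  have "substochastic nu"
    using nu by (auto simp: substochastic_def doubly_stochastic_def row_sum_def col_sum_def)
  from maxweight_ge_substochastic[OF s this] show ?thesis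
    by (simp add: inner_diff_right)
qed

lemma norm_le_total:
  fixes x :: "real^'n::finite^'n"
  assumes "\<And>i j. 0 \<le> x $ i $ j"
  shows "norm x \<le> total x"
proof -
  have "norm x \<le> (\<Sum>i\<in>UNIV. norm (x $ i))"
    unfolding norm_vec_def by (rule L2_set_le_sum) simp
  also have "\<dots> \<le> (\<Sum>i\<in>UNIV. \<Sum>j\<in>UNIV. \<bar>x $ i $ j\<bar>)" by (intro sum_mono norm_le_l1_cart)
  finally show ?thesis using assms by (simp add: total_def row_sum_def)
qed

lemma total_le_norm: "\<bar>total x\<bar> \<le> (real CARD('n))\<^sup>2 * norm x" for x :: "real^'n::finite^'n"
proof -
  have "\<bar>total x\<bar> \<le> (\<Sum>i\<in>UNIV. \<Sum>j\<in>UNIV. \<bar>x $ i $ j\<bar>)"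
    unfolding total_def row_sum_def by (intro order_trans[OF sum_abs] sum_mono sum_abs)
  also have "\<dots> \<le> (\<Sum>i::'n\<in>UNIV. \<Sum>j::'n\<in>UNIV. norm x)"
    by (intro sum_mono abs_entry_le_norm)
  finally show ?thesis by (simp add: power2_eq_square)
qed

section \<open>One slot\<close>

definition next_queue :: "nat^'n::finite^'n \<Rightarrow> nat^'n^'n \<Rightarrow> nat^'n^'n \<Rightarrow> nat^'n^'n" where
  "next_queue x s a = (\<chi> i j. x $ i $ j + a $ i $ j - s $ i $ j)"

locale slot =
  fixes x s a :: "nat^'n::finite^'n"
  assumes s: "s \<in> maximal_schedules"
begin

abbreviation "X \<equiv> real_mat x"
abbreviation "S \<equiv> real_mat s"
abbreviation "A \<equiv> real_mat a"
abbreviation "Y \<equiv> real_mat (next_queue x s a)"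

text \<open>The unused service.\<close>

definition u :: "real^'n^'n" where "u = Y - X - A + S"

lemma s01: "s $ i $ j = 0 \<or> s $ i $ j = 1"
  using s by (auto simp: maximal_schedules_def)

lemma S_sums [simp]: "row_sum S i = 1" "col_sum S i = 1" "total S = real CARD('n)"
  using s by (auto simp: total_def maximal_schedules_def row_sum_def col_sum_def simp flip: of_nat_sum)

lemma u01: "u $ i $ j = 0 \<or> u $ i $ j = 1"
  using s01[of i j] by (auto simp: u_def next_queue_def of_nat_diff) 

lemma Y_u: "Y $ i $ j * u $ i $ j = 0"
  using s01[of i j] by (auto simp: u_def next_queue_def of_nat_diff)

lemma u_le: "u $ i $ j \<le> S $ i $ j"
  using s01[of i j] by (auto simp: u_def next_queue_def of_nat_diff)

lemma u_nonneg: "0 \<le> u $ i $ j"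
  using u01[of i j] by auto

lemma inner_Y_u: "Y \<bullet> u = 0"
  unfolding inner_matrix Y_u by simp

lemma norm_u: "(norm u)\<^sup>2 = total u"
proof -
  have "(u $ i $ j)\<^sup>2 = u $ i $ j" for i j
    using u01[of i j] by auto
  then show ?thesis by (simp add: norm_matrix_sq total_def row_sum_def)
qed

lemma norm_u_cases: "norm u = 0 \<or> 1 \<le> norm u"
proof (cases "u = 0")
  case False
  then obtain i j where "u $ i $ j \<noteq> 0" by (metis vec_eq_iff zero_index)
  then have "u $ i $ j = 1" using u01 by metis
  then show ?thesis using abs_entry_le_norm[of u i j] by simp
qed simp

lemma total_u: "total u = total Y - total X - total A + real CARD('n)"
  by (simp add: u_def)

text \<open>Since \<open>u \<le> S\<close> entrywise, its row and column sums lie between 0 and 1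
  and dominate their squares; rows and columns each contribute \<open>total u\<close>.\<close>

lemma quad_u_le: "quad u u \<le> 2 * total u"
proof -
  have 0: "0 \<le> row_sum u i" "0 \<le> col_sum u i" for i
    by (auto simp: row_sum_def col_sum_def u_nonneg intro: sum_nonneg)
  have 1: "row_sum u i \<le> 1" "col_sum u i \<le> 1" for i
    using S_sums by (auto simp: row_sum_def col_sum_def intro!: order_trans[OF sum_mono[OF u_le]])
  have "row_sum u i * row_sum u i \<le> row_sum u i" "col_sum u i * col_sum u i \<le> col_sum u i" for i
    using 0[of i] 1[of i] by (simp_all add: mult_left_le)
  then have "quad u u \<le> (\<Sum>i\<in>UNIV. row_sum u i) + (\<Sum>i\<in>UNIV. col_sum u i) - 0"
    unfolding quad_def by (intro add_mono diff_mono sum_mono) auto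
  then show ?thesis by (simp add: total_col[symmetric]) (simp add: total_def)
qed

text \<open>Splits \<open>d \<cdot> \<parallel>u\<parallel>\<close> without Hoelder's inequality, using that \<open>\<parallel>u\<parallel>\<close> is \<open>0\<close> or at least \<open>1\<close>.\<close>

lemma quad_Y_u:
  assumes "0 < \<tau>" "2 \<le> r"
  shows "\<bar>quad Y u\<bar> \<le> real CARD('n) * (infdist Y additive_cone ^ r / \<tau> ^ (r - 1) + \<tau> * total u)"
proof -
  define d where "d = infdist Y additive_cone"
  have d: "0 \<le> d" by (simp add: d_def infdist_nonneg)
  \<comment> \<open>If \<tau> times the norm of u is at most \<open>d\<close>, the moment term
    dominates: as the norm is 0 or at least 1, one factor of it is absorbed by its power of exponent
    r - 1. Otherwise the second term dominates.\<close>
  have "d * norm u \<le> d ^ r / \<tau> ^ (r - 1) + \<tau> * (norm u)\<^sup>2"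
  proof (cases "norm u * \<tau> \<le> d")
    case True
    show ?thesis
    proof (cases "norm u = 0")
      case False
      then have "1 \<le> norm u" using norm_u_cases by blast
      then have "norm u * \<tau> ^ (r - 1) \<le> (norm u * \<tau>) ^ (r - 1)"
        using assms unfolding power_mult_distrib
        by (intro mult_right_mono self_le_power) auto
      also have "\<dots> \<le> d ^ (r - 1)"
        using True assms by (intro power_mono) auto
      finally have "d * (norm u * \<tau> ^ (r - 1)) \<le> d * d ^ (r - 1)"
        using d by (rule mult_left_mono)
      also have "\<dots> = d ^ r"
        using assms by (cases r) auto
      finally have "d * norm u \<le> d ^ r / \<tau> ^ (r - 1)"
        using assms by (simp add: pos_le_divide_eq mult.assoc)
      then show ?thesis using assms by (simp add: add_increasing2)
    qed (use d assms in auto)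
  next
    case False
    then have "d * norm u \<le> (norm u * \<tau>) * norm u"
      by (intro mult_right_mono) auto
    then show ?thesis
      using d assms by (simp add: power2_eq_square mult_ac add_increasing)
  qed
  then have "real CARD('n) * (d * norm u) \<le> real CARD('n) * (d ^ r / \<tau> ^ (r - 1) + \<tau> * total u)"
    unfolding norm_u by (rule mult_left_mono) simp
  with quad_le_infdist[OF inner_Y_u] show ?thesis
    unfolding d_def by (rule order_trans)
qed

text \<open>Expanding the square of \<open>Y - u\<close> pairs \<open>u\<close> with the next queue,
  to which it is orthogonal, instead of with the current one.\<close>

lemma quad_Y: "quad Y Y = quad X X + (2 * quad X (A - S) + quad (A - S) (A - S)) + 2 * quad Y u - quad u u"
proof -
  have "quad (Y - u) (Y - u) = quad (X + (A - S)) (X + (A - S))"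
    by (simp add: u_def algebra_simps)
  then show ?thesis
    by (simp add: quad_add_left quad_add_right quad_diff_left quad_diff_right quad_commute)
qed

text \<open>Cutting negative entries off at 0 moves them towards every nonnegative target.\<close>

lemma dist_Y_le:
  assumes "\<And>i j. 0 \<le> p $ i $ j"
  shows "(norm (Y - p))\<^sup>2 \<le> (norm (X - p + (A - S)))\<^sup>2"
  unfolding norm_matrix_sq
proof (intro sum_mono)
  fix i j
  have "\<bar>(Y - p) $ i $ j\<bar> \<le> \<bar>(X - p + (A - S)) $ i $ j\<bar>"
    using s01[of i j] assms[of i j] by (auto simp: next_queue_def of_nat_diff)
  then show "((Y - p) $ i $ j)\<^sup>2 \<le> ((X - p + (A - S)) $ i $ j)\<^sup>2"
    by (simp only: abs_le_square_iff)
qed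

lemma increment:
  assumes "\<And>i j. real (a $ i $ j) \<le> c" "1 \<le> c"
  shows "norm (Y - X) \<le> real CARD('n) * c"
proof (rule power2_le_imp_le)
  have "\<bar>(Y - X) $ i $ j\<bar> \<le> c" for i j
    using s01[of i j] assms(1)[of i j] assms(2) by (auto simp: next_queue_def of_nat_diff)
  then have "((Y - X) $ i $ j)\<^sup>2 \<le> c\<^sup>2" for i j
    using power2_le_iff_abs_le[of c] assms(2) by auto
  then have "(norm (Y - X))\<^sup>2 \<le> (\<Sum>i::'n\<in>UNIV. \<Sum>j::'n\<in>UNIV. c\<^sup>2)"
    unfolding norm_matrix_sq by (intro sum_mono)
  also have "\<dots> = (real CARD('n) * c)\<^sup>2"
    by (simp add: power_mult_distrib power2_eq_square[of "real CARD('n)"])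
  finally show "(norm (Y - X))\<^sup>2 \<le> (real CARD('n) * c)\<^sup>2" .
  show "0 \<le> real CARD('n) * c"
    using assms(2) by simp
qed

end

section \<open>The queue length chain\<close>

lemma finite_bounded_matrices: "finite {x :: nat^'n::finite^'n. \<forall>i j. x $ i $ j \<le> m}"
proof -
  have "{x :: nat^'n^'n. \<forall>i j. x $ i $ j \<le> m} \<subseteq>
      (\<lambda>f :: 'n \<Rightarrow> 'n \<Rightarrow> nat. \<chi> i j. f i j) ` (UNIV \<rightarrow>\<^sub>E (UNIV \<rightarrow>\<^sub>E {..m}))"
  proof
    fix x :: "nat^'n^'n" assume "x \<in> {x. \<forall>i j. x $ i $ j \<le> m}"
    then show "x \<in> (\<lambda>f :: 'n \<Rightarrow> 'n \<Rightarrow> nat. \<chi> i j. f i j) ` (UNIV \<rightarrow>\<^sub>E (UNIV \<rightarrow>\<^sub>E {..m}))"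
      by (intro image_eqI[of _ _ "\<lambda>i j. x $ i $ j"]) auto
  qed
  then show ?thesis
    by (rule finite_subset) (intro finite_imageI finite_PiE; simp)
qed

text \<open>Here \<open>P\<close> is the law of the arrival matrix of one slot.\<close>

locale switch_chain =
  fixes P :: "(nat^'n::finite^'n) pmf" and nu lam sd :: "real^'n^'n" and \<epsilon> a_max :: real
  assumes nu: "nu \<in> doubly_stochastic" "0 < min_entry nu"
    and eps: "0 < \<epsilon>" "\<epsilon> < 1"
    and lam: "lam = (1 - \<epsilon>) *\<^sub>R nu"
    and a_max: "1 \<le> a_max"
    and bounded: "\<And>a i j. a \<in> set_pmf P \<Longrightarrow> real (a $ i $ j) \<le> a_max"
    and mean: "\<And>i j. (\<integral>a. real (a $ i $ j) \<partial>measure_pmf P) = lam $ i $ j"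
    and cov: "\<And>i j k l. (\<integral>a. (real (a $ i $ j) - lam $ i $ j) * (real (a $ k $ l) - lam $ k $ l) \<partial>measure_pmf P)
        = (if i = k \<and> j = l then (sd $ i $ j)\<^sup>2 else 0)"
    and zero: "0 \<in> set_pmf P"
begin

section \<open>Arrival moments of one slot\<close>

lemma card_ge_1: "1 \<le> real CARD('n)"
  by (simp add: Suc_le_eq)

lemma finite_P: "finite (set_pmf P)"
proof (rule finite_subset[OF _ finite_bounded_matrices])
  show "set_pmf P \<subseteq> {x. \<forall>i j. x $ i $ j \<le> nat \<lfloor>a_max\<rfloor>}"
    using bounded by (auto intro!: le_nat_floor)
qed

lemma int_P [simp]: "integrable (measure_pmf P) (f :: _ \<Rightarrow> real)"
  by (rule integrable_measure_pmf_finite[OF finite_P])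

lemma E_inner: "(\<integral>a. m \<bullet> (real_mat a - lam) \<partial>measure_pmf P) = 0"
proof -
  have "(\<integral>a. m \<bullet> (real_mat a - lam) \<partial>measure_pmf P) =
      (\<Sum>i\<in>UNIV. \<Sum>j\<in>UNIV. m $ i $ j * ((\<integral>a. real (a $ i $ j) \<partial>measure_pmf P) - lam $ i $ j))"
    unfolding inner_matrix by simp
  then show ?thesis by (simp add: mean)
qed

lemma E_quad_inner: "(\<integral>a. quad z (real_mat a - lam) \<partial>measure_pmf P) = 0"
  by (simp add: quad_eq_inner_proj E_inner)

lemma nu_sums [simp]: "row_sum nu i = 1" "col_sum nu i = 1" "0 \<le> nu $ i $ j"
  using nu by (auto simp: doubly_stochastic_def row_sum_def col_sum_def)

lemma lam_sums [simp]: "row_sum lam i = 1 - \<epsilon>" "col_sum lam i = 1 - \<epsilon>" "total lam = (1 - \<epsilon>) * real CARD('n)"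
  by (simp_all add: lam total_def)

lemma E_total: "(\<integral>a. total (real_mat a) \<partial>measure_pmf P) = (1 - \<epsilon>) * real CARD('n)"
proof -
  have "(\<integral>a. total (real_mat a) \<partial>measure_pmf P) = (\<Sum>i\<in>UNIV. \<Sum>j\<in>UNIV. (\<integral>a. real (a $ i $ j) \<partial>measure_pmf P))"
    by (simp add: total_def row_sum_def)
  also have "\<dots> = total lam"
    unfolding mean total_def row_sum_def ..
  finally show ?thesis by simp
qed

text \<open>Stated for an arbitrary index set so that a row, a column and the whole matrix are
  instances; off-diagonal covariances vanish.\<close>

lemma E_square_sum:
  fixes I :: "('n \<times> 'n) set"
  shows "(\<integral>a. (\<Sum>(i, j)\<in>I. (real_mat a - lam) $ i $ j)\<^sup>2 \<partial>measure_pmf P) = (\<Sum>(i, j)\<in>I. (sd $ i $ j)\<^sup>2)"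
proof -
  have "(\<integral>a. (\<Sum>(i, j)\<in>I. (real_mat a - lam) $ i $ j)\<^sup>2 \<partial>measure_pmf P) =
      (\<Sum>p\<in>I. \<Sum>q\<in>I. \<integral>a. (real_mat a - lam) $ fst p $ snd p * (real_mat a - lam) $ fst q $ snd q \<partial>measure_pmf P)"
    by (simp add: power2_eq_square sum_product case_prod_beta)
  also have "\<dots> = (\<Sum>p\<in>I. \<Sum>q\<in>I. if p = q then (sd $ fst p $ snd p)\<^sup>2 else 0)"
    by (intro sum.cong refl) (simp add: cov prod_eq_iff)
  also have "\<dots> = (\<Sum>p\<in>I. (sd $ fst p $ snd p)\<^sup>2)"
    by (intro sum.cong refl) simp
  finally show ?thesis by (simp add: case_prod_beta)
qed

text \<open>Each variance occurs once among the rows, once among the columns and with weight -1/n in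
  the total.\<close>

lemma E_quad_dev: "(\<integral>a. quad (real_mat a - lam) (real_mat a - lam) \<partial>measure_pmf P) = (2 - 1 / real CARD('n)) * (norm sd)\<^sup>2"
proof -
  have row: "(\<integral>a. (row_sum (real_mat a - lam) i)\<^sup>2 \<partial>measure_pmf P) = (\<Sum>j\<in>UNIV. (sd $ i $ j)\<^sup>2)" for i
    using E_square_sum[of "{i} \<times> UNIV"] unfolding row_sum_def by (simp flip: sum.cartesian_product)
  have col: "(\<integral>a. (col_sum (real_mat a - lam) j)\<^sup>2 \<partial>measure_pmf P) = (\<Sum>i\<in>UNIV. (sd $ i $ j)\<^sup>2)" for j
    using E_square_sum[of "UNIV \<times> {j}"] unfolding col_sum_def by (simp flip: sum.cartesian_product)
  have tot: "(\<integral>a. (total (real_mat a - lam))\<^sup>2 \<partial>measure_pmf P) = (norm sd)\<^sup>2"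
    using E_square_sum[of "UNIV \<times> UNIV"] unfolding total_def row_sum_def norm_matrix_sq
    by (simp only: flip: sum.cartesian_product)
  have "(\<integral>a. quad (real_mat a - lam) (real_mat a - lam) \<partial>measure_pmf P) =
      (\<Sum>i\<in>UNIV. \<integral>a. (row_sum (real_mat a - lam) i)\<^sup>2 \<partial>measure_pmf P)
      + (\<Sum>j\<in>UNIV. \<integral>a. (col_sum (real_mat a - lam) j)\<^sup>2 \<partial>measure_pmf P)
      - (\<integral>a. (total (real_mat a - lam))\<^sup>2 \<partial>measure_pmf P) / real CARD('n)"
    unfolding quad_def power2_eq_square[symmetric] by simp
  also have "\<dots> = (norm sd)\<^sup>2 + (norm sd)\<^sup>2 - (norm sd)\<^sup>2 / real CARD('n)"
    unfolding row col tot by (simp add: norm_matrix_sq) (rule sum.swap)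
  finally show ?thesis by (simp add: algebra_simps)
qed

lemma E_norm_dev: "(\<integral>a. (norm (real_mat a - lam))\<^sup>2 \<partial>measure_pmf P) = (norm sd)\<^sup>2"
proof -
  have "(\<integral>a. (norm (real_mat a - lam))\<^sup>2 \<partial>measure_pmf P) =
      (\<Sum>i\<in>UNIV. \<Sum>j\<in>UNIV. \<integral>a. ((real_mat a - lam) $ i $ j)\<^sup>2 \<partial>measure_pmf P)"
    unfolding norm_matrix_sq by simp
  also have "\<dots> = (norm sd)\<^sup>2"
    using cov unfolding norm_matrix_sq by (simp add: power2_eq_square)
  finally show ?thesis .
qed

lemma schedule_sums:
  fixes s :: "nat^'n^'n"
  assumes "s \<in> maximal_schedules"
  shows "row_sum (real_mat s) i = 1" "col_sum (real_mat s) i = 1" "total (real_mat s) = real CARD('n)"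
    "(norm (real_mat s))\<^sup>2 = real CARD('n)"
proof -
  interpret slot x s a for x a by unfold_locales (rule assms)
  show 1: "row_sum (real_mat s) i = 1" "col_sum (real_mat s) i = 1" "total (real_mat s) = real CARD('n)" by auto
  have sq: "(real_mat s $ i $ j)\<^sup>2 = real_mat s $ i $ j" for i j
    using s01[of i j] by auto
  show "(norm (real_mat s))\<^sup>2 = real CARD('n)"
    using 1(3) unfolding norm_matrix_sq sq total_def row_sum_def .
qed

text \<open>All row and column sums of \<open>lam - real_mat s\<close> are -\<epsilon> for any
  maximal \<open>s\<close>, so the first-order term sees \<open>X\<close> only through its
  total.\<close>

lemma E_quad_step:
  assumes s: "s \<in> maximal_schedules"
  shows "(\<integral>a. 2 * quad X (real_mat a - real_mat s) + quad (real_mat a - real_mat s) (real_mat a - real_mat s) \<partial>measure_pmf P)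
    = - 2 * \<epsilon> * total X + (2 - 1 / real CARD('n)) * (norm sd)\<^sup>2 + real CARD('n) * \<epsilon>\<^sup>2"
proof -
  let ?m = "lam - real_mat s"
  have split: "2 * quad X (real_mat a - real_mat s) + quad (real_mat a - real_mat s) (real_mat a - real_mat s) =
      quad (real_mat a - lam) (real_mat a - lam) + 2 * quad (X + ?m) (real_mat a - lam) + (2 * quad X ?m + quad ?m ?m)" for a
  proof -
    define w where "w = real_mat a - lam"
    have eq: "real_mat a - real_mat s = w + ?m" by (simp add: w_def)
    show ?thesis
      unfolding eq w_def[symmetric]
      by (simp add: quad_add_left quad_add_right quad_commute[of w "?m"])
  qed
  have "quad X ?m = (\<Sum>i\<in>UNIV. row_sum X i * (- \<epsilon>)) + (\<Sum>j\<in>UNIV. col_sum X j * (- \<epsilon>)) - total X * (- \<epsilon> * real CARD('n)) / real CARD('n)"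
    using schedule_sums[OF s] by (simp add: quad_def algebra_simps)
  also have "\<dots> = - \<epsilon> * total X"
    by (simp only: flip: sum_distrib_right) (simp add: total_col[symmetric], simp add: total_def)
  finally have X: "quad X ?m = - \<epsilon> * total X" .
  have "quad ?m ?m = real CARD('n) * \<epsilon>\<^sup>2"
    using schedule_sums[OF s] by (simp add: quad_def algebra_simps power2_eq_square)
  then show ?thesis
    unfolding split by (simp add: E_quad_inner E_quad_dev X)
qed

text \<open>An upper bound for the mean squared norm of arrivals minus schedule; it is also the
  bracket in the first entry of \<open>M_const\<close>.\<close>

definition L :: real where "L = (norm lam)\<^sup>2 + (norm sd)\<^sup>2 + real CARD('n)"

lemma L_pos: "0 < L"
  by (simp add: L_def add_nonneg_pos)

lemma E_norm_step:
  assumes s: "s \<in> maximal_schedules"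
  shows "(\<integral>a. (norm (z + (real_mat a - real_mat s)))\<^sup>2 \<partial>measure_pmf P) \<le> (norm z)\<^sup>2 + 2 * (z \<bullet> (lam - real_mat s)) + L"
proof -
  let ?m = "lam - real_mat s"
  have split: "(norm (z + (real_mat a - real_mat s)))\<^sup>2 =
      (norm (real_mat a - lam))\<^sup>2 + 2 * ((z + ?m) \<bullet> (real_mat a - lam)) + (norm (z + ?m))\<^sup>2" for a
    by (simp add: power2_norm_eq_inner inner_add_left inner_add_right inner_diff_left inner_diff_right inner_commute algebra_simps)
  have "(norm ?m)\<^sup>2 = (norm lam)\<^sup>2 - 2 * (lam \<bullet> real_mat s) + real CARD('n)"
    using schedule_sums(4)[OF s]
    by (simp add: power2_norm_eq_inner inner_diff_left inner_diff_right inner_commute)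
  moreover have "0 \<le> lam \<bullet> real_mat s"
    using eps by (simp add: inner_matrix lam sum_nonneg)
  ultimately have "(norm ?m)\<^sup>2 \<le> (norm lam)\<^sup>2 + real CARD('n)" by simp
  then show ?thesis
    unfolding split
    by (simp add: E_inner E_norm_dev L_def) (simp add: power2_norm_eq_inner inner_add_left inner_add_right inner_commute)
qed

section \<open>The MaxWeight kernel\<close>

definition K :: "nat^'n^'n \<Rightarrow> (nat^'n^'n) pmf" where
  "K x = bind_pmf (pmf_of_set (maxweight_schedules x)) (\<lambda>s. map_pmf (next_queue x s) P)"

lemma set_pmf_schedule [simp]: "set_pmf (pmf_of_set (maxweight_schedules x)) = maxweight_schedules x"
  by (simp add: finite_maxweight_schedules maxweight_schedules_nonempty)

lemma set_K: "set_pmf (K x) = (\<Union>s\<in>maxweight_schedules x. next_queue x s ` set_pmf P)"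
  by (simp add: K_def)

lemma finite_K: "finite (set_pmf (K x))"
  by (simp add: set_K finite_maxweight_schedules finite_P)

lemma int_K [simp]: "integrable (measure_pmf (K x)) (f :: _ \<Rightarrow> real)"
  by (rule integrable_measure_pmf_finite[OF finite_K])

lemma maxweight_maximal: "s \<in> maxweight_schedules x \<Longrightarrow> s \<in> maximal_schedules"
  by (simp add: maxweight_schedules_def)

text \<open>Drift bounds are proved for each optimal schedule separately; averaging over ties
  preserves them.\<close>

lemma K_le:
  fixes f :: "nat^'n^'n \<Rightarrow> real"
  assumes "\<And>s. s \<in> maxweight_schedules x \<Longrightarrow> (\<integral>a. f (next_queue x s a) \<partial>measure_pmf P) \<le> B"
  shows "(\<integral>y. f y \<partial>measure_pmf (K x)) \<le> B"
proof -
  let ?U = "pmf_of_set (maxweight_schedules x)"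
  have int: "integrable (measure_pmf ?U) g" for g :: "_ \<Rightarrow> real"
    by (rule integrable_measure_pmf_finite) (simp add: finite_maxweight_schedules)
  have "(\<integral>y. f y \<partial>measure_pmf (K x)) = (\<integral>s. (\<integral>a. f (next_queue x s a) \<partial>measure_pmf P) \<partial>measure_pmf ?U)"
    unfolding K_def by (subst integral_bind_pmf') (simp_all flip: K_def)
  also have "\<dots> \<le> (\<integral>s. B \<partial>measure_pmf ?U)"
    using assms by (intro integral_mono_AE int) (auto simp: AE_measure_pmf_iff)
  finally show ?thesis by simp
qed

lemma K_increment:
  assumes "y \<in> set_pmf (K x)"
  shows "norm (real_mat y - real_mat x) \<le> real CARD('n) * a_max"
proof -
  obtain s a where sa: "s \<in> maxweight_schedules x" "a \<in> set_pmf P" "y = next_queue x s a"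
    using assms by (auto simp: set_K)
  interpret slot x s a by unfold_locales (rule maxweight_maximal[OF sa(1)])
  show ?thesis
    using increment[of a_max] bounded[OF sa(2)] a_max by (simp add: sa(3))
qed

subsection \<open>Drift of the distance to the origin and to the cone\<close>

text \<open>The inequality 2ab \<le> a^2 + b^2 converts drift of the square into drift of
  \<open>Z\<close>. At the threshold \<open>L / \<delta>\<close> the constant \<open>L\<close> costs
  half of the rate.\<close>

lemma drift_from_square:
  assumes \<delta>: "0 < \<delta>" and Z: "\<And>y. 0 \<le> Z y" "L / \<delta> \<le> Z x"
    and sq: "(\<integral>y. (Z y)\<^sup>2 \<partial>measure_pmf (K x)) \<le> (Z x)\<^sup>2 - 2 * \<delta> * Z x + L"
  shows "(\<integral>y. Z y \<partial>measure_pmf (K x)) \<le> Z x - \<delta> / 2"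
proof -
  have Zx: "0 < Z x"
    using L_pos \<delta> Z(2) by (meson divide_pos_pos less_le_trans)
  have "2 * Z x * (\<integral>y. Z y \<partial>measure_pmf (K x)) = (\<integral>y. 2 * Z x * Z y \<partial>measure_pmf (K x))"
    by simp
  also have "\<dots> \<le> (\<integral>y. (Z y)\<^sup>2 + (Z x)\<^sup>2 \<partial>measure_pmf (K x))"
  proof (intro integral_mono int_K)
    fix y
    show "2 * Z x * Z y \<le> (Z y)\<^sup>2 + (Z x)\<^sup>2"
      using sum_squares_bound[of "Z x" "Z y"] by simp
  qed
  also have "\<dots> \<le> 2 * (Z x)\<^sup>2 - 2 * \<delta> * Z x + L"
    using sq by simp
  also have "\<dots> \<le> 2 * (Z x)\<^sup>2 - \<delta> * Z x"
    using Z(2) \<delta> by (simp add: field_simps)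
  also have "\<dots> = 2 * Z x * (Z x - \<delta> / 2)"
    by (simp add: power2_eq_square algebra_simps)
  finally show ?thesis using Zx by simp
qed

lemma E_dist_step:
  assumes s: "s \<in> maxweight_schedules x" and p: "\<And>i j. 0 \<le> p $ i $ j"
  shows "(\<integral>a. (norm (real_mat (next_queue x s a) - p))\<^sup>2 \<partial>measure_pmf P) \<le>
    (norm (real_mat x - p))\<^sup>2 + 2 * ((real_mat x - p) \<bullet> (lam - real_mat s)) + L"
proof -
  have "(\<integral>a. (norm (real_mat (next_queue x s a) - p))\<^sup>2 \<partial>measure_pmf P) \<le>
      (\<integral>a. (norm (real_mat x - p + (real_mat a - real_mat s)))\<^sup>2 \<partial>measure_pmf P)"
    using slot.dist_Y_le[OF slot.intro[OF maxweight_maximal[OF s]] p] by (intro integral_mono int_P) auto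
  also have "\<dots> \<le> (norm (real_mat x - p))\<^sup>2 + 2 * ((real_mat x - p) \<bullet> (lam - real_mat s)) + L"
    by (rule E_norm_step[OF maxweight_maximal[OF s]])
  finally show ?thesis .
qed

text \<open>The MaxWeight value is at least \<open>\<langle>q, \<nu>\<rangle>\<close>, and the
  missing load contributes \<epsilon> times that inner product, itself at least
  \<open>min_entry nu * norm q\<close>. The rate degenerates with \<epsilon>, so this serves
  ergodicity at fixed \<epsilon>.\<close>

lemma norm_square_drift:
  "(\<integral>y. (norm (real_mat y))\<^sup>2 \<partial>measure_pmf (K x)) \<le>
    (norm (real_mat x))\<^sup>2 - 2 * (\<epsilon> * min_entry nu) * norm (real_mat x) + L"
proof (rule K_le)
  fix s assume s: "s \<in> maxweight_schedules x"
  have "min_entry nu * norm (real_mat x) \<le> min_entry nu * total (real_mat x)"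
    using nu(2) by (intro mult_left_mono norm_le_total) auto
  also have "\<dots> \<le> real_mat x \<bullet> nu"
    unfolding total_def row_sum_def sum_distrib_left inner_matrix
  proof (intro sum_mono)
    fix i j
    show "min_entry nu * real_mat x $ i $ j \<le> real_mat x $ i $ j * nu $ i $ j"
      using min_entry_le[of nu i j] by (subst mult.commute) (intro mult_left_mono; simp)
  qed
  finally have "\<epsilon> * (min_entry nu * norm (real_mat x)) \<le> \<epsilon> * (real_mat x \<bullet> nu)"
    using eps by (intro mult_left_mono) auto
  then have "real_mat x \<bullet> (lam - real_mat s) \<le> - \<epsilon> * min_entry nu * norm (real_mat x)"
    using maxweight_drift_zero[OF nu(1) s] by (simp add: lam algebra_simps inner_diff_right)
  then show "(\<integral>a. (norm (real_mat (next_queue x s a)))\<^sup>2 \<partial>measure_pmf P) \<le>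
      (norm (real_mat x))\<^sup>2 - 2 * (\<epsilon> * min_entry nu) * norm (real_mat x) + L"
    using E_dist_step[OF s, of 0] by simp
qed

definition d :: "nat^'n^'n \<Rightarrow> real" where "d x = infdist (real_mat x) additive_cone"

lemma d_nonneg: "0 \<le> d x"
  by (simp add: d_def infdist_nonneg)

lemma d_le_norm: "d x \<le> norm (real_mat x)"
  using infdist_le[OF zero_in_additive_cone, of "real_mat x"] by (simp add: d_def)

text \<open>The old nearest point \<open>p\<close> is kept as a competitor for the new distance.
  Replacing \<nu> by \<lambda> costs at most half of the rate, by \<open>eps_le\<close>.\<close>

lemma d_square_drift:
  assumes eps_le: "\<epsilon> \<le> min_entry nu / (2 * norm nu)"
  shows "(\<integral>y. (d y)\<^sup>2 \<partial>measure_pmf (K x)) \<le> (d x)\<^sup>2 - 2 * (min_entry nu / 2) * d x + L"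
proof (rule K_le)
  fix s assume s: "s \<in> maxweight_schedules x"
  define p where "p = closest_point additive_cone (real_mat x)"
  have p: "p \<in> additive_cone"
    using closest_point_in_set[OF closed_additive_cone] zero_in_additive_cone by (auto simp: p_def)
  have dx: "d x = norm (real_mat x - p)"
    using setdist_closest_point[OF closed_additive_cone, of "real_mat x"] zero_in_additive_cone
    by (auto simp: d_def p_def infdist_eq_setdist dist_norm)
  have "0 < norm nu"
    using nu(2) min_entry_le[of nu] by (metis less_le_trans zero_less_norm_iff order_less_irrefl zero_index)
  then have eps_nu: "\<epsilon> * norm nu \<le> min_entry nu / 2"
    using eps_le by (simp add: field_simps)
  have "- ((real_mat x - p) \<bullet> nu) \<le> norm (real_mat x - p) * norm nu"
    using Cauchy_Schwarz_ineq2[of "real_mat x - p" nu] by linarith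
  then have "\<epsilon> * - ((real_mat x - p) \<bullet> nu) \<le> \<epsilon> * (norm (real_mat x - p) * norm nu)"
    using eps by (intro mult_left_mono) auto
  also have "\<dots> = \<epsilon> * norm nu * norm (real_mat x - p)" by simp
  also have "\<dots> \<le> min_entry nu / 2 * norm (real_mat x - p)"
    using eps_nu by (rule mult_right_mono) simp
  finally have "(real_mat x - p) \<bullet> (lam - real_mat s) \<le> - (min_entry nu / 2) * d x"
    using maxweight_drift[OF nu s] unfolding dx p_def
    by (simp add: lam algebra_simps inner_diff_right)
  moreover have "(\<integral>a. (d (next_queue x s a))\<^sup>2 \<partial>measure_pmf P) \<le>
      (\<integral>a. (norm (real_mat (next_queue x s a) - p))\<^sup>2 \<partial>measure_pmf P)"
    using infdist_le[OF p] by (intro integral_mono int_P power_mono) (auto simp: d_def infdist_nonneg dist_norm)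
  ultimately show "(\<integral>a. (d (next_queue x s a))\<^sup>2 \<partial>measure_pmf P) \<le> (d x)\<^sup>2 - 2 * (min_entry nu / 2) * d x + L"
    using E_dist_step[OF s, of p] additive_cone_nonneg[OF p] by (simp add: dx)
qed

lemma d_increment: "y \<in> set_pmf (K x) \<Longrightarrow> \<bar>d y - d x\<bar> \<le> real CARD('n) * a_max"
  using K_increment[of y x] infdist_triangle[of "real_mat y" additive_cone "real_mat x"]
    infdist_triangle[of "real_mat x" additive_cone "real_mat y"]
  by (simp add: d_def dist_norm norm_minus_commute)

subsection \<open>Ergodicity\<close>

text \<open>Serving one nonempty pair alone already has positive weight, so an optimal schedule
  serves some nonempty queue.\<close>

lemma next_queue_total_less:
  fixes x :: "nat^'n^'n"
  assumes s: "s \<in> maxweight_schedules x" and x: "x \<noteq> 0"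
  shows "(\<Sum>i\<in>UNIV. \<Sum>j\<in>UNIV. next_queue x s 0 $ i $ j) < (\<Sum>i\<in>UNIV. \<Sum>j\<in>UNIV. x $ i $ j)"
proof -
  obtain i j where ij: "0 < x $ i $ j"
    using x by (metis bot_nat_0.not_eq_extremum vec_eq_iff zero_index)
  define e :: "nat^'n^'n" where "e = (\<chi> k l. if k = i \<and> l = j then 1 else 0)"
  have "e \<in> schedules"
    by (auto simp: schedules_def e_def if_distrib sum.If_cases Collect_conv_if)
  moreover have "weight x e = x $ i $ j"
  proof -
    have "weight x e = (\<Sum>k\<in>UNIV. if k = i then (\<Sum>l\<in>UNIV. if l = j then x $ k $ l else 0) else 0)"
      unfolding weight_def by (intro sum.cong) (auto simp: e_def if_distrib[of "(*) _"] cong: if_cong)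
    then show ?thesis by simp
  qed
  ultimately have "0 < weight x s"
    using s ij by (auto simp: maxweight_schedules_def intro: less_le_trans)
  then obtain k l where kl: "0 < x $ k $ l * s $ k $ l"
    unfolding weight_def by (metis (no_types, lifting) neq0_conv sum.neutral)
  have le: "next_queue x s 0 $ i $ j \<le> x $ i $ j" for i j
    by (simp add: next_queue_def)
  have "(\<Sum>j\<in>UNIV. next_queue x s 0 $ k $ j) < (\<Sum>j\<in>UNIV. x $ k $ j)"
    using kl by (intro sum_strict_mono_ex1) (auto simp: next_queue_def intro!: exI[of _ l])
  then show ?thesis
    using le by (intro sum_strict_mono_ex1) (auto intro!: bexI[of _ k] sum_mono)
qed

lemma next_queue_in_K: "s \<in> maxweight_schedules x \<Longrightarrow> next_queue x s 0 \<in> set_pmf (K x)"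
  using zero by (auto simp: set_K)

lemma reach_zero: "\<exists>t. 0 \<in> set_pmf (kernel_pow K t x)"
proof (induction "\<Sum>i\<in>UNIV. \<Sum>j\<in>UNIV. x $ i $ j" arbitrary: x rule: less_induct)
  case less
  show ?case
  proof (cases "x = 0")
    case True
    then have "0 \<in> set_pmf (kernel_pow K 0 x)" by simp
    then show ?thesis by blast
  next
    case False
    obtain s where s: "s \<in> maxweight_schedules x"
      using maxweight_schedules_nonempty by blast
    obtain t where "0 \<in> set_pmf (kernel_pow K t (next_queue x s 0))"
      using less next_queue_total_less[OF s False] by blast
    then have "0 \<in> set_pmf (kernel_pow K (1 + t) x)"
      unfolding kernel_pow_add using next_queue_in_K[OF s] by (auto simp: bind_return_pmf)
    then show ?thesis by blast
  qed
qed

lemma loop_zero: "0 \<in> set_pmf (K 0)"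
proof -
  obtain s :: "nat^'n^'n" where s: "s \<in> maxweight_schedules 0"
    using maxweight_schedules_nonempty by blast
  moreover have "next_queue 0 s 0 = 0"
    by (simp add: next_queue_def vec_eq_iff)
  ultimately show ?thesis using next_queue_in_K[OF s] by simp
qed

lemma finite_norm_sublevel: "finite {x :: nat^'n^'n. norm (real_mat x) \<le> R}"
proof (rule finite_subset[OF _ finite_bounded_matrices])
  show "{x :: nat^'n^'n. norm (real_mat x) \<le> R} \<subseteq> {x. \<forall>i j. x $ i $ j \<le> nat \<lfloor>R\<rfloor>}"
  proof clarify
    fix x :: "nat^'n^'n" and i j assume "norm (real_mat x) \<le> R"
    then have "real (x $ i $ j) \<le> R"
      using abs_entry_le_norm[of "real_mat x" i j] by simp
    then show "x $ i $ j \<le> nat \<lfloor>R\<rfloor>"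
      by (rule le_nat_floor)
  qed
qed

lemma lyapunov: "\<exists>\<theta>>0. \<exists>\<gamma> C. lyapunov_chain K (\<lambda>x. exp (\<theta> * norm (real_mat x))) \<gamma> C 0"
proof -
  have "0 < \<epsilon> * min_entry nu" using eps nu by simp
  then have drift: "(\<integral>y. norm (real_mat y) \<partial>measure_pmf (K x)) \<le> norm (real_mat x) - \<epsilon> * min_entry nu / 2"
    if "L / (\<epsilon> * min_entry nu) \<le> norm (real_mat x)" for x
    using that norm_square_drift by (intro drift_from_square) auto
  have incr: "\<bar>norm (real_mat y) - norm (real_mat x)\<bar> \<le> real CARD('n) * a_max" if "y \<in> set_pmf (K x)" for x y
    using K_increment[OF that] norm_triangle_ineq3 order_trans by blast
  have "0 < real CARD('n) * a_max" using card_ge_1 a_max by simp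
  then obtain \<theta> \<gamma> C where \<theta>: "0 < \<theta>" "0 \<le> \<gamma>" "\<gamma> < 1" "0 \<le> C"
    and exp: "\<And>x. (\<integral>y. exp (\<theta> * norm (real_mat y)) \<partial>measure_pmf (K x)) \<le> \<gamma> * exp (\<theta> * norm (real_mat x)) + C"
    using exp_drift[where K = K and Z = "\<lambda>x. norm (real_mat x)" and \<eta> = "\<epsilon> * min_entry nu / 2"
        and D = "real CARD('n) * a_max" and \<kappa> = "L / (\<epsilon> * min_entry nu)", OF finite_K _ _ incr drift]
      \<open>0 < \<epsilon> * min_entry nu\<close> by fastforce
  have fin: "finite {x :: nat^'n^'n. exp (\<theta> * norm (real_mat x)) \<le> R}" for R
  proof (rule finite_subset[OF _ finite_norm_sublevel])
    show "{x :: nat^'n^'n. exp (\<theta> * norm (real_mat x)) \<le> R} \<subseteq> {x. norm (real_mat x) \<le> ln R / \<theta>}"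
    proof clarify
      fix x :: "nat^'n^'n" assume le: "exp (\<theta> * norm (real_mat x)) \<le> R"
      then have "\<theta> * norm (real_mat x) \<le> ln R"
        by (meson exp_gt_zero ln_ge_iff order_less_le_trans)
      then show "norm (real_mat x) \<le> ln R / \<theta>"
        using \<theta> by (simp add: field_simps)
    qed
  qed
  have "lyapunov_chain K (\<lambda>x. exp (\<theta> * norm (real_mat x))) \<gamma> C 0"
    by (rule lyapunov_chain.intro) (rule finite_K exp_ge_zero fin \<theta> exp reach_zero loop_zero)+
  then show ?thesis using \<theta> by blast
qed


subsection \<open>Moment bounds in steady state\<close>

lemma M_const_pos: "0 < M_const r a_max nu lam sd"
proof -
  have "0 < 8 * L / min_entry nu" using L_pos nu(2) by simp
  then show ?thesis
    by (simp add: M_const_def L_def less_max_iff_disj Let_def)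
qed

lemma norm_lam_le: "norm lam \<le> norm nu"
  using eps by (simp add: lam mult_left_le_one_le)

text \<open>Arrivals lie between 0 and \<open>a_max\<close> and their means are at most 1, hence at
  most \<open>a_max\<close>; so deviations never exceed \<open>a_max\<close>.\<close>

lemma norm_sd_le: "norm sd \<le> norm ((\<chi> i j. a_max) :: real^'n^'n)"
proof (rule power2_le_imp_le)
  have "(sd $ i $ j)\<^sup>2 \<le> a_max\<^sup>2" for i j
  proof -
    have "(sd $ i $ j)\<^sup>2 = (\<integral>a. (real (a $ i $ j) - lam $ i $ j)\<^sup>2 \<partial>measure_pmf P)"
      using cov[of i j i j] by (simp add: power2_eq_square)
    also have "\<dots> \<le> (\<integral>a. a_max\<^sup>2 \<partial>measure_pmf P)"
    proof (intro integral_mono_AE int_P AE_pmfI)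
      fix a assume a: "a \<in> set_pmf P"
      have "nu $ i $ j \<le> row_sum nu i"
        unfolding row_sum_def by (rule member_le_sum) auto
      then have "0 \<le> lam $ i $ j" "lam $ i $ j \<le> 1"
        using eps by (auto simp: lam mult_le_one)
      then have "\<bar>real (a $ i $ j) - lam $ i $ j\<bar> \<le> a_max"
        using bounded[OF a, of i j] a_max by (simp add: abs_le_iff)
      then show "(real (a $ i $ j) - lam $ i $ j)\<^sup>2 \<le> a_max\<^sup>2"
        by (metis abs_ge_zero power2_abs power_mono)
    qed
    finally show ?thesis by simp
  qed
  then show "(norm sd)\<^sup>2 \<le> (norm ((\<chi> i j. a_max) :: real^'n^'n))\<^sup>2"
    unfolding norm_matrix_sq by (intro sum_mono) simp
qed simp

text \<open>The right side is free of \<epsilon>, so \<open>M_const\<close> stays bounded in heavy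
  traffic.\<close>

lemma M_const_le: "M_const r a_max nu lam sd \<le> M_const r a_max nu nu (\<chi> i j. a_max)"
proof -
  have "(norm lam)\<^sup>2 + (norm sd)\<^sup>2 \<le> (norm nu)\<^sup>2 + (norm ((\<chi> i j. a_max) :: real^'n^'n))\<^sup>2"
    using norm_lam_le norm_sd_le by (intro add_mono power_mono) auto
  then show ?thesis
    using nu(2) unfolding M_const_def Let_def
    by (intro mult_left_mono max.mono order_refl divide_right_mono) auto
qed

lemma min_entry_le_1: "min_entry nu \<le> 1"
proof -
  have "nu $ i $ j \<le> row_sum nu i" for i j
    unfolding row_sum_def by (rule member_le_sum) auto
  then show ?thesis
    using min_entry_le[of nu] nu_sums(1) by (metis order_trans)
qed

context
  fixes p :: "(nat^'n^'n) pmf" and \<theta> :: real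
  assumes stationary: "bind_pmf p K = p"
    and theta: "0 < \<theta>"
    and int_exp: "integrable (measure_pmf p) (\<lambda>x. exp (\<theta> * norm (real_mat x)))"
begin

lemma int_norm_square: "integrable (measure_pmf p) (\<lambda>x. (norm (real_mat x))\<^sup>2)"
proof (rule Bochner_Integration.integrable_bound[OF integrable_mult_right[OF int_exp, of "2 / \<theta>\<^sup>2"]])
  have "(norm (real_mat x))\<^sup>2 \<le> 2 / \<theta>\<^sup>2 * exp (\<theta> * norm (real_mat x))" for x :: "nat^'n^'n"
  proof -
    have "(\<theta> * norm (real_mat x))\<^sup>2 / 2 \<le> exp (\<theta> * norm (real_mat x))"
      using exp_lower_Taylor_quadratic[of "\<theta> * norm (real_mat x)"] theta
        mult_nonneg_nonneg[OF less_imp_le[OF theta] norm_ge_zero[of "real_mat x"]] by linarith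
    then show ?thesis using theta by (simp add: field_simps)
  qed
  then show "AE x in measure_pmf p. norm ((norm (real_mat x))\<^sup>2) \<le> norm (2 / \<theta>\<^sup>2 * exp (\<theta> * norm (real_mat x)))"
    by (auto simp: abs_mult)
qed simp

lemma int_norm: "integrable (measure_pmf p) (\<lambda>x. norm (real_mat x))"
  by (rule measure_pmf.square_integrable_imp_integrable[OF _ int_norm_square]) simp

lemma int_total: "integrable (measure_pmf p) (\<lambda>x. total (real_mat x))"
  by (rule Bochner_Integration.integrable_bound[OF integrable_mult_right[OF int_norm, of "(real CARD('n))\<^sup>2"]])
    (auto simp: total_le_norm)

lemma int_quad: "integrable (measure_pmf p) (\<lambda>x. quad (real_mat x) (real_mat x))"
proof (rule Bochner_Integration.integrable_bound[OF integrable_mult_right[OF int_norm_square, of "real CARD('n)"]])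
  show "AE x in measure_pmf p. norm (quad (real_mat x) (real_mat x)) \<le> norm (real CARD('n) * (norm (real_mat x))\<^sup>2)"
    by (auto simp: quad_self_eq_norm intro!: mult_left_mono power_mono norm_proj_le)
qed simp

lemma int_d: "integrable (measure_pmf p) d"
  by (rule Bochner_Integration.integrable_bound[OF int_norm]) (auto simp: d_nonneg d_le_norm)

text \<open>\<open>f\<close> is read at the next state and \<open>g\<close> at the current one;
  stationarity gives \<open>f\<close> the same mean at both times.\<close>

lemma E_stationary_le:
  fixes f g :: "nat^'n^'n \<Rightarrow> real"
  assumes f: "integrable (measure_pmf p) f" and g: "integrable (measure_pmf p) g"
    and le: "\<And>x s. s \<in> maxweight_schedules x \<Longrightarrow> (\<integral>a. f (next_queue x s a) \<partial>measure_pmf P) \<le> g x"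
  shows "(\<integral>x. f x \<partial>measure_pmf p) \<le> (\<integral>x. g x \<partial>measure_pmf p)"
proof -
  have f': "integrable (measure_pmf (bind_pmf p K)) f" using f by (simp add: stationary)
  have "(\<integral>x. f x \<partial>measure_pmf p) = (\<integral>x. (\<integral>y. f y \<partial>measure_pmf (K x)) \<partial>measure_pmf p)"
    using integral_bind_pmf'[OF f'] by (simp add: stationary)
  also have "\<dots> \<le> (\<integral>x. g x \<partial>measure_pmf p)"
    using integrable_inner_pmf[OF f'] g le by (intro integral_mono K_le)
  finally show ?thesis .
qed

lemma d_moment:
  assumes eps_le: "\<epsilon> \<le> min_entry nu / (2 * norm nu)" and r: "1 \<le> r"
  shows "integrable (measure_pmf p) (\<lambda>x. d x ^ r)"
    and "(\<integral>x. d x ^ r \<partial>measure_pmf p) \<le> M_const r a_max nu lam sd ^ r"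
proof -
  let ?m = "min_entry nu" and ?D = "real CARD('n) * a_max"
  have D: "0 < ?D" using card_ge_1 a_max by simp
  \<comment> \<open>\<open>drift_from_square\<close> with rate \<open>?m / 2\<close> yields this
    threshold and the drift \<open>?m / 4\<close>.\<close>
  interpret sd: stationary_drift K p d "L / (?m / 2)" "?m / 2 / 2" ?D
  proof unfold_locales
    show "(\<integral>y. d y \<partial>measure_pmf (K x)) \<le> d x - ?m / 2 / 2" if "L / (?m / 2) \<le> d x" for x
      using nu(2) that d_square_drift[OF eps_le] d_nonneg by (intro drift_from_square) auto
  qed (use finite_K stationary int_d d_nonneg L_pos nu(2) D d_increment in auto)
  show "integrable (measure_pmf p) (\<lambda>x. d x ^ r)"
    by (rule sd.moment_bound(1)[OF r])
  define A where "A = 8 * L / ?m"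
  define B where "B = 16 * (?D / ?m) * (?D + 1)"
  define B' where "B' = (sqrt (real r) * exp 1) powr (1 / real r) * 16 * (real r / exp 1) * (?D / ?m) * (?D + 1)"
  have A: "0 \<le> A" using L_pos nu(2) by (simp add: A_def)
  have B: "0 \<le> B" using D nu(2) by (simp add: B_def)
  have B': "B' ^ r = B ^ r * (sqrt (real r) * exp 1 * (real r / exp 1) ^ r)"
  proof -
    have "((sqrt (real r) * exp 1) powr (1 / real r)) ^ r = sqrt (real r) * exp 1"
      using r by (simp add: powr_realpow[symmetric] powr_powr)
    moreover have "B' = (sqrt (real r) * exp 1) powr (1 / real r) * (B * (real r / exp 1))"
      by (simp only: B'_def B_def mult_ac)
    ultimately show ?thesis by (simp only: power_mult_distrib) simp
  qed
  have "B' \<ge> 0" using D nu(2) by (simp add: B'_def)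
  \<comment> \<open>The left base equals \<open>4 * L / ?m\<close>, half of
    \<open>A\<close>.\<close>
  have "(2 * (L / (?m / 2))) ^ r \<le> A ^ r"
    using L_pos nu(2) by (intro power_mono) (auto simp: A_def divide_right_mono)
  moreover have "(4 * ?D * (?D + ?m / 2 / 2) / (?m / 2 / 2)) ^ r * fact r \<le> B ^ r * (sqrt (real r) * exp 1 * (real r / exp 1) ^ r)"
  proof (rule mult_mono)
    have "4 * ?D * (?D + ?m / 2 / 2) / (?m / 2 / 2) = 16 * (?D / ?m) * (?D + ?m / 4)"
      using nu(2) by (simp add: field_simps)
    \<comment> \<open>Here \<open>?m / 4 \<le> 1\<close>, because an entry of a doubly stochastic
      matrix is at most 1.\<close>
    also have "\<dots> \<le> B"
      unfolding B_def using D nu(2) min_entry_le_1 by (intro mult_left_mono) auto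
    finally have "4 * ?D * (?D + ?m / 2 / 2) / (?m / 2 / 2) \<le> B" .
    then show "(4 * ?D * (?D + ?m / 2 / 2) / (?m / 2 / 2)) ^ r \<le> B ^ r"
      by (rule power_mono) (intro divide_nonneg_nonneg mult_nonneg_nonneg add_nonneg_nonneg; use a_max nu(2) in simp)
    show "fact r \<le> sqrt (real r) * exp 1 * (real r / exp 1) ^ r"
      by (rule fact_le_stirling[OF r])
  qed (use B in auto)
  ultimately have "(\<integral>x. d x ^ r \<partial>measure_pmf p) \<le> (A ^ r + B' ^ r) / 2"
    using sd.moment_bound(2)[OF r] unfolding B' by simp
  also have "\<dots> \<le> (max A B' ^ r + max A B' ^ r) / 2"
    using A \<open>B' \<ge> 0\<close> by (intro divide_right_mono add_mono power_mono) auto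
  \<comment> \<open>The factor 2 is a relaxation that matches \<open>2 powr (1 / real r)\<close> in
    \<open>M_const\<close>.\<close>
  also have "\<dots> \<le> 2 * max A B' ^ r"
    using A by simp
  also have "\<dots> = (2 powr (1 / real r) * max A B') ^ r"
    using r by (simp add: power_mult_distrib powr_realpow[symmetric] powr_powr)
  also have "2 powr (1 / real r) * max A B' = M_const r a_max nu lam sd"
    by (simp only: M_const_def A_def B'_def L_def Let_def)
  finally show "(\<integral>x. d x ^ r \<partial>measure_pmf p) \<le> M_const r a_max nu lam sd ^ r" .
qed

text \<open>The stationary drift of \<open>n \<parallel>q\<^sub>\<parallel>\<parallel>\<^sup>2\<close> vanishes. The total unused service of a slot is the
  increment of the total queue plus the service deficit, so the error terms are functions of the
  next state, and stationarity also evaluates them.\<close>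

lemma E_queue_bounds:
  assumes eps_le: "\<epsilon> \<le> min_entry nu / (2 * norm nu)" and r: "2 \<le> r" and \<tau>: "0 < \<tau>"
  defines "N \<equiv> real CARD('n)"
  defines "c \<equiv> (2 - 1 / N) * (norm sd)\<^sup>2 + N * \<epsilon>\<^sup>2"
  defines "e \<equiv> 2 * N * ((\<integral>x. d x ^ r \<partial>measure_pmf p) / \<tau> ^ (r - 1) + \<tau> * (N * \<epsilon>))"
  shows "2 * \<epsilon> * (\<integral>x. total (real_mat x) \<partial>measure_pmf p) \<le> c + e"
    and "c - e - 2 * N * \<epsilon> \<le> 2 * \<epsilon> * (\<integral>x. total (real_mat x) \<partial>measure_pmf p)"
proof -
  let ?T = "\<lambda>x. total (real_mat x)" and ?V = "\<lambda>x. quad (real_mat x) (real_mat x)"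
  let ?g = "2 * N / \<tau> ^ (r - 1)"
  note int_dr = d_moment(1)[OF eps_le, of r]
  have [simp]: "integrable (measure_pmf p) (\<lambda>x. d x ^ r)" using r int_dr by simp
  note [simp] = int_total int_quad
  define IV where "IV = (\<integral>x. ?V x \<partial>measure_pmf p)"
  define IT where "IT = (\<integral>x. ?T x \<partial>measure_pmf p)"
  define Id where "Id = (\<integral>x. d x ^ r \<partial>measure_pmf p)"
  have e: "e = ?g * Id + 2 * N * \<tau> * N * \<epsilon>"
    by (simp add: e_def Id_def distrib_left)
  have "(\<integral>x. ?V x - ?g * d x ^ r - 2 * N * \<tau> * ?T x \<partial>measure_pmf p)
      \<le> (\<integral>x. ?V x - 2 * \<epsilon> * ?T x + c - 2 * N * \<tau> * ?T x + 2 * N * \<tau> * N * \<epsilon> \<partial>measure_pmf p)"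
  proof (rule E_stationary_le)
    fix x s :: "nat^'n^'n" assume s: "s \<in> maxweight_schedules x"
    let ?Y = "\<lambda>a. next_queue x s a" and ?S = "real_mat s" and ?X = "real_mat x"
    have "(\<integral>a. ?V (?Y a) - ?g * d (?Y a) ^ r - 2 * N * \<tau> * ?T (?Y a) \<partial>measure_pmf P) \<le>
        (\<integral>a. ?V x + (2 * quad ?X (real_mat a - ?S) + quad (real_mat a - ?S) (real_mat a - ?S))
          + 2 * N * \<tau> * (N - ?T x - total (real_mat a)) \<partial>measure_pmf P)"
    proof (intro integral_mono int_P)
      fix a
      interpret slot x s a by unfold_locales (rule maxweight_maximal[OF s])
      show "?V (?Y a) - ?g * d (?Y a) ^ r - 2 * N * \<tau> * ?T (?Y a) \<le>
          ?V x + (2 * quad ?X (real_mat a - ?S) + quad (real_mat a - ?S) (real_mat a - ?S))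
            + 2 * N * \<tau> * (N - ?T x - total (real_mat a))"
      proof -
        have "\<bar>quad Y u\<bar> \<le> N * (d (?Y a) ^ r / \<tau> ^ (r - 1)) + N * \<tau> * total u"
          using quad_Y_u[OF \<tau> r] by (simp add: N_def d_def distrib_left mult.assoc)
        moreover have "?g * d (?Y a) ^ r = 2 * (N * (d (?Y a) ^ r / \<tau> ^ (r - 1)))"
          by simp
        moreover have "2 * N * \<tau> * (N - ?T x - total (real_mat a)) + 2 * N * \<tau> * ?T (?Y a) = 2 * (N * \<tau> * total u)"
          by (simp add: total_u N_def algebra_simps)
        ultimately show ?thesis
          using quad_Y quad_self_nonneg[of u] by linarith
      qed
    qed
    also have "\<dots> = ?V x + (- 2 * \<epsilon> * ?T x + c) + 2 * N * \<tau> * (N - ?T x - (1 - \<epsilon>) * N)"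
      using E_quad_step[OF maxweight_maximal[OF s], of ?X] E_total
      by (simp add: c_def N_def)
    finally show "(\<integral>a. ?V (?Y a) - ?g * d (?Y a) ^ r - 2 * N * \<tau> * ?T (?Y a) \<partial>measure_pmf P) \<le>
        ?V x - 2 * \<epsilon> * ?T x + c - 2 * N * \<tau> * ?T x + 2 * N * \<tau> * N * \<epsilon>"
      by (simp add: algebra_simps)
  qed simp_all
  then have "IV - ?g * Id - 2 * N * \<tau> * IT \<le> IV - 2 * \<epsilon> * IT + c - 2 * N * \<tau> * IT + 2 * N * \<tau> * N * \<epsilon>"
    by (simp add: IV_def IT_def Id_def)
  then show "2 * \<epsilon> * (\<integral>x. ?T x \<partial>measure_pmf p) \<le> c + e"
    unfolding e IT_def[symmetric] by linarith
  \<comment> \<open>The lower bound must also absorb \<open>quad u u \<le> 2 * total u\<close>,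
    hence the additional 2 in the coefficient of the total queue.\<close>
  have "(\<integral>x. - ?V x - ?g * d x ^ r - (2 * N * \<tau> + 2) * ?T x \<partial>measure_pmf p)
      \<le> (\<integral>x. - ?V x + 2 * \<epsilon> * ?T x - c - (2 * N * \<tau> + 2) * ?T x + (2 * N * \<tau> + 2) * N * \<epsilon> \<partial>measure_pmf p)"
  proof (rule E_stationary_le)
    fix x s :: "nat^'n^'n" assume s: "s \<in> maxweight_schedules x"
    let ?Y = "\<lambda>a. next_queue x s a" and ?S = "real_mat s" and ?X = "real_mat x"
    have "(\<integral>a. - ?V (?Y a) - ?g * d (?Y a) ^ r - (2 * N * \<tau> + 2) * ?T (?Y a) \<partial>measure_pmf P) \<le>
        (\<integral>a. - ?V x - (2 * quad ?X (real_mat a - ?S) + quad (real_mat a - ?S) (real_mat a - ?S))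
          + (2 * N * \<tau> + 2) * (N - ?T x - total (real_mat a)) \<partial>measure_pmf P)"
    proof (intro integral_mono int_P)
      fix a
      interpret slot x s a by unfold_locales (rule maxweight_maximal[OF s])
      show "- ?V (?Y a) - ?g * d (?Y a) ^ r - (2 * N * \<tau> + 2) * ?T (?Y a) \<le>
          - ?V x - (2 * quad ?X (real_mat a - ?S) + quad (real_mat a - ?S) (real_mat a - ?S))
            + (2 * N * \<tau> + 2) * (N - ?T x - total (real_mat a))"
      proof -
        have "\<bar>quad Y u\<bar> \<le> N * (d (?Y a) ^ r / \<tau> ^ (r - 1)) + N * \<tau> * total u"
          using quad_Y_u[OF \<tau> r] by (simp add: N_def d_def distrib_left mult.assoc)
        moreover have "?g * d (?Y a) ^ r = 2 * (N * (d (?Y a) ^ r / \<tau> ^ (r - 1)))"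
          by simp
        moreover have "(2 * N * \<tau> + 2) * (N - ?T x - total (real_mat a)) + (2 * N * \<tau> + 2) * ?T (?Y a) =
            2 * (N * \<tau> * total u) + 2 * total u"
          by (simp add: total_u N_def algebra_simps)
        ultimately show ?thesis
          using quad_Y quad_u_le by linarith
      qed
    qed
    also have "\<dots> = - ?V x - (- 2 * \<epsilon> * ?T x + c) + (2 * N * \<tau> + 2) * (N - ?T x - (1 - \<epsilon>) * N)"
      using E_quad_step[OF maxweight_maximal[OF s], of ?X] E_total
      by (simp add: c_def N_def)
    finally show "(\<integral>a. - ?V (?Y a) - ?g * d (?Y a) ^ r - (2 * N * \<tau> + 2) * ?T (?Y a) \<partial>measure_pmf P) \<le>
        - ?V x + 2 * \<epsilon> * ?T x - c - (2 * N * \<tau> + 2) * ?T x + (2 * N * \<tau> + 2) * N * \<epsilon>"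
      by (simp add: algebra_simps)
  qed simp_all
  then have "- IV - ?g * Id - (2 * N * \<tau> + 2) * IT \<le>
      - IV + 2 * \<epsilon> * IT - c - (2 * N * \<tau> + 2) * IT + (2 * N * \<tau> + 2) * N * \<epsilon>"
    by (simp add: IV_def IT_def Id_def)
  moreover have "(2 * N * \<tau> + 2) * N * \<epsilon> = 2 * N * \<tau> * N * \<epsilon> + 2 * N * \<epsilon>"
    by (simp add: distrib_right)
  ultimately show "c - e - 2 * N * \<epsilon> \<le> 2 * \<epsilon> * (\<integral>x. ?T x \<partial>measure_pmf p)"
    unfolding e IT_def[symmetric] by linarith
qed

theorem stationary_queue_bounds:
  assumes eps_le: "\<epsilon> \<le> min_entry nu / (2 * norm nu)" and r: "2 \<le> r"
  shows "integrable (measure_pmf p) total_queue"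
    and "(1 - 1 / (2 * real CARD('n))) * (norm sd)\<^sup>2 / \<epsilon> - B1 r a_max nu lam sd \<epsilon>
      \<le> (\<integral>x. total_queue x \<partial>measure_pmf p)"
    and "(\<integral>x. total_queue x \<partial>measure_pmf p)
      \<le> (1 - 1 / (2 * real CARD('n))) * (norm sd)\<^sup>2 / \<epsilon> + B2 r a_max nu lam sd \<epsilon>"
proof -
  define N where "N = real CARD('n)"
  define M where "M = M_const r a_max nu lam sd"
  \<comment> \<open>With \<open>w ^ r = N * \<epsilon>\<close> and \<open>\<tau> = M / w\<close>,
    the moment term \<open>M ^ r / \<tau> ^ (r - 1)\<close> equals the service term
    \<open>\<tau> * (N * \<epsilon>)\<close>.\<close>
  define w where "w = (N * \<epsilon>) powr (1 / real r)"
  let ?T = "\<integral>x. total_queue x \<partial>measure_pmf p"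
  have N: "1 \<le> N" using card_ge_1 by (simp add: N_def)
  have M: "0 < M" by (simp add: M_def M_const_pos)
  have w: "0 < w" using N eps by (simp add: w_def)
  have wr: "w ^ r = N * \<epsilon>"
    using N eps r by (simp add: w_def powr_realpow[symmetric] powr_powr)
  have wr1: "w ^ (r - 1) = N * \<epsilon> / w"
    using wr w r by (cases r) (auto simp: field_simps)
  define e where "e = 2 * N * ((\<integral>x. d x ^ r \<partial>measure_pmf p) / (M / w) ^ (r - 1) + M / w * (N * \<epsilon>))"
  have "(\<integral>x. d x ^ r \<partial>measure_pmf p) / (M / w) ^ (r - 1) \<le> M ^ r / (M / w) ^ (r - 1)"
    using d_moment(2)[OF eps_le, of r] r M w by (intro divide_right_mono) (auto simp: M_def)
  also have "\<dots> = M * w ^ (r - 1)"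
    using M r by (cases r) (auto simp: power_divide)
  also have "\<dots> = M / w * (N * \<epsilon>)"
    unfolding wr1 by simp
  finally have le: "2 * N * ((\<integral>x. d x ^ r \<partial>measure_pmf p) / (M / w) ^ (r - 1) + M / w * (N * \<epsilon>))
      \<le> 2 * N * (M / w * (N * \<epsilon>) + M / w * (N * \<epsilon>))"
    using N by (intro mult_left_mono add_right_mono) auto
  define F where "F = 2 * (N\<^sup>2 / w) * M"
  have "2 * N * (M / w * (N * \<epsilon>) + M / w * (N * \<epsilon>)) = 2 * \<epsilon> * F"
    by (simp add: F_def power2_eq_square mult_ac)
  then have e: "e \<le> 2 * \<epsilon> * F"
    using le by (simp add: e_def)
  have pw: "N\<^sup>2 / w = N powr (2 - 1 / real r) * \<epsilon> powr (- 1 / real r)"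
    using N eps by (simp add: w_def powr_mult powr_diff powr_minus powr_numeral divide_inverse)
  have F: "F = 2 * (N powr (2 - 1 / real r) * \<epsilon> powr (- 1 / real r)) * M"
    by (simp only: F_def pw)
  define G where "G = (1 - 1 / (2 * N)) * (norm sd)\<^sup>2 / \<epsilon>"
  have c: "(2 - 1 / N) * (norm sd)\<^sup>2 + N * \<epsilon>\<^sup>2 = 2 * \<epsilon> * (G + N * \<epsilon> / 2)"
    using eps N by (simp add: G_def power2_eq_square field_simps)
  have tq: "total_queue = (\<lambda>x :: nat^'n^'n. total (real_mat x))"
    by (simp add: total_queue_eq fun_eq_iff)
  show "integrable (measure_pmf p) total_queue"
    unfolding tq by (rule int_total)
  note bounds = E_queue_bounds[OF eps_le r divide_pos_pos[OF M w], folded N_def, folded e_def tq, unfolded c]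
  have "2 * \<epsilon> * ?T \<le> 2 * \<epsilon> * (G + N * \<epsilon> / 2 + F)"
    using bounds(1) e by (simp add: tq distrib_left)
  then have "?T \<le> G + N * \<epsilon> / 2 + F"
    using eps by simp
  \<comment> \<open>Compared with the bound just obtained, \<open>B2\<close> is larger by
    \<open>N / 2\<close>.\<close>
  moreover have "B2 r a_max nu lam sd \<epsilon> = N * (1 + \<epsilon>) / 2 + F"
    by (simp add: B2_def Let_def F N_def M_def)
  ultimately have "?T \<le> G + B2 r a_max nu lam sd \<epsilon>"
    using N by (simp add: distrib_left add_divide_distrib)
  then show "?T \<le> (1 - 1 / (2 * real CARD('n))) * (norm sd)\<^sup>2 / \<epsilon> + B2 r a_max nu lam sd \<epsilon>"
    by (simp only: G_def N_def)
  have "2 * \<epsilon> * (G + N * \<epsilon> / 2 - F - N) \<le> 2 * \<epsilon> * ?T"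
    using bounds(2) e by (simp add: tq distrib_left right_diff_distrib mult_ac)
  then have "G + N * \<epsilon> / 2 - F - N \<le> ?T"
    using eps by simp
  moreover have "B1 r a_max nu lam sd \<epsilon> = - (N * \<epsilon> / 2) + N + (F + N\<^sup>2 / w * M)"
    unfolding pw by (simp add: B1_def Let_def F N_def M_def)
  \<comment> \<open>\<open>B1\<close> carries three copies of this term where \<open>F\<close> has
    two; the third is nonnegative slack.\<close>
  moreover have "0 \<le> N\<^sup>2 / w * M" using w M by simp
  ultimately have "G - B1 r a_max nu lam sd \<epsilon> \<le> ?T"
    by linarith
  then show "(1 - 1 / (2 * real CARD('n))) * (norm sd)\<^sup>2 / \<epsilon> - B1 r a_max nu lam sd \<epsilon> \<le> ?T"
    by (simp only: G_def N_def)
qed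

end

end

section \<open>Laws of the processes\<close>

context prob_space
begin

text \<open>\<open>Abs_pmf\<close> is meaningful here once the atoms carry all the mass, which
  \<open>measure_law\<close> derives from countability.\<close>

definition law :: "('a \<Rightarrow> 'b) \<Rightarrow> 'b pmf" where
  "law X = Abs_pmf (distr M (count_space UNIV) X)"

lemma measure_law:
  fixes X :: "'a \<Rightarrow> 'b::countable"
  assumes X: "random_variable (count_space UNIV) X"
  shows "measure_pmf (law X) = distr M (count_space UNIV) X"
proof -
  interpret D: prob_space "distr M (count_space UNIV) X"
    by (rule prob_space_distr[OF X])
  have "AE x in distr M (count_space UNIV) X. measure (distr M (count_space UNIV) X) {x} \<noteq> 0"
    by (subst D.AE_support_countable) (auto intro!: exI[of _ UNIV])
  then show ?thesis
    unfolding law_def by (subst Abs_pmf_inverse) (auto simp: D.prob_space_axioms)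
qed

lemma pmf_law:
  fixes X :: "'a \<Rightarrow> 'b::countable"
  assumes X: "random_variable (count_space UNIV) X"
  shows "pmf (law X) x = prob {\<omega> \<in> space M. X \<omega> = x}"
proof -
  have "pmf (law X) x = prob (X -` {x} \<inter> space M)"
    using X by (simp add: pmf.rep_eq measure_law measure_distr)
  also have "X -` {x} \<inter> space M = {\<omega> \<in> space M. X \<omega> = x}"
    by auto
  finally show ?thesis .
qed

lemma integral_law:
  fixes X :: "'a \<Rightarrow> 'b::countable" and f :: "'b \<Rightarrow> real"
  assumes X: "random_variable (count_space UNIV) X"
  shows "(\<integral>x. f x \<partial>measure_pmf (law X)) = expectation (\<lambda>\<omega>. f (X \<omega>))"
  unfolding measure_law[OF X] using X by (intro integral_distr) auto

lemma random_variable_Pair: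
  fixes X :: "'a \<Rightarrow> 'b::countable" and Y :: "'a \<Rightarrow> 'c::countable"
  assumes "random_variable (count_space UNIV) X" "random_variable (count_space UNIV) Y"
  shows "random_variable (count_space UNIV) (\<lambda>\<omega>. (X \<omega>, Y \<omega>))"
proof -
  have "(\<lambda>\<omega>. (X \<omega>, Y \<omega>)) -` {(x, y)} \<inter> space M = (X -` {x} \<inter> space M) \<inter> (Y -` {y} \<inter> space M)" for x y
    by auto
  then show ?thesis
    using assms by (auto simp: measurable_count_space_eq2_countable)
qed

lemma random_variable_comp:
  assumes "random_variable (count_space UNIV) X"
  shows "random_variable (count_space UNIV) (\<lambda>\<omega>. g (X \<omega>))"
  using assms by (rule measurable_compose) simp

lemma law_comp:
  fixes X :: "'a \<Rightarrow> 'b::countable" and g :: "'b \<Rightarrow> 'c::countable"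
  assumes X: "random_variable (count_space UNIV) X"
  shows "law (\<lambda>\<omega>. g (X \<omega>)) = map_pmf g (law X)"
proof (rule pmf_eqI)
  fix y
  have "pmf (law (\<lambda>\<omega>. g (X \<omega>))) y = prob {\<omega> \<in> space M. g (X \<omega>) = y}"
    by (rule pmf_law[OF random_variable_comp[OF X]])
  also have "\<dots> = prob (X -` (g -` {y}) \<inter> space M)"
    by (rule arg_cong[where f = prob]) auto
  also have "\<dots> = pmf (map_pmf g (law X)) y"
    using X by (simp add: pmf_map measure_law measure_distr)
  finally show "pmf (law (\<lambda>\<omega>. g (X \<omega>))) y = pmf (map_pmf g (law X)) y" .
qed

end

text \<open>The shape in which \<open>maxweight\<close> prescribes the conditional law: marginal
  probability times kernel probability.\<close>

lemma pmf_bind_Pair: "pmf (bind_pmf p (\<lambda>x. map_pmf (Pair x) (F x))) (x, y) = pmf p x * pmf (F x) y"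
proof -
  have "pmf (map_pmf (Pair x') (F x')) (x, y) = pmf (F x) y * indicator {x} x'" for x'
  proof -
    have "Pair x' -` {(x, y)} = (if x' = x then {y} else {})" by auto
    then show ?thesis by (simp add: pmf_map measure_pmf_single)
  qed
  then show ?thesis
    by (simp add: pmf_bind measure_pmf_single mult.commute)
qed

section \<open>From the stochastic model to the kernel\<close>

context maxweight_switch
begin

abbreviation arrival_law where "arrival_law \<equiv> law (a 0)"

lemma entry_measurable: "random_variable (count_space UNIV) (\<lambda>\<omega>. a t \<omega> $ i $ j)"
  using random_variable_comp[OF a_measurable, of "\<lambda>x. x $ i $ j" t] .

text \<open>Independence turns the joint probability into a product of marginals, and these are the
  same in every slot. Thus whole arrival matrices are identically distributed.\<close>

lemma prob_arrivals:
  "prob {\<omega> \<in> space M. a t \<omega> = z} = (\<Prod>(i, j)\<in>UNIV. prob {\<omega> \<in> space M. a 0 \<omega> $ i $ j = z $ i $ j})"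
proof -
  let ?X = "\<lambda>(t, i, j) \<omega>. a t \<omega> $ i $ j" and ?J = "range (\<lambda>(i, j). (t, i, j))"
  have "{\<omega> \<in> space M. a t \<omega> = z} = (\<Inter>k\<in>?J. ?X k -` {z $ fst (snd k) $ snd (snd k)} \<inter> space M)"
    by (auto simp: vec_eq_iff)
  also have "prob \<dots> = (\<Prod>k\<in>?J. prob (?X k -` {z $ fst (snd k) $ snd (snd k)} \<inter> space M))"
    by (intro indep_varsD[OF arrivals_indep]) auto
  also have "\<dots> = (\<Prod>(i, j)\<in>UNIV. prob ((\<lambda>\<omega>. a t \<omega> $ i $ j) -` {z $ i $ j} \<inter> space M))"
    by (subst prod.reindex) (auto simp: inj_on_def case_prod_beta)
  also have "\<dots> = (\<Prod>(i, j)\<in>UNIV. prob {\<omega> \<in> space M. a 0 \<omega> $ i $ j = z $ i $ j})"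
  proof (intro prod.cong refl, clarify)
    fix i j
    have "measure (distr M (count_space UNIV) (\<lambda>\<omega>. a t \<omega> $ i $ j)) {z $ i $ j} =
        measure (distr M (count_space UNIV) (\<lambda>\<omega>. a 0 \<omega> $ i $ j)) {z $ i $ j}"
      using arrivals_identical[of t i j] by simp
    then have "prob ((\<lambda>\<omega>. a t \<omega> $ i $ j) -` {z $ i $ j} \<inter> space M) =
        prob ((\<lambda>\<omega>. a 0 \<omega> $ i $ j) -` {z $ i $ j} \<inter> space M)"
      by (simp add: measure_distr entry_measurable)
    also have "(\<lambda>\<omega>. a 0 \<omega> $ i $ j) -` {z $ i $ j} \<inter> space M = {\<omega> \<in> space M. a 0 \<omega> $ i $ j = z $ i $ j}"
      by auto
    finally show "prob ((\<lambda>\<omega>. a t \<omega> $ i $ j) -` {z $ i $ j} \<inter> space M) =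
        prob {\<omega> \<in> space M. a 0 \<omega> $ i $ j = z $ i $ j}" .
  qed
  finally show ?thesis .
qed

lemma law_arrivals: "law (a t) = arrival_law"
  by (rule pmf_eqI) (simp add: pmf_law a_measurable prob_arrivals)

lemma zero_in_arrival_law: "0 \<in> set_pmf arrival_law"
proof -
  obtain e where "0 < e" "\<And>i j. e < prob {\<omega> \<in> space M. a 0 \<omega> $ i $ j = 0}"
    using arrivals_zero by blast
  then have "0 < (\<Prod>(i, j)\<in>UNIV. prob {\<omega> \<in> space M. a 0 \<omega> $ i $ j = (0 :: nat^'n^'n) $ i $ j})"
    by (intro prod_pos) (auto intro: less_trans)
  then have "0 < pmf arrival_law 0"
    unfolding pmf_law[OF a_measurable] prob_arrivals .
  then show ?thesis
    by (simp add: set_pmf_iff)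
qed

lemma arrival_law_bounded:
  assumes "x \<in> set_pmf arrival_law"
  shows "real (x $ i $ j) \<le> a_max"
proof -
  have "prob {\<omega> \<in> space M. a 0 \<omega> = x} \<noteq> 0"
    using assms by (simp add: set_pmf_iff pmf_law a_measurable)
  then have "{\<omega> \<in> space M. a 0 \<omega> = x} \<noteq> {}"
    by (metis measure_empty)
  then show ?thesis using arrivals_bounded by blast
qed

lemma arrival_law_mean: "(\<integral>x. real (x $ i $ j) \<partial>measure_pmf arrival_law) = lam $ i $ j"
  by (subst integral_law[OF a_measurable]) (rule arrivals_mean)

lemma arrival_law_cov:
  "(\<integral>x. (real (x $ i $ j) - lam $ i $ j) * (real (x $ k $ l) - lam $ k $ l) \<partial>measure_pmf arrival_law) =
    (if i = k \<and> j = l then (sd $ i $ j)\<^sup>2 else 0)"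
proof (cases "i = k \<and> j = l")
  case True
  have "expectation (\<lambda>\<omega>. (real (a 0 \<omega> $ i $ j) - lam $ i $ j)\<^sup>2) = (sd $ i $ j)\<^sup>2"
    using arrivals_variance[of 0 i j] by (simp add: arrivals_mean)
  then show ?thesis
    using True by (simp add: integral_law[OF a_measurable] power2_eq_square)
next
  case False
  let ?X = "\<lambda>(t, i, j) \<omega>. real (a t \<omega> $ i $ j) - lam $ i $ j"
  have int: "integrable M (?X (0, i, j))" for i j
  proof -
    have "real (a 0 \<omega> $ i $ j) \<le> a_max" if "\<omega> \<in> space M" for \<omega>
      using arrivals_bounded[OF that] .
    then have "integrable M (\<lambda>\<omega>. real (a 0 \<omega> $ i $ j))"
      using measurable_compose[OF entry_measurable, of real borel 0 i j]
      by (intro integrable_const_bound[where B = a_max]) auto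
    then show ?thesis by simp
  qed
  have "indep_vars (\<lambda>_. borel) ?X UNIV"
  proof -
    have "indep_vars (\<lambda>_. borel) (\<lambda>k \<omega>. (\<lambda>(t, i, j) x. real x - lam $ i $ j) k ((\<lambda>(t, i, j) \<omega>. a t \<omega> $ i $ j) k \<omega>)) UNIV"
      by (rule indep_vars_compose2[OF arrivals_indep]) simp
    moreover have "?X = (\<lambda>k \<omega>. (\<lambda>(t, i, j) x. real x - lam $ i $ j) k ((\<lambda>(t, i, j) \<omega>. a t \<omega> $ i $ j) k \<omega>))"
      by (auto simp: fun_eq_iff)
    ultimately show ?thesis by (simp only:)
  qed
  then have "indep_vars (\<lambda>_. borel) ?X {(0, i, j), (0, k, l)}"
    by (rule indep_vars_subset) auto
  then have "expectation (\<lambda>\<omega>. \<Prod>m\<in>{(0, i, j), (0, k, l)}. ?X m \<omega>) = (\<Prod>m\<in>{(0, i, j), (0, k, l)}. expectation (?X m))"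
    using int by (intro indep_vars_lebesgue_integral) auto
  then have "expectation (\<lambda>\<omega>. (real (a 0 \<omega> $ i $ j) - lam $ i $ j) * (real (a 0 \<omega> $ k $ l) - lam $ k $ l)) =
      expectation (?X (0, i, j)) * expectation (?X (0, k, l))"
    using False by auto
  also have "expectation (?X (0, i, j)) = 0"
  proof -
    have "integrable M (\<lambda>\<omega>. real (a 0 \<omega> $ i $ j))"
      using Bochner_Integration.integrable_add[OF int[of i j] integrable_const[of "lam $ i $ j"]] by simp
    then show ?thesis by (simp add: arrivals_mean prob_space)
  qed
  finally show ?thesis
    using False by (auto simp: integral_law[OF a_measurable])
qed

lemma past_measurable: "random_variable (count_space UNIV) (past q s a t)"
proof (induction t)
  case 0
  then show ?case by (simp add: past_def)
next
  case (Suc t)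
  have "past q s a (Suc t) = (\<lambda>\<omega>. (\<lambda>(h, x). h @ [x]) (past q s a t \<omega>, q t \<omega>, s t \<omega>, a t \<omega>))"
    by (simp add: past_def fun_eq_iff)
  also have "random_variable (count_space UNIV) \<dots>"
    by (rule random_variable_comp) (intro random_variable_Pair Suc q_measurable s_measurable a_measurable)
  finally show ?case .
qed

text \<open>The MaxWeight rule conditions on the past as well; mapping the past away leaves the
  joint law at one time.\<close>

lemma law_queue_schedule:
  "law (\<lambda>\<omega>. (q t \<omega>, s t \<omega>)) = bind_pmf (law (q t)) (\<lambda>x. map_pmf (Pair x) (pmf_of_set (maxweight_schedules x)))"
proof -
  let ?U = "\<lambda>x. pmf_of_set (maxweight_schedules x)"
  have m: "random_variable (count_space UNIV) (\<lambda>\<omega>. (past q s a t \<omega>, q t \<omega>))"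
    "random_variable (count_space UNIV) (\<lambda>\<omega>. ((past q s a t \<omega>, q t \<omega>), s t \<omega>))"
    by (intro random_variable_Pair past_measurable q_measurable s_measurable)+
  have "law (\<lambda>\<omega>. ((past q s a t \<omega>, q t \<omega>), s t \<omega>)) =
      bind_pmf (law (\<lambda>\<omega>. (past q s a t \<omega>, q t \<omega>))) (\<lambda>hx. map_pmf (Pair hx) (?U (snd hx)))"
  proof (rule pmf_eqI)
    fix k :: "(((nat^'n^'n) \<times> (nat^'n^'n) \<times> (nat^'n^'n)) list \<times> (nat^'n^'n)) \<times> (nat^'n^'n)"
    obtain h x y where k: "k = ((h, x), y)" by (metis prod.exhaust)
    show "pmf (law (\<lambda>\<omega>. ((past q s a t \<omega>, q t \<omega>), s t \<omega>))) k =
        pmf (bind_pmf (law (\<lambda>\<omega>. (past q s a t \<omega>, q t \<omega>))) (\<lambda>hx. map_pmf (Pair hx) (?U (snd hx)))) k"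
      using maxweight[of t h x y] unfolding k pmf_bind_Pair by (simp add: pmf_law m)
  qed
  then have "map_pmf (\<lambda>((h, x), y). (x, y)) (law (\<lambda>\<omega>. ((past q s a t \<omega>, q t \<omega>), s t \<omega>))) =
      bind_pmf (law (\<lambda>\<omega>. (past q s a t \<omega>, q t \<omega>))) (\<lambda>hx. map_pmf (Pair (snd hx)) (?U (snd hx)))"
    by (simp add: map_bind_pmf map_pmf_comp case_prod_beta)
  also have "\<dots> = bind_pmf (map_pmf snd (law (\<lambda>\<omega>. (past q s a t \<omega>, q t \<omega>)))) (\<lambda>x. map_pmf (Pair x) (?U x))"
    by (simp add: bind_map_pmf)
  finally show ?thesis
    using law_comp[OF m(1), of snd] law_comp[OF m(2), of "\<lambda>((h, x), y). (x, y)"] by simp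
qed

lemma law_queue_schedule_arrival:
  "law (\<lambda>\<omega>. ((q t \<omega>, s t \<omega>), a t \<omega>)) = pair_pmf (law (\<lambda>\<omega>. (q t \<omega>, s t \<omega>))) arrival_law"
proof (rule pmf_eqI)
  fix k :: "((nat^'n^'n) \<times> (nat^'n^'n)) \<times> (nat^'n^'n)"
  obtain x y z where k: "k = ((x, y), z)" by (metis prod.exhaust)
  have m: "random_variable (count_space UNIV) (\<lambda>\<omega>. (q t \<omega>, s t \<omega>))"
    "random_variable (count_space UNIV) (\<lambda>\<omega>. ((q t \<omega>, s t \<omega>), a t \<omega>))"
    by (intro random_variable_Pair q_measurable s_measurable a_measurable)+
  let ?H = "\<lambda>\<omega>. (past q s a t \<omega>, q t \<omega>, s t \<omega>)"
  have "prob ((a t -` {z} \<inter> space M) \<inter> (?H -` {(h, x', y'). x' = x \<and> y' = y} \<inter> space M)) =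
      prob (a t -` {z} \<inter> space M) * prob (?H -` {(h, x', y'). x' = x \<and> y' = y} \<inter> space M)"
    by (rule arrivals_indep_past[of t, unfolded indep_sets2_eq, THEN conjunct2, THEN conjunct2, rule_format]) blast+
  moreover have "(a t -` {z} \<inter> space M) \<inter> (?H -` {(h, x', y'). x' = x \<and> y' = y} \<inter> space M) =
      {\<omega> \<in> space M. ((q t \<omega>, s t \<omega>), a t \<omega>) = k}"
    "a t -` {z} \<inter> space M = {\<omega> \<in> space M. a t \<omega> = z}"
    "?H -` {(h, x', y'). x' = x \<and> y' = y} \<inter> space M = {\<omega> \<in> space M. (q t \<omega>, s t \<omega>) = (x, y)}"
    by (auto simp: k)
  ultimately show "pmf (law (\<lambda>\<omega>. ((q t \<omega>, s t \<omega>), a t \<omega>))) k = pmf (pair_pmf (law (\<lambda>\<omega>. (q t \<omega>, s t \<omega>))) arrival_law) k"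
    unfolding k pmf_pair law_arrivals[of t, symmetric]
    by (simp only: pmf_law[OF m(1)] pmf_law[OF m(2)] pmf_law[OF a_measurable] k mult.commute)
qed

text \<open>Convergence in distribution concerns the one-time laws of \<open>q\<close>, and this
  recursion determines them from \<open>law (q 0)\<close>.\<close>

lemma law_queue_Suc:
  "law (q (Suc t)) = bind_pmf (law (q t)) (\<lambda>x. bind_pmf (pmf_of_set (maxweight_schedules x))
      (\<lambda>y. map_pmf (next_queue x y) arrival_law))"
proof -
  have m: "random_variable (count_space UNIV) (\<lambda>\<omega>. ((q t \<omega>, s t \<omega>), a t \<omega>))"
    by (intro random_variable_Pair q_measurable s_measurable a_measurable)
  let ?g = "\<lambda>((x, y), z). next_queue x y z"
  have "distr M (count_space UNIV) (q (Suc t)) = distr M (count_space UNIV) (\<lambda>\<omega>. ?g ((q t \<omega>, s t \<omega>), a t \<omega>))"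
    by (intro distr_cong) (auto simp: next_queue_def vec_eq_iff queue_evolution)
  then have "law (q (Suc t)) = law (\<lambda>\<omega>. ?g ((q t \<omega>, s t \<omega>), a t \<omega>))"
    by (simp add: law_def)
  also have "\<dots> = map_pmf ?g (law (\<lambda>\<omega>. ((q t \<omega>, s t \<omega>), a t \<omega>)))"
    by (rule law_comp[OF m])
  also have "\<dots> = bind_pmf (law (q t)) (\<lambda>x. bind_pmf (pmf_of_set (maxweight_schedules x))
      (\<lambda>y. map_pmf (next_queue x y) arrival_law))"
    unfolding law_queue_schedule_arrival law_queue_schedule
    by (simp only: pair_pmf_def map_pmf_def bind_assoc_pmf bind_return_pmf prod.case)
  finally show ?thesis .
qed

lemma switch_chain:
  assumes "nu \<in> doubly_stochastic" "0 < min_entry nu" "0 < \<epsilon>" "\<epsilon> < 1" "lam = (1 - \<epsilon>) *\<^sub>R nu" "1 \<le> a_max"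
  shows "switch_chain arrival_law nu lam sd \<epsilon> a_max"
  by (rule switch_chain.intro)
    (rule assms arrival_law_bounded arrival_law_mean arrival_law_cov zero_in_arrival_law; assumption?)+

theorem steady_state:
  assumes nu: "nu \<in> doubly_stochastic" "0 < min_entry nu" and eps: "0 < \<epsilon>" "\<epsilon> < 1"
    and lam: "lam = (1 - \<epsilon>) *\<^sub>R nu" and a_max: "1 \<le> a_max"
  shows "\<exists>p. converges_in_distribution (\<lambda>t. distr M (count_space UNIV) (q t)) (measure_pmf p) \<and>
    (\<forall>r. \<epsilon> \<le> min_entry nu / (2 * norm nu) \<and> 2 \<le> r \<longrightarrow>
       integrable (measure_pmf p) total_queue \<and>
       (1 - 1 / (2 * real CARD('n))) * (norm sd)\<^sup>2 / \<epsilon> - B1 r a_max nu lam sd \<epsilon>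
         \<le> measure_pmf.expectation p total_queue \<and>
       measure_pmf.expectation p total_queue
         \<le> (1 - 1 / (2 * real CARD('n))) * (norm sd)\<^sup>2 / \<epsilon> + B2 r a_max nu lam sd \<epsilon>)"
proof -
  interpret C: switch_chain arrival_law nu lam sd \<epsilon> a_max
    by (rule switch_chain[OF assms])
  obtain \<theta> \<gamma> c where \<theta>: "0 < \<theta>" and L: "lyapunov_chain C.K (\<lambda>x. exp (\<theta> * norm (real_mat x))) \<gamma> c 0"
    using C.lyapunov by blast
  interpret L: lyapunov_chain C.K "\<lambda>x. exp (\<theta> * norm (real_mat x))" \<gamma> c 0
    by (rule L)
  have law_q: "law (q t) = bind_pmf (law (q 0)) (kernel_pow C.K t)" for t
  proof (induction t)
    case 0
    then show ?case by (simp add: bind_return_pmf')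
  next
    case (Suc t)
    then show ?case
      by (simp add: law_queue_Suc bind_assoc_pmf C.K_def[abs_def])
  qed
  have "(\<lambda>t. integral\<^sup>L (distr M (count_space UNIV) (q t)) f) \<longlonglongrightarrow> measure_pmf.expectation L.\<pi> f"
    if "bounded (range f)" for f :: "nat^'n^'n \<Rightarrow> real"
  proof -
    obtain b where b: "\<And>x. \<bar>f x\<bar> \<le> b"
      using \<open>bounded (range f)\<close> by (auto simp: bounded_iff)
    show ?thesis
      using L.converges_to_stationary[of f b "law (q 0)", OF b]
      by (simp add: law_q[symmetric] measure_law[OF q_measurable])
  qed
  then have conv: "converges_in_distribution (\<lambda>t. distr M (count_space UNIV) (q t)) (measure_pmf L.\<pi>)"
    by (simp add: converges_in_distribution_def)
  show ?thesis
  proof (intro exI[of _ L.\<pi>] conjI[OF conv] allI impI, elim conjE)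
    fix r :: nat assume r: "\<epsilon> \<le> min_entry nu / (2 * norm nu)" "2 \<le> r"
    note bounds = C.stationary_queue_bounds[OF L.stationary \<theta> L.integrable_stationary r]
    show "integrable (measure_pmf L.\<pi>) total_queue \<and>
       (1 - 1 / (2 * real CARD('n))) * (norm sd)\<^sup>2 / \<epsilon> - B1 r a_max nu lam sd \<epsilon>
         \<le> measure_pmf.expectation L.\<pi> total_queue \<and>
       measure_pmf.expectation L.\<pi> total_queue
         \<le> (1 - 1 / (2 * real CARD('n))) * (norm sd)\<^sup>2 / \<epsilon> + B2 r a_max nu lam sd \<epsilon>"
      by (intro conjI bounds)
  qed
qed

end

section \<open>Heavy traffic limit\<close>

lemma powr_at_right_0: "((\<lambda>\<epsilon>. \<epsilon> powr c) \<longlongrightarrow> 0) (at_right (0::real))" if "0 < c"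
  using that by (intro tendsto_zero_powrI[where b = c] tendsto_intros)
    (auto simp: eventually_at_right_field intro!: exI[of _ 1])

text \<open>The singular term becomes \<epsilon> to the power 1 - 1/r, positive for r \<ge> 2;
  boundedness of \<open>M\<close> suffices.\<close>

lemma eps_error_tendsto_0:
  fixes B M :: "real \<Rightarrow> real"
  assumes r: "2 \<le> (r :: nat)"
    and B: "\<And>\<epsilon>. 0 < \<epsilon> \<Longrightarrow> \<epsilon> < 1 \<Longrightarrow> B \<epsilon> = b * \<epsilon> + c + k * \<epsilon> powr (- 1 / real r) * M \<epsilon>"
    and M: "\<And>\<epsilon>. 0 < \<epsilon> \<Longrightarrow> \<epsilon> < 1 \<Longrightarrow> \<bar>M \<epsilon>\<bar> \<le> m"
  shows "((\<lambda>\<epsilon>. \<epsilon> * B \<epsilon>) \<longlongrightarrow> 0) (at_right 0)"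
proof (rule Lim_null_comparison)
  have ev: "\<forall>\<^sub>F \<epsilon> in at_right (0::real). 0 < \<epsilon> \<and> \<epsilon> < 1"
    by (auto simp: eventually_at_right_field intro!: exI[of _ 1])
  show "\<forall>\<^sub>F \<epsilon> in at_right 0. norm (\<epsilon> * B \<epsilon>) \<le> \<bar>b\<bar> * \<epsilon>\<^sup>2 + \<bar>c\<bar> * \<epsilon> + \<bar>k\<bar> * \<epsilon> powr (1 - 1 / real r) * m"
    using ev
  proof eventually_elim
    case (elim \<epsilon>)
    have "\<epsilon> * B \<epsilon> = b * \<epsilon>\<^sup>2 + c * \<epsilon> + k * (\<epsilon> * \<epsilon> powr (- 1 / real r)) * M \<epsilon>"
      using B[of \<epsilon>] elim by (simp add: power2_eq_square algebra_simps)
    also have "\<epsilon> * \<epsilon> powr (- 1 / real r) = \<epsilon> powr (1 - 1 / real r)"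
      using elim by (simp add: powr_diff powr_minus divide_inverse)
    finally have "\<bar>\<epsilon> * B \<epsilon>\<bar> \<le> \<bar>b * \<epsilon>\<^sup>2\<bar> + \<bar>c * \<epsilon>\<bar> + \<bar>k * \<epsilon> powr (1 - 1 / real r) * M \<epsilon>\<bar>"
      by linarith
    also have "\<dots> \<le> \<bar>b\<bar> * \<epsilon>\<^sup>2 + \<bar>c\<bar> * \<epsilon> + \<bar>k\<bar> * \<epsilon> powr (1 - 1 / real r) * m"
      using elim M[of \<epsilon>] by (auto simp: abs_mult intro!: add_mono mult_left_mono)
    finally show ?case by simp
  qed
  have "((\<lambda>\<epsilon>. \<bar>b\<bar> * \<epsilon>\<^sup>2 + \<bar>c\<bar> * \<epsilon> + \<bar>k\<bar> * \<epsilon> powr (1 - 1 / real r) * m) \<longlongrightarrow>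
      \<bar>b\<bar> * 0\<^sup>2 + \<bar>c\<bar> * 0 + \<bar>k\<bar> * 0 * m) (at_right 0)"
    using r by (intro tendsto_intros powr_at_right_0) auto
  then show "((\<lambda>\<epsilon>. \<bar>b\<bar> * \<epsilon>\<^sup>2 + \<bar>c\<bar> * \<epsilon> + \<bar>k\<bar> * \<epsilon> powr (1 - 1 / real r) * m) \<longlongrightarrow> 0) (at_right 0)"
    by simp
qed

theorem theorem1:
  fixes nu :: "real^'n::finite^'n"
    and a_max :: real
    and lam sd :: "real \<Rightarrow> real^'n^'n"
    and M :: "real \<Rightarrow> 'w measure"
    and a s q :: "real \<Rightarrow> nat \<Rightarrow> 'w \<Rightarrow> nat^'n^'n"
  assumes "nu \<in> doubly_stochastic"
    and "0 < min_entry nu"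
    and "1 \<le> a_max"
    and "\<And>\<epsilon>. 0 < \<epsilon> \<Longrightarrow> \<epsilon> < 1 \<Longrightarrow> lam \<epsilon> = (1 - \<epsilon>) *\<^sub>R nu"
    and "\<And>\<epsilon>. 0 < \<epsilon> \<Longrightarrow> \<epsilon> < 1 \<Longrightarrow>
           maxweight_switch (M \<epsilon>) a_max (lam \<epsilon>) (sd \<epsilon>) (a \<epsilon>) (s \<epsilon>) (q \<epsilon>)"
  shows "\<exists>qbar :: real \<Rightarrow> (nat^'n^'n) pmf.
    (\<forall>\<epsilon>. 0 < \<epsilon> \<and> \<epsilon> < 1 \<longrightarrow>
       converges_in_distribution
         (\<lambda>t. distr (M \<epsilon>) (count_space UNIV) (q \<epsilon> t)) (measure_pmf (qbar \<epsilon>))) \<and>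
    (\<forall>\<epsilon> r. 0 < \<epsilon> \<and> \<epsilon> \<le> min_entry nu / (2 * norm nu) \<and> 2 \<le> r \<longrightarrow>
       integrable (measure_pmf (qbar \<epsilon>)) total_queue \<and>
       (1 - 1 / (2 * real CARD('n))) * (norm (sd \<epsilon>))\<^sup>2 / \<epsilon>
           - B1 r a_max nu (lam \<epsilon>) (sd \<epsilon>) \<epsilon>
         \<le> measure_pmf.expectation (qbar \<epsilon>) total_queue \<and>
       measure_pmf.expectation (qbar \<epsilon>) total_queue
         \<le> (1 - 1 / (2 * real CARD('n))) * (norm (sd \<epsilon>))\<^sup>2 / \<epsilon>
           + B2 r a_max nu (lam \<epsilon>) (sd \<epsilon>) \<epsilon>) \<and>
    (\<forall>r\<ge>2. ((\<lambda>\<epsilon>. \<epsilon> * B1 r a_max nu (lam \<epsilon>) (sd \<epsilon>) \<epsilon>) \<longlongrightarrow> 0) (at_right 0) \<and>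
            ((\<lambda>\<epsilon>. \<epsilon> * B2 r a_max nu (lam \<epsilon>) (sd \<epsilon>) \<epsilon>) \<longlongrightarrow> 0) (at_right 0)) \<and>
    (\<forall>sd0 :: real^'n^'n.
       (\<forall>i j. ((\<lambda>\<epsilon>. (sd \<epsilon> $ i $ j)\<^sup>2) \<longlongrightarrow> (sd0 $ i $ j)\<^sup>2) (at_right 0)) \<longrightarrow>
       ((\<lambda>\<epsilon>. \<epsilon> * measure_pmf.expectation (qbar \<epsilon>) total_queue)
          \<longlongrightarrow> (1 - 1 / (2 * real CARD('n))) * (norm sd0)\<^sup>2) (at_right 0))"
proof -
  let ?N = "real CARD('n)"
  let ?\<epsilon>0 = "min_entry nu / (2 * norm nu)"
  let ?\<alpha> = "1 - 1 / (2 * ?N)"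
  have "\<exists>p. converges_in_distribution (\<lambda>t. distr (M \<epsilon>) (count_space UNIV) (q \<epsilon> t)) (measure_pmf p) \<and>
    (\<forall>r. \<epsilon> \<le> ?\<epsilon>0 \<and> 2 \<le> r \<longrightarrow>
       integrable (measure_pmf p) total_queue \<and>
       ?\<alpha> * (norm (sd \<epsilon>))\<^sup>2 / \<epsilon> - B1 r a_max nu (lam \<epsilon>) (sd \<epsilon>) \<epsilon>
         \<le> measure_pmf.expectation p total_queue \<and>
       measure_pmf.expectation p total_queue
         \<le> ?\<alpha> * (norm (sd \<epsilon>))\<^sup>2 / \<epsilon> + B2 r a_max nu (lam \<epsilon>) (sd \<epsilon>) \<epsilon>)" if "0 < \<epsilon>" "\<epsilon> < 1" for \<epsilon>
    by (rule maxweight_switch.steady_state[OF assms(5)[OF that] assms(1,2) that assms(4)[OF that] assms(3)])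
  then obtain qbar where conv: "\<And>\<epsilon>. 0 < \<epsilon> \<Longrightarrow> \<epsilon> < 1 \<Longrightarrow>
      converges_in_distribution (\<lambda>t. distr (M \<epsilon>) (count_space UNIV) (q \<epsilon> t)) (measure_pmf (qbar \<epsilon>))"
    and bounds: "\<And>\<epsilon> r. 0 < \<epsilon> \<Longrightarrow> \<epsilon> < 1 \<Longrightarrow> \<epsilon> \<le> ?\<epsilon>0 \<and> 2 \<le> r \<longrightarrow>
       integrable (measure_pmf (qbar \<epsilon>)) total_queue \<and>
       ?\<alpha> * (norm (sd \<epsilon>))\<^sup>2 / \<epsilon> - B1 r a_max nu (lam \<epsilon>) (sd \<epsilon>) \<epsilon>
         \<le> measure_pmf.expectation (qbar \<epsilon>) total_queue \<and>
       measure_pmf.expectation (qbar \<epsilon>) total_queue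
         \<le> ?\<alpha> * (norm (sd \<epsilon>))\<^sup>2 / \<epsilon> + B2 r a_max nu (lam \<epsilon>) (sd \<epsilon>) \<epsilon>"
    by metis
  obtain i :: 'n where True by blast
  have nu_le: "min_entry nu \<le> norm nu"
    using min_entry_le[of nu i i] abs_entry_le_norm[of nu i i] by linarith
  \<comment> \<open>Since \<open>min_entry nu \<le> norm nu\<close>, the threshold is at most 1/2,
    so the bounds are claimed only where the systems are specified.\<close>
  have \<epsilon>0: "0 < ?\<epsilon>0" "?\<epsilon>0 < 1"
  proof -
    have "0 < norm nu" using assms(2) nu_le by linarith
    then show "0 < ?\<epsilon>0" "?\<epsilon>0 < 1"
      using assms(2) nu_le by (auto simp: pos_divide_less_eq)
  qed
  have M_bounds: "\<bar>M_const r a_max nu (lam \<epsilon>) (sd \<epsilon>)\<bar> \<le> M_const r a_max nu nu (\<chi> i j. a_max)"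
    if "0 < \<epsilon>" "\<epsilon> < 1" for \<epsilon> r
  proof -
    interpret maxweight_switch "M \<epsilon>" a_max "lam \<epsilon>" "sd \<epsilon>" "a \<epsilon>" "s \<epsilon>" "q \<epsilon>"
      by (rule assms(5)[OF that])
    interpret C: switch_chain arrival_law nu "lam \<epsilon>" "sd \<epsilon>" \<epsilon> a_max
      by (rule switch_chain[OF assms(1,2) that assms(4)[OF that] assms(3)])
    show ?thesis
      using C.M_const_pos[of r] C.M_const_le[of r] by simp
  qed
  have B1: "((\<lambda>\<epsilon>. \<epsilon> * B1 r a_max nu (lam \<epsilon>) (sd \<epsilon>) \<epsilon>) \<longlongrightarrow> 0) (at_right 0)" if "2 \<le> r" for r
    by (rule eps_error_tendsto_0[OF that, where b = "- ?N / 2" and c = ?N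
          and k = "3 * ?N powr (2 - 1 / real r)", OF _ M_bounds[of _ r]]) (auto simp: B1_def Let_def)
  have B2: "((\<lambda>\<epsilon>. \<epsilon> * B2 r a_max nu (lam \<epsilon>) (sd \<epsilon>) \<epsilon>) \<longlongrightarrow> 0) (at_right 0)" if "2 \<le> r" for r
    by (rule eps_error_tendsto_0[OF that, where b = "?N / 2" and c = "?N / 2"
          and k = "2 * ?N powr (2 - 1 / real r)", OF _ M_bounds[of _ r]]) (auto simp: B2_def Let_def algebra_simps add_divide_distrib)
  \<comment> \<open>A sandwich with the fixed exponent r = 2; both errors vanish after
    multiplication by \<epsilon>.\<close>
  have lim: "((\<lambda>\<epsilon>. \<epsilon> * measure_pmf.expectation (qbar \<epsilon>) total_queue) \<longlongrightarrow> ?\<alpha> * (norm sd0)\<^sup>2) (at_right 0)"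
    if sd0: "\<And>i j. ((\<lambda>\<epsilon>. (sd \<epsilon> $ i $ j)\<^sup>2) \<longlongrightarrow> (sd0 $ i $ j)\<^sup>2) (at_right 0)" for sd0 :: "real^'n^'n"
  proof (rule tendsto_sandwich)
    have ev: "\<forall>\<^sub>F \<epsilon> in at_right (0::real). 0 < \<epsilon> \<and> \<epsilon> \<le> ?\<epsilon>0"
      using \<epsilon>0 by (auto simp: eventually_at_right_field intro!: exI[of _ ?\<epsilon>0])
    have norm: "((\<lambda>\<epsilon>. (norm (sd \<epsilon>))\<^sup>2) \<longlongrightarrow> (norm sd0)\<^sup>2) (at_right 0)"
      unfolding norm_matrix_sq by (intro tendsto_sum sd0)
    show "((\<lambda>\<epsilon>. ?\<alpha> * (norm (sd \<epsilon>))\<^sup>2 - \<epsilon> * B1 2 a_max nu (lam \<epsilon>) (sd \<epsilon>) \<epsilon>) \<longlongrightarrow> ?\<alpha> * (norm sd0)\<^sup>2) (at_right 0)"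
      using tendsto_diff[OF tendsto_mult_left[OF norm, of ?\<alpha>] B1[of 2]] by simp
    show "((\<lambda>\<epsilon>. ?\<alpha> * (norm (sd \<epsilon>))\<^sup>2 + \<epsilon> * B2 2 a_max nu (lam \<epsilon>) (sd \<epsilon>) \<epsilon>) \<longlongrightarrow> ?\<alpha> * (norm sd0)\<^sup>2) (at_right 0)"
      using tendsto_add[OF tendsto_mult_left[OF norm, of ?\<alpha>] B2[of 2]] by simp
    have scaled: "?\<alpha> * (norm (sd \<epsilon>))\<^sup>2 - \<epsilon> * B1 2 a_max nu (lam \<epsilon>) (sd \<epsilon>) \<epsilon> \<le> \<epsilon> * measure_pmf.expectation (qbar \<epsilon>) total_queue"
      "\<epsilon> * measure_pmf.expectation (qbar \<epsilon>) total_queue \<le> ?\<alpha> * (norm (sd \<epsilon>))\<^sup>2 + \<epsilon> * B2 2 a_max nu (lam \<epsilon>) (sd \<epsilon>) \<epsilon>"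
      if \<epsilon>: "0 < \<epsilon> \<and> \<epsilon> \<le> ?\<epsilon>0" for \<epsilon>
    proof -
      have "\<epsilon> < 1" using \<epsilon> \<epsilon>0 by linarith
      then have *: "?\<alpha> * (norm (sd \<epsilon>))\<^sup>2 / \<epsilon> - B1 2 a_max nu (lam \<epsilon>) (sd \<epsilon>) \<epsilon> \<le> measure_pmf.expectation (qbar \<epsilon>) total_queue"
        "measure_pmf.expectation (qbar \<epsilon>) total_queue \<le> ?\<alpha> * (norm (sd \<epsilon>))\<^sup>2 / \<epsilon> + B2 2 a_max nu (lam \<epsilon>) (sd \<epsilon>) \<epsilon>"
        using bounds[of \<epsilon> 2] \<epsilon> by auto
      have \<epsilon>': "0 \<le> \<epsilon>" "\<epsilon> \<noteq> 0" using \<epsilon> by auto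
      show "?\<alpha> * (norm (sd \<epsilon>))\<^sup>2 - \<epsilon> * B1 2 a_max nu (lam \<epsilon>) (sd \<epsilon>) \<epsilon> \<le> \<epsilon> * measure_pmf.expectation (qbar \<epsilon>) total_queue"
        using mult_left_mono[OF *(1) \<epsilon>'(1)] \<epsilon>'(2) by (simp add: right_diff_distrib)
      show "\<epsilon> * measure_pmf.expectation (qbar \<epsilon>) total_queue \<le> ?\<alpha> * (norm (sd \<epsilon>))\<^sup>2 + \<epsilon> * B2 2 a_max nu (lam \<epsilon>) (sd \<epsilon>) \<epsilon>"
        using mult_left_mono[OF *(2) \<epsilon>'(1)] \<epsilon>'(2) by (simp add: distrib_left)
    qed
    show "\<forall>\<^sub>F \<epsilon> in at_right 0. ?\<alpha> * (norm (sd \<epsilon>))\<^sup>2 - \<epsilon> * B1 2 a_max nu (lam \<epsilon>) (sd \<epsilon>) \<epsilon>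
        \<le> \<epsilon> * measure_pmf.expectation (qbar \<epsilon>) total_queue"
      using ev by eventually_elim (rule scaled)
    show "\<forall>\<^sub>F \<epsilon> in at_right 0. \<epsilon> * measure_pmf.expectation (qbar \<epsilon>) total_queue
        \<le> ?\<alpha> * (norm (sd \<epsilon>))\<^sup>2 + \<epsilon> * B2 2 a_max nu (lam \<epsilon>) (sd \<epsilon>) \<epsilon>"
      using ev by eventually_elim (rule scaled)
  qed
  show ?thesis
  proof (intro exI[of _ qbar] conjI)
    show "\<forall>\<epsilon>. 0 < \<epsilon> \<and> \<epsilon> < 1 \<longrightarrow>
       converges_in_distribution
         (\<lambda>t. distr (M \<epsilon>) (count_space UNIV) (q \<epsilon> t)) (measure_pmf (qbar \<epsilon>))"
      using conv by blast
    show "\<forall>\<epsilon> r. 0 < \<epsilon> \<and> \<epsilon> \<le> ?\<epsilon>0 \<and> 2 \<le> r \<longrightarrow>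
       integrable (measure_pmf (qbar \<epsilon>)) total_queue \<and>
       ?\<alpha> * (norm (sd \<epsilon>))\<^sup>2 / \<epsilon> - B1 r a_max nu (lam \<epsilon>) (sd \<epsilon>) \<epsilon>
         \<le> measure_pmf.expectation (qbar \<epsilon>) total_queue \<and>
       measure_pmf.expectation (qbar \<epsilon>) total_queue
         \<le> ?\<alpha> * (norm (sd \<epsilon>))\<^sup>2 / \<epsilon> + B2 r a_max nu (lam \<epsilon>) (sd \<epsilon>) \<epsilon>"
      using bounds \<epsilon>0(2) by (meson le_less_trans)
  qed (use B1 B2 lim in blast)+
qed

end
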